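(* Let $q\in\mathbb{C}^\times$ be not a root of unity. The assignment $\varphi\mapsto L(\mathbf{u}^{\langle0\rangle}(\varphi))$ gives a bijection between $\mathbb{C}[x]^{\langle0\rangle}$ and the set of isomorphism classes of finite dimensional simple $U_q(\mathfrak{sl}_2^{\langle0\rangle}[x])$-modules.
   Context: $[k]=(q^k-q^{-k})/(q-q^{-1})$, $[x,y]=xy-yx$. $U_q(\mathfrak{sl}_2^{\langle0\rangle}[x])$ is the $\mathbb{C}$-algebra with generators $X^\pm_t,J_t$ ($t\ge0$), $K^\pm$ and relations: $K^+$ and all $J_t$ pairwise commute; $K^+K^-=1=K^-K^+$; $(K^-)^2=1-(q-q^{-1})J_0$; $X^\pm_{t+1}X^\pm_s-q^{\pm2}X^\pm_sX^\pm_{t+1}=q^{\pm2}X^\pm_tX^\pm_{s+1}-X^\pm_{s+1}X^\pm_t$; $K^+X^\pm_tK^-=q^{\pm2}X^\pm_t$; $q^{\pm2}J_0X^\pm_t-q^{\mp2}X^\pm_tJ_0=\pm[2]X^\pm_t$; $[J_{s+1},X^\pm_t]=q^{\pm2}J_sX^\pm_{t+1}-q^{\mp2}X^\pm_{t+1}J_s$; $[X^+_t,X^-_s]=K^+J_{s+t}$. For $\mathbf{u}=(\lambda,(u_t)_{t>0})\in\mathbb{C}^\times\times\prod_{t>0}\mathbb{C}$, $L(\mathbf{u})$ is the simple module generated by $v_0$ with $X^+_tv_0=0$ ($t\ge0$), $K^+v_0=\lambda v_0$, $J_tv_0=u_tv_0$ ($t>0$). $p_t(q)(x_1,\dots,x_k)=\sum_{\lambda\vdash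 t,\ell(\lambda)\le k}q^{-\ell(\lambda)}(q-q^{-1})^{\ell(\lambda)-1}m_\lambda(x_1,\dots,x_k)$ ($m_\lambda$ monomial symmetric). $\mathbb{C}[x]^{\langle0\rangle}$ is the set of polynomials $\varphi=\beta_\varphi(x-\gamma_1)\cdots(x-\gamma_k)$ with leading coefficient $\beta_\varphi=\pm1$, and $\mathbf{u}^{\langle0\rangle}(\varphi)=(\beta_\varphi,(0)_{t>0})$ if $k=0$, $(\beta_\varphi q^k,(p_t(q)(\gamma_1,\dots,\gamma_k))_{t>0})$ if $k>0$. *)

theory Defs
  imports "Jordan_Normal_Form.Matrix" "HOL-Computational_Algebra.Polynomial" "HOL-Library.Multiset"
begin

text \<open>A finite dimensional module of dimension n is given by n x n complex matrices
  representing the generators X^+_t, X^-_t, J_t (t a natural number), K^+, K^-.\<close>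

record umod =
  dim :: nat
  Xp :: "nat \<Rightarrow> complex mat"
  Xm :: "nat \<Rightarrow> complex mat"
  J :: "nat \<Rightarrow> complex mat"
  Kp :: "complex mat"
  Km :: "complex mat"

definition qbr :: "complex \<Rightarrow> nat \<Rightarrow> complex" where
  "qbr q k = (q ^ k - inverse q ^ k) / (q - inverse q)"

definition comm :: "complex mat \<Rightarrow> complex mat \<Rightarrow> complex mat" where
  "comm A B = A * B - B * A"

definition is_umod :: "complex \<Rightarrow> umod \<Rightarrow> bool" where
  "is_umod q M \<longleftrightarrow>
    (let n = dim M in
     (\<forall>t. Xp M t \<in> carrier_mat n n \<and> Xm M t \<in> carrier_mat n n \<and> J M t \<in> carrier_mat n n) \<and>
     Kp M \<in> carrier_mat n n \<and> Km M \<in> carrier_mat n n \<and>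
     \<comment> \<open>K^+ and all J_t pairwise commute\<close>
     (\<forall>t. Kp M * J M t = J M t * Kp M) \<and>
     (\<forall>s t. J M s * J M t = J M t * J M s) \<and>
     \<comment> \<open>K^+ K^- = 1 = K^- K^+\<close>
     Kp M * Km M = 1\<^sub>m n \<and> Km M * Kp M = 1\<^sub>m n \<and>
     \<comment> \<open>(K^-)^2 = 1 - (q - q^{-1}) J_0\<close>
     Km M * Km M = 1\<^sub>m n - (q - inverse q) \<cdot>\<^sub>m J M 0 \<and>
     \<comment> \<open>X_{t+1} X_s - q^{+-2} X_s X_{t+1} = q^{+-2} X_t X_{s+1} - X_{s+1} X_t\<close>
     (\<forall>s t. Xp M (t+1) * Xp M s - (q^2) \<cdot>\<^sub>m (Xp M s * Xp M (t+1))
            = (q^2) \<cdot>\<^sub>m (Xp M t * Xp M (s+1)) - Xp M (s+1) * Xp M t) \<and>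
     (\<forall>s t. Xm M (t+1) * Xm M s - (inverse q^2) \<cdot>\<^sub>m (Xm M s * Xm M (t+1))
            = (inverse q^2) \<cdot>\<^sub>m (Xm M t * Xm M (s+1)) - Xm M (s+1) * Xm M t) \<and>
     \<comment> \<open>K^+ X_t K^- = q^{+-2} X_t\<close>
     (\<forall>t. Kp M * Xp M t * Km M = (q^2) \<cdot>\<^sub>m Xp M t) \<and>
     (\<forall>t. Kp M * Xm M t * Km M = (inverse q^2) \<cdot>\<^sub>m Xm M t) \<and>
     \<comment> \<open>q^{+-2} J_0 X_t - q^{-+2} X_t J_0 = +-[2] X_t\<close>
     (\<forall>t. (q^2) \<cdot>\<^sub>m (J M 0 * Xp M t) - (inverse q^2) \<cdot>\<^sub>m (Xp M t * J M 0)
          = qbr q 2 \<cdot>\<^sub>m Xp M t) \<and>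
     (\<forall>t. (inverse q^2) \<cdot>\<^sub>m (J M 0 * Xm M t) - (q^2) \<cdot>\<^sub>m (Xm M t * J M 0)
          = (- qbr q 2) \<cdot>\<^sub>m Xm M t) \<and>
     \<comment> \<open>[J_{s+1}, X_t] = q^{+-2} J_s X_{t+1} - q^{-+2} X_{t+1} J_s\<close>
     (\<forall>s t. comm (J M (s+1)) (Xp M t)
          = (q^2) \<cdot>\<^sub>m (J M s * Xp M (t+1)) - (inverse q^2) \<cdot>\<^sub>m (Xp M (t+1) * J M s)) \<and>
     (\<forall>s t. comm (J M (s+1)) (Xm M t)
          = (inverse q^2) \<cdot>\<^sub>m (J M s * Xm M (t+1)) - (q^2) \<cdot>\<^sub>m (Xm M (t+1) * J M s)) \<and>
     \<comment> \<open>[X^+_t, X^-_s] = K^+ J_{s+t}\<close>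
     (\<forall>s t. comm (Xp M t) (Xm M s) = Kp M * J M (s+t)))"

definition is_submodule :: "umod \<Rightarrow> complex vec set \<Rightarrow> bool" where
  "is_submodule M W \<longleftrightarrow>
     W \<subseteq> carrier_vec (dim M) \<and> 0\<^sub>v (dim M) \<in> W \<and>
     (\<forall>v\<in>W. \<forall>w\<in>W. v + w \<in> W) \<and> (\<forall>c. \<forall>v\<in>W. c \<cdot>\<^sub>v v \<in> W) \<and>
     (\<forall>v\<in>W. (\<forall>t. Xp M t *\<^sub>v v \<in> W \<and> Xm M t *\<^sub>v v \<in> W \<and> J M t *\<^sub>v v \<in> W) \<and>
             Kp M *\<^sub>v v \<in> W \<and> Km M *\<^sub>v v \<in> W)"

definition fd_simple :: "complex \<Rightarrow> umod \<Rightarrow> bool" where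
  "fd_simple q M \<longleftrightarrow> is_umod q M \<and> dim M > 0 \<and>
     (\<forall>W. is_submodule M W \<longrightarrow> W = {0\<^sub>v (dim M)} \<or> W = carrier_vec (dim M))"

definition umod_iso :: "umod \<Rightarrow> umod \<Rightarrow> bool" where
  "umod_iso M N \<longleftrightarrow> dim M = dim N \<and>
     (\<exists>P Pi. P \<in> carrier_mat (dim N) (dim M) \<and> Pi \<in> carrier_mat (dim M) (dim N) \<and>
        P * Pi = 1\<^sub>m (dim N) \<and> Pi * P = 1\<^sub>m (dim M) \<and>
        (\<forall>t. P * Xp M t = Xp N t * P \<and> P * Xm M t = Xm N t * P \<and> P * J M t = J N t * P) \<and>
        P * Kp M = Kp N * P \<and> P * Km M = Km N * P)"

text \<open>M is (isomorphic to) L(u), u = (lambda, (u_t)_{t>0}): M is simple and is generated by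
  a vector v0 with X^+_t v0 = 0, K^+ v0 = lambda v0, J_t v0 = u_t v0 (t > 0).
  (Any nonzero vector generates a simple module.)\<close>

definition is_L :: "complex \<Rightarrow> umod \<Rightarrow> complex \<times> (nat \<Rightarrow> complex) \<Rightarrow> bool" where
  "is_L q M u \<longleftrightarrow> fd_simple q M \<and>
     (\<exists>v0. v0 \<in> carrier_vec (dim M) \<and> v0 \<noteq> 0\<^sub>v (dim M) \<and>
        (\<forall>t. Xp M t *\<^sub>v v0 = 0\<^sub>v (dim M)) \<and>
        Kp M *\<^sub>v v0 = fst u \<cdot>\<^sub>v v0 \<and>
        (\<forall>t>0. J M t *\<^sub>v v0 = snd u t \<cdot>\<^sub>v v0))"

definition partitions_le :: "nat \<Rightarrow> nat \<Rightarrow> nat multiset set" where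
  "partitions_le t k = {lam. (\<forall>a\<in>#lam. a > 0) \<and> sum_mset lam = t \<and> size lam \<le> k}"

definition mon_sym :: "nat multiset \<Rightarrow> complex list \<Rightarrow> complex" where
  "mon_sym lam xs = (\<Sum>\<alpha>\<in>{\<alpha>::nat list. length \<alpha> = length xs \<and> filter_mset (\<lambda>a. a \<noteq> 0) (mset \<alpha>) = lam}.
       \<Prod>i<length xs. xs ! i ^ (\<alpha> ! i))"

definition p_poly :: "nat \<Rightarrow> complex \<Rightarrow> complex list \<Rightarrow> complex" where
  "p_poly t q xs = (\<Sum>lam\<in>partitions_le t (length xs).
       inverse q ^ size lam * (q - inverse q) ^ (size lam - 1) * mon_sym lam xs)"

definition C0 :: "complex poly set" where
  "C0 = {\<phi>. lead_coeff \<phi> = 1 \<or> lead_coeff \<phi> = -1}"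

definition root_list :: "complex poly \<Rightarrow> complex list" where
  "root_list \<phi> = (SOME gs. \<phi> = smult (lead_coeff \<phi>) (\<Prod>g\<leftarrow>gs. [:- g, 1:]))"

definition u0 :: "complex \<Rightarrow> complex poly \<Rightarrow> complex \<times> (nat \<Rightarrow> complex)" where
  "u0 q \<phi> = (if degree \<phi> = 0 then (lead_coeff \<phi>, \<lambda>t. 0)
             else (lead_coeff \<phi> * q ^ degree \<phi>, \<lambda>t. p_poly t q (root_list \<phi>)))"

end

(* The vectors obtained from a highest weight vector v by the lowering operators X^-_t are stable
   under all generators. Hence two simple modules with the same highest weight are isomorphic: the
   submodule generated by (v, v') in their direct sum is the graph of an isomorphism.

   A weight (lambda, u) determines a power series P with 1 + (q - 1/q) sum_{t>0} u_t z^t =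
   P(z/q^2) / P(z). For u = u0(phi) it is the reversed polynomial of phi, whence injectivity. The
   n-th coefficient of P is up to a nonzero factor the v-component of (X^+_0)^n (X^-_1)^n v. In a
   finite dimensional simple module with highest weight +-q^k, the weight q^{-2n} lambda does not
   occur for n > k by sl_2-theory, so P is a polynomial of degree at most k.

   For existence, if the roots of phi are distinct and nonzero, there are explicit formulas for a
   module on the span of the subsets of the set of roots. A general phi is a limit of such ones;
   the matrix coefficients of the modules generated by the highest weight vectors converge, and the
   limits define a simple module of dimension at most 2^k. *)

theory Submission
  imports Defs "HOL-Library.Function_Algebras" "HOL-Computational_Algebra.Fundamental_Theorem_Algebra"
    "HOL-Computational_Algebra.Polynomial_FPS"
begin

unbundle no fps_syntax

section \<open>Linear operators and representations\<close>

text \<open>No Verma-type module is constructed, so every argument takes place inside given modules.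
  The substitute is a family of modules in which the same expression in the \<open>X^-_t\<close> is
  applied to all highest weight vectors at once. The top weight coefficient of the result is built
  from constants and the numbers \<open>u_t\<close> by ring operations, whatever the modules are.
  Members of equal weight can thus be compared, and converging weights give converging coefficients.
  Taking coefficients also divides out the vectors that never lead back to the highest weight
  vector. The limit is therefore simple, and simplicity of the generic modules never has to be
  decided. The bound on the degree of P rests on one commutator formula for \<open>X^+_0\<close>
  with powers of the series of the \<open>X^-_t\<close>, multiplied by P so that the eigenvalues of
  the \<open>J_t\<close> become the substitution z -> z/q^2.\<close>

definition sm :: "complex \<Rightarrow> ('i \<Rightarrow> complex) \<Rightarrow> 'i \<Rightarrow> complex" where
  "sm c x = (\<lambda>i. c * x i)"

lemma sm_simps [simp]:
  "sm c (x + y) = sm c x + sm c y" "sm c (x - y) = sm c x - sm c y" "sm c (- x) = - sm c x"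
  "sm c (sm d x) = sm (c * d) x"
  "sm 1 x = x" "sm 0 x = 0" "sm c 0 = 0"
  by (auto simp: sm_def fun_eq_iff algebra_simps)

lemma sm_add_left: "sm (c + d) x = sm c x + sm d x"
  and sm_diff_left: "sm (c - d) x = sm c x - sm d x"
  and sm_minus_left: "sm (- c) x = - sm c x"
  by (auto simp: sm_def fun_eq_iff algebra_simps)

lemma sm_apply: "sm c x i = c * x i"
  by (simp add: sm_def)

lemma sm_eq_0_iff: "sm c x = 0 \<longleftrightarrow> c = 0 \<or> x = 0"
  by (auto simp: sm_def fun_eq_iff)

lemma sm_sum: "sm c (\<Sum>i\<in>A. f i) = (\<Sum>i\<in>A. sm c (f i))"
  by (induction A rule: infinite_finite_induct) (simp_all only: sum.infinite sum.empty sum.insert sm_simps not_False_eq_True)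

lemma sum_sm_left: "sm (\<Sum>i\<in>A. f i) x = (\<Sum>i\<in>A. sm (f i) x)"
  by (induction A rule: infinite_finite_induct) (auto simp: sm_add_left)

lemma sum_fun_apply: "(\<Sum>i\<in>A. f i) x = (\<Sum>i\<in>A. f i (x :: 'i) :: complex)"
  by (induction A rule: infinite_finite_induct) auto

text \<open>Operators on a space of functions form a ring, so the relations can be manipulated as ring
  identities, without carriers and dimensions.\<close>

typedef 'i lop = "{f :: ('i \<Rightarrow> complex) \<Rightarrow> 'i \<Rightarrow> complex.
    (\<forall>x y. f (x + y) = f x + f y) \<and> (\<forall>c x. f (sm c x) = sm c (f x))}"
  morphisms app Lop
  by (rule exI[of _ "\<lambda>x. x"]) simp

setup_lifting type_definition_lop

instantiation lop :: (type) ring_1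
begin
lift_definition zero_lop :: "'i lop" is "\<lambda>x. 0" by simp
lift_definition one_lop :: "'i lop" is "\<lambda>x. x" by simp
lift_definition plus_lop :: "'i lop \<Rightarrow> 'i lop \<Rightarrow> 'i lop" is "\<lambda>f g x. f x + g x"
  by (simp add: algebra_simps)
lift_definition minus_lop :: "'i lop \<Rightarrow> 'i lop \<Rightarrow> 'i lop" is "\<lambda>f g x. f x - g x"
  by (simp add: algebra_simps)
lift_definition uminus_lop :: "'i lop \<Rightarrow> 'i lop" is "\<lambda>f x. - f x"
  by simp
lift_definition times_lop :: "'i lop \<Rightarrow> 'i lop \<Rightarrow> 'i lop" is "\<lambda>f g x. f (g x)"
  by simp
instance
proof
  show "(0 :: 'i lop) \<noteq> 1"
    by transfer (auto simp: fun_eq_iff intro!: exI[of _ "\<lambda>_. 1"])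
qed (transfer; force simp: algebra_simps)+
end

lift_definition sc :: "complex \<Rightarrow> 'i lop" is sm
  by (simp add: mult.commute)

lemma app_simps [simp]:
  "app 0 x = 0" "app 1 x = x" "app (A + B) x = app A x + app B x" "app (A - B) x = app A x - app B x"
  "app (- A) x = - app A x" "app (A * B) x = app A (app B x)" "app (sc c) x = sm c x"
  by (transfer; simp)+

lemma app_lin [simp]:
  "app A (x + y) = app A x + app A y" "app A (sm c x) = sm c (app A x)"
  by (transfer; simp)+

lemma app_lin' [simp]: "app A 0 = 0" "app A (- x) = - app A x" "app A (x - y) = app A x - app A y"
proof -
  show *: "app A (- x) = - app A x" for x
    using app_lin(2)[of A "-1" x] by (simp add: sm_minus_left)
  show "app A 0 = 0" using app_lin(2)[of A 0 0] by simp
  show "app A (x - y) = app A x - app A y"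
    using app_lin(1)[of A x "- y"] * by simp
qed

lemma app_sum: "app A (\<Sum>i\<in>S. f i) = (\<Sum>i\<in>S. app A (f i))"
  by (induction S rule: infinite_finite_induct) (simp_all only: sum.infinite sum.empty sum.insert app_lin app_lin' not_False_eq_True)

lemma sum_app: "app (\<Sum>i\<in>S. f i) x = (\<Sum>i\<in>S. app (f i) x)"
  by (induction S rule: infinite_finite_induct) auto

lemma lop_eqI: "(\<And>x. app A x = app B x) \<Longrightarrow> A = B"
  by (transfer; auto)

lemma sc_simps:
  "sc (c + d) = sc c + sc d" "sc (c - d) = sc c - sc d" "sc (- c) = - sc c" "sc (c * d) = sc c * sc d"
  "sc 0 = 0" "sc 1 = 1"
  by (rule lop_eqI; simp add: sm_add_left sm_diff_left sm_minus_left mult.commute; fail)+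

lemma sc_central: "A * sc c = sc c * A"
  by (rule lop_eqI) simp

section \<open>Generators and relations as operator identities\<close>

datatype gen = XP nat | XM nat | JJ nat | KP | KM

locale quantum =
  fixes q :: complex
  assumes q0: "q \<noteq> 0" and qroot: "\<forall>n>0. q ^ n \<noteq> 1"
begin

text \<open>The factor by which one \<open>X^-_t\<close> multiplies a
  \<open>K^+\<close>-eigenvalue.\<close>

definition cc :: complex where "cc = inverse q ^ 2"

lemma cc0 [simp]: "cc \<noteq> 0" using q0 by (simp add: cc_def)

lemma cc_pow_ne1: "n > 0 \<Longrightarrow> cc ^ n \<noteq> 1"
proof
  assume "n > 0" "cc ^ n = 1"
  then have "q ^ (2 * n) = 1"
    using q0 by (simp add: cc_def power_mult power_inverse)
  with \<open>n > 0\<close> qroot show False by (metis mult_pos_pos zero_less_numeral)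
qed

lemma cc_ne1: "cc \<noteq> 1" using cc_pow_ne1[of 1] by simp

lemma cc_inj: "cc ^ i = cc ^ j \<Longrightarrow> i = j"
proof (induction i j rule: linorder_wlog)
  case (le i j)
  then have "cc ^ i * cc ^ (j - i) = cc ^ i" by (metis le_add_diff_inverse power_add)
  then have "cc ^ (j - i) = 1" by simp
  then show ?case using cc_pow_ne1[of "j - i"] le by linarith
qed auto

lemma q2cc [simp]: "q\<^sup>2 * cc = 1" "cc * q\<^sup>2 = 1"
  using q0 by (auto simp: cc_def field_simps power_inverse)

lemma qd: "q - inverse q \<noteq> 0"
proof
  assume "q - inverse q = 0"
  then have "q ^ 2 = 1" using q0 by (simp add: field_simps power2_eq_square)
  then show False using qroot by (metis zero_less_numeral)
qed

end

text \<open>The index type stays arbitrary: matrix modules live on \<open>nat\<close>, the explicit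
  modules on sets of indices.\<close>

locale urep = quantum q for q +
  fixes \<rho> :: "gen \<Rightarrow> 'i lop"
  assumes KJ: "\<rho> KP * \<rho> (JJ t) = \<rho> (JJ t) * \<rho> KP"
    and JJ: "\<rho> (JJ s) * \<rho> (JJ t) = \<rho> (JJ t) * \<rho> (JJ s)"
    and KK: "\<rho> KP * \<rho> KM = 1" "\<rho> KM * \<rho> KP = 1"
    and KM2: "\<rho> KM * \<rho> KM = 1 - sc (q - inverse q) * \<rho> (JJ 0)"
    and XXp: "\<rho> (XP (t+1)) * \<rho> (XP s) - sc (q^2) * (\<rho> (XP s) * \<rho> (XP (t+1)))
            = sc (q^2) * (\<rho> (XP t) * \<rho> (XP (s+1))) - \<rho> (XP (s+1)) * \<rho> (XP t)"
    and XXm: "\<rho> (XM (t+1)) * \<rho> (XM s) - sc (inverse q^2) * (\<rho> (XM s) * \<rho> (XM (t+1)))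
            = sc (inverse q^2) * (\<rho> (XM t) * \<rho> (XM (s+1))) - \<rho> (XM (s+1)) * \<rho> (XM t)"
    and KXp: "\<rho> KP * \<rho> (XP t) * \<rho> KM = sc (q^2) * \<rho> (XP t)"
    and KXm: "\<rho> KP * \<rho> (XM t) * \<rho> KM = sc (inverse q^2) * \<rho> (XM t)"
    and J0Xp: "sc (q^2) * (\<rho> (JJ 0) * \<rho> (XP t)) - sc (inverse q^2) * (\<rho> (XP t) * \<rho> (JJ 0))
            = sc (qbr q 2) * \<rho> (XP t)"
    and J0Xm: "sc (inverse q^2) * (\<rho> (JJ 0) * \<rho> (XM t)) - sc (q^2) * (\<rho> (XM t) * \<rho> (JJ 0))
            = sc (- qbr q 2) * \<rho> (XM t)"
    and JXp: "\<rho> (JJ (s+1)) * \<rho> (XP t) - \<rho> (XP t) * \<rho> (JJ (s+1))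
            = sc (q^2) * (\<rho> (JJ s) * \<rho> (XP (t+1))) - sc (inverse q^2) * (\<rho> (XP (t+1)) * \<rho> (JJ s))"
    and JXm: "\<rho> (JJ (s+1)) * \<rho> (XM t) - \<rho> (XM t) * \<rho> (JJ (s+1))
            = sc (inverse q^2) * (\<rho> (JJ s) * \<rho> (XM (t+1))) - sc (q^2) * (\<rho> (XM (t+1)) * \<rho> (JJ s))"
    and XX: "\<rho> (XP t) * \<rho> (XM s) - \<rho> (XM s) * \<rho> (XP t) = \<rho> KP * \<rho> (JJ (s+t))"
begin

lemma KXp': "\<rho> KP * \<rho> (XP t) = sc (q^2) * \<rho> (XP t) * \<rho> KP"
proof -
  have "\<rho> KP * \<rho> (XP t) = (\<rho> KP * \<rho> (XP t) * \<rho> KM) * \<rho> KP" by (simp add: mult.assoc KK)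
  then show ?thesis by (simp add: KXp)
qed

lemma KXm': "\<rho> KP * \<rho> (XM t) = sc cc * \<rho> (XM t) * \<rho> KP"
proof -
  have "\<rho> KP * \<rho> (XM t) = (\<rho> KP * \<rho> (XM t) * \<rho> KM) * \<rho> KP" by (simp add: mult.assoc KK)
  then show ?thesis by (simp add: KXm cc_def)
qed

lemma KmXm': "\<rho> KM * \<rho> (XM t) = sc (q^2) * \<rho> (XM t) * \<rho> KM"
proof -
  have "\<rho> (XM t) * \<rho> KM = \<rho> KM * (\<rho> KP * \<rho> (XM t)) * \<rho> KM"
    by (simp add: mult.assoc[symmetric] KK)
  also have "\<dots> = sc cc * (\<rho> KM * \<rho> (XM t) * (\<rho> KP * \<rho> KM))"
    by (simp only: KXm' mult.assoc) (simp only: mult.assoc[symmetric] sc_central[of "\<rho> KM"])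
  finally have *: "\<rho> (XM t) * \<rho> KM = sc cc * (\<rho> KM * \<rho> (XM t))"
    by (simp add: KK)
  have "sc (q^2) * \<rho> (XM t) * \<rho> KM = sc (q^2 * cc) * (\<rho> KM * \<rho> (XM t))"
    by (simp only: sc_simps(4) mult.assoc *)
  then show ?thesis by (simp add: sc_simps(6))
qed

text \<open>With \<open>XX\<close> at \<open>s = t = 0\<close> this is the bracket of quantum sl_2,
  so \<open>X^+_0\<close>, \<open>X^-_0\<close> and \<open>K^+\<close> form a quantum
  sl_2-triple.\<close>

lemma KP_J: "\<rho> KP * \<rho> (JJ 0) * sc (q - inverse q) = \<rho> KP - \<rho> KM"
proof -
  have "sc (q - inverse q) * \<rho> (JJ 0) = 1 - \<rho> KM * \<rho> KM" by (simp add: KM2)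
  then have "\<rho> KP * (sc (q - inverse q) * \<rho> (JJ 0)) = \<rho> KP - \<rho> KP * \<rho> KM * \<rho> KM"
    by (simp only: right_diff_distrib mult_1_right mult.assoc)
  then show ?thesis by (simp add: KK) (simp only: mult.assoc sc_central[of "\<rho> (JJ 0)"])
qed

end

lemma lop_eq_iff: "A = B \<longleftrightarrow> (\<forall>x i. app A x i = app B x i)"
  by (auto intro!: lop_eqI)

section \<open>Vacuum expectations of lowering operators\<close>

text \<open>The weights \<open>al\<close> are symmetric under \<open>i\<close> ->
  \<open>n - 1 - i\<close>, so in the weighted sum of the hypotheses the reflected terms repeat the
  direct ones and only \<open>T (i + 1) - c * T i\<close> remains, twice. The factors of
  \<open>al\<close> are chosen to vanish at the ends, so the shifted and the unshifted sum both
  extend to \<open>i \<le> n\<close> without boundary terms.\<close>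

lemma reflected_sum_zero:
  fixes T :: "nat \<Rightarrow> complex"
  assumes c: "c \<noteq> 1"
    and r: "\<And>i. i < n \<Longrightarrow> T (i + 1) - c * T (n - 1 - i) = c * T i - T (n - i)"
  shows "(\<Sum>i\<le>n. (1 - c ^ i - c ^ (i + 1) + c ^ (n + 1)) * T i) = 0"
proof -
  define al where "al i = (1 - c ^ (i + 1)) * (1 - c ^ (n - i))" for i
  have sym: "al (n - 1 - i) = al i" if "i < n" for i
  proof -
    have "n - 1 - i + 1 = n - i" "n - (n - 1 - i) = i + 1" using that by auto
    then show ?thesis by (simp add: al_def mult.commute)
  qed
  have "0 = (\<Sum>i<n. al i * (T (i + 1) - c * T (n - 1 - i) - (c * T i - T (n - i))))"
    using r by (intro sum.neutral[symmetric]) simp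
  also have "\<dots> = (\<Sum>i<n. al i * (T (i + 1) - c * T i)) + (\<Sum>i<n. al i * (T (n - i) - c * T (n - 1 - i)))"
    unfolding sum.distrib[symmetric] by (intro sum.cong) (auto simp: algebra_simps)
  also have "(\<Sum>i<n. al i * (T (n - i) - c * T (n - 1 - i))) = (\<Sum>i<n. al i * (T (i + 1) - c * T i))"
    by (rule sum.reindex_bij_witness[of _ "\<lambda>i. n - 1 - i" "\<lambda>i. n - 1 - i"])
       (auto simp: sym[simplified] Suc_diff_Suc)
  finally have "(\<Sum>i<n. al i * (T (i + 1) - c * T i)) = 0" by simp
  then have e: "(\<Sum>i<n. al i * T (i + 1)) = c * (\<Sum>i<n. al i * T i)"
    by (simp add: algebra_simps sum_subtractf sum_distrib_left)
  have "(\<Sum>i<n. al i * T (i + 1)) = (\<Sum>i<n. (1 - c ^ (i + 1)) * (1 - c ^ (n + 1 - (i + 1))) * T (i + 1))"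
    by (simp add: al_def)
  also have "\<dots> = (\<Sum>i\<le>n. (1 - c ^ i) * (1 - c ^ (n + 1 - i)) * T i)"
    by (simp add: sum.atMost_shift)
  finally have l: "(\<Sum>i<n. al i * T (i + 1)) = (\<Sum>i\<le>n. (1 - c ^ i) * (1 - c ^ (n + 1 - i)) * T i)" .
  have "(\<Sum>i<n. al i * T i) = (\<Sum>i\<le>n. al i * T i)"
    by (simp add: al_def flip: lessThan_Suc_atMost)
  with e l have "(\<Sum>i\<le>n. (1 - c ^ i) * (1 - c ^ (n + 1 - i)) * T i - c * (al i * T i)) = 0"
    by (simp add: sum_subtractf sum_distrib_left)
  also have "(\<Sum>i\<le>n. (1 - c ^ i) * (1 - c ^ (n + 1 - i)) * T i - c * (al i * T i))
     = (1 - c) * (\<Sum>i\<le>n. (1 - c ^ i - c ^ (i + 1) + c ^ (n + 1)) * T i)"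
    unfolding sum_distrib_left
  proof (rule sum.cong, rule refl)
    fix i assume "i \<in> {..n}"
    then have 1: "c ^ (n + 1) = c ^ i * c ^ (n - i) * c" and 2: "c ^ (n + 1 - i) = c * c ^ (n - i)"
      by (auto simp: Suc_diff_le simp flip: power_add)
    show "(1 - c ^ i) * (1 - c ^ (n + 1 - i)) * T i - c * (al i * T i)
      = (1 - c) * ((1 - c ^ i - c ^ (i + 1) + c ^ (n + 1)) * T i)"
      unfolding al_def 1 2 by (simp add: algebra_simps)
  qed
  finally show ?thesis using c by simp
qed

section \<open>Power series with operator coefficients\<close>

abbreviation fsc :: "complex \<Rightarrow> 'i lop fps" where
  "fsc c \<equiv> fps_const (sc c)"

lemma fsc_central: "F * fsc c = fsc c * F"
  by (rule fps_ext) (simp add: sc_central)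

lemma fsc_simps: "fsc (c * d) = fsc c * fsc d" "fsc (c + d) = fsc c + fsc d" "fsc 1 = 1"
  by (simp_all add: sc_simps)

context quantum
begin

text \<open>The substitution z -> z/q^2, multiplicative because scalars are central.\<close>

definition scl :: "'i lop fps \<Rightarrow> 'i lop fps" where
  "scl F = Abs_fps (\<lambda>n. sc (cc ^ n) * fps_nth F n)"

lemma scl_nth [simp]: "fps_nth (scl F) n = sc (cc ^ n) * fps_nth F n"
  by (simp add: scl_def)

lemma scl_mult: "scl (F * G) = scl F * scl G"
proof (rule fps_ext)
  fix n
  have "sc (cc ^ n) * (\<Sum>i=0..n. fps_nth F i * fps_nth G (n - i))
      = (\<Sum>i=0..n. sc (cc ^ i) * fps_nth F i * (sc (cc ^ (n - i)) * fps_nth G (n - i)))"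
    unfolding sum_distrib_left
  proof (rule sum.cong, rule refl)
    fix i assume "i \<in> {0..n}"
    then have *: "sc (cc ^ n) = sc (cc ^ i) * sc (cc ^ (n - i))"
      by (simp flip: power_add sc_simps(4))
    have "sc (cc ^ n) * (fps_nth F i * fps_nth G (n - i))
        = sc (cc ^ i) * (fps_nth F i * sc (cc ^ (n - i))) * fps_nth G (n - i)"
      by (simp only: * sc_central[of "fps_nth F i"] mult.assoc)
    then show "sc (cc ^ n) * (fps_nth F i * fps_nth G (n - i))
        = sc (cc ^ i) * fps_nth F i * (sc (cc ^ (n - i)) * fps_nth G (n - i))"
      by (simp only: mult.assoc)
  qed
  then show "fps_nth (scl (F * G)) n = fps_nth (scl F * scl G) n"
    by (simp add: fps_mult_nth)
qed

lemma scl_1: "scl 1 = 1"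
  by (rule fps_ext) (simp add: sc_simps)

lemma scl_power: "scl (F ^ m) = scl F ^ m"
  by (induction m) (auto simp: scl_mult scl_1)

text \<open>The quantum number of \<open>m + 1\<close> in base \<open>cc\<close>; the shift fits its
  use with the power \<open>A1 ^ Suc m\<close>.\<close>

definition qs :: "nat \<Rightarrow> complex" where "qs m = (\<Sum>j\<le>m. cc ^ j)"

lemma qs_0 [simp]: "qs 0 = 1" by (simp add: qs_def)

lemma qs_Suc: "qs (Suc m) = 1 + cc * qs m"
  unfolding qs_def by (subst sum.atMost_Suc_shift) (simp add: sum_distrib_left)

lemma qs_ne0: "qs m \<noteq> 0"
proof -
  have "(1 - cc) * qs m = 1 - cc ^ (m + 1)"
  proof (induction m)
    case (Suc m)
    have "(1 - cc) * qs (Suc m) = (1 - cc) + cc * ((1 - cc) * qs m)"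
      by (simp add: qs_Suc algebra_simps)
    then show ?case by (simp only: Suc) (simp add: algebra_simps)
  qed simp
  then show ?thesis using cc_pow_ne1[of "m+1"] by auto
qed

end

context urep
begin

text \<open>The start \<open>t\<close> is a parameter because the inductions on coefficients split
  off the first term and continue at \<open>Suc t\<close>.\<close>

definition Aser :: "nat \<Rightarrow> 'i lop fps" where
  "Aser t = Abs_fps (\<lambda>j. \<rho> (XM (t + j)))"

text \<open>The constant coefficient is 1 instead of \<open>(q - inverse q) * J_0\<close>: the
  relation between \<open>J_0\<close> and \<open>X^-_t\<close> has exactly the effect of putting 1
  there, as the case \<open>s = 0\<close> of \<open>Jh_XM\<close> shows.\<close>

definition Jh :: "'i lop fps" where
  "Jh = Abs_fps (\<lambda>n. if n = 0 then 1 else sc (q - inverse q) * \<rho> (JJ n))"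

lemma Aser_split: "Aser t = fps_const (\<rho> (XM t)) + fps_X * Aser (Suc t)"
  by (rule fps_ext) (auto simp: Aser_def)

lemma sclAser_split: "scl (Aser t) = fps_const (\<rho> (XM t)) + fps_X * (fsc cc * scl (Aser (Suc t)))"
proof (rule fps_ext)
  fix n show "fps_nth (scl (Aser t)) n = fps_nth (fps_const (\<rho> (XM t)) + fps_X * (fsc cc * scl (Aser (Suc t)))) n"
    by (cases n) (simp_all add: Aser_def sc_simps mult.assoc)
qed

lemma Jh_XM:
  "fps_nth Jh (s+1) * \<rho> (XM t) - \<rho> (XM t) * fps_nth Jh (s+1)
   = sc cc * (fps_nth Jh s * \<rho> (XM (t+1))) - sc (q^2) * (\<rho> (XM (t+1)) * fps_nth Jh s)"
proof -
  let ?d = "q - inverse q"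
  have "fps_nth Jh (s+1) * \<rho> (XM t) - \<rho> (XM t) * fps_nth Jh (s+1)
    = sc ?d * (\<rho> (JJ (s+1)) * \<rho> (XM t) - \<rho> (XM t) * \<rho> (JJ (s+1)))"
    by (simp add: Jh_def right_diff_distrib mult.assoc) (simp add: sc_central[of "\<rho> (XM t)"] flip: mult.assoc)
  also have "\<dots> = sc ?d * (sc cc * (\<rho> (JJ s) * \<rho> (XM (t+1))) - sc (q^2) * (\<rho> (XM (t+1)) * \<rho> (JJ s)))"
    by (simp only: JXm cc_def)
  also have "\<dots> = sc cc * (fps_nth Jh s * \<rho> (XM (t+1))) - sc (q^2) * (\<rho> (XM (t+1)) * fps_nth Jh s)"
  proof (cases "s = 0")
    case True
    have "qbr q 2 * ?d = q^2 - cc" using qd by (simp add: qbr_def cc_def)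
    then have "?d * - qbr q 2 = cc - q^2" by (simp add: mult.commute)
    moreover have "sc ?d * (sc cc * (\<rho> (JJ 0) * \<rho> (XM (t+1))) - sc (q^2) * (\<rho> (XM (t+1)) * \<rho> (JJ 0)))
      = sc (?d * - qbr q 2) * \<rho> (XM (t+1))"
      using J0Xm[of "t+1"] by (simp only: cc_def sc_simps mult.assoc)
    ultimately show ?thesis using True by (simp add: Jh_def sc_simps left_diff_distrib)
  next
    case False
    then show ?thesis
      by (intro lop_eqI) (simp add: Jh_def mult_ac)
  qed
  finally show ?thesis .
qed

lemma Jh_0 [simp]: "fps_nth Jh 0 = 1"
  by (simp add: Jh_def)

text \<open>Iterating \<open>Jh_XM\<close> lowers the index of \<open>Jh\<close> and raises that of
  \<open>XM\<close>, each time with a factor \<open>cc\<close>. Since \<open>q^2 = cc * q^4\<close>,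
  the two terms of each step combine with those of the next, and the geometric weights assemble to a
  coefficient of \<open>scl (Aser t) * Jh\<close>.\<close>

lemma Jh_past_XM:
  "fps_nth Jh n * \<rho> (XM t) = sc (q^4) * (\<rho> (XM t) * fps_nth Jh n) + sc (1 - q^4) * fps_nth (scl (Aser t) * Jh) n"
proof (induction n arbitrary: t)
  case 0
  show ?case
    by (intro lop_eqI) (simp add: Aser_def sm_def fun_eq_iff algebra_simps)
next
  case (Suc n)
  have S: "fps_nth (scl (Aser t) * Jh) (Suc n) = \<rho> (XM t) * fps_nth Jh (Suc n) + sc cc * fps_nth (scl (Aser (Suc t)) * Jh) n"
    by (subst sclAser_split) (simp add: algebra_simps)
  have q4: "cc * q^4 = q^2" using q0 by (simp add: cc_def power_inverse field_simps)
  show ?case unfolding lop_eq_iff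
  proof (intro allI)
    fix x i
    have 1: "app (fps_nth Jh (Suc n) * \<rho> (XM t)) x i = app (\<rho> (XM t) * fps_nth Jh (Suc n)) x i
      + cc * app (fps_nth Jh n * \<rho> (XM (t+1))) x i - q^2 * app (\<rho> (XM (t+1)) * fps_nth Jh n) x i"
      using arg_cong[OF Jh_XM[of n t], of "\<lambda>A. app A x i"] by (simp add: sm_apply algebra_simps)
    have 2: "app (fps_nth Jh n * \<rho> (XM (t+1))) x i = q^4 * app (\<rho> (XM (t+1)) * fps_nth Jh n) x i
       + (1 - q^4) * app (fps_nth (scl (Aser (Suc t)) * Jh) n) x i"
      using arg_cong[OF Suc[of "Suc t"], of "\<lambda>A. app A x i"] by (simp add: sm_apply)
    show "app (fps_nth Jh (Suc n) * \<rho> (XM t)) x i = app (sc (q^4) * (\<rho> (XM t) * fps_nth Jh (Suc n))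
       + sc (1 - q^4) * fps_nth (scl (Aser t) * Jh) (Suc n)) x i"
      unfolding 1 2 S by (simp add: sm_apply q4[symmetric] algebra_simps)
  qed
qed

text \<open>The sum of \<open>Jh_past_XM\<close> over the terms of the series: splitting off the
  first term leaves the same statement at \<open>Suc t\<close>, one degree lower.\<close>

lemma Jh_past_Aser:
  "fps_nth (Jh * Aser t) n = sc (1 + q^2) * fps_nth (scl (Aser t) * Jh) n - sc (q^2) * fps_nth (Aser t * Jh) n"
proof (induction n arbitrary: t)
  case 0
  show ?case
    by (intro lop_eqI) (simp add: Aser_def sm_def fun_eq_iff algebra_simps)
next
  case (Suc n)
  have S: "fps_nth (scl (Aser t) * Jh) (Suc n) = \<rho> (XM t) * fps_nth Jh (Suc n) + sc cc * fps_nth (scl (Aser (Suc t)) * Jh) n"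
    by (subst sclAser_split) (simp add: algebra_simps)
  have S2: "fps_nth (Aser t * Jh) (Suc n) = \<rho> (XM t) * fps_nth Jh (Suc n) + fps_nth (Aser (Suc t) * Jh) n"
    by (subst Aser_split) (simp add: algebra_simps)
  have S3: "fps_nth (Jh * Aser t) (Suc n) = fps_nth Jh (Suc n) * \<rho> (XM t) + fps_nth (Jh * Aser (Suc t)) n"
  proof -
    have "Jh * Aser t = Jh * fps_const (\<rho> (XM t)) + fps_X * (Jh * Aser (Suc t))"
      by (subst Aser_split) (simp only: distrib_left mult.assoc[symmetric] fps_mult_fps_X_commute[of Jh])
    then show ?thesis by simp
  qed
  have q4: "cc * q^4 = q^2" using q0 by (simp add: cc_def power_inverse field_simps)
  have q4': "cc * (q^4 * z) = q^2 * z" "cc * (q^2 * z) = z" for z by (simp_all add: q4 flip: mult.assoc)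
  show ?case unfolding lop_eq_iff
  proof (intro allI)
    fix x i
    let ?a = "\<lambda>A :: 'i lop. app A x i"
    have 1: "?a (fps_nth Jh (Suc n) * \<rho> (XM t)) = q^4 * ?a (\<rho> (XM t) * fps_nth Jh (Suc n))
       + (1 - q^4) * (?a (\<rho> (XM t) * fps_nth Jh (Suc n)) + cc * ?a (fps_nth (scl (Aser (Suc t)) * Jh) n))"
      using arg_cong[OF Jh_past_XM[of "Suc n" t], of ?a] by (simp add: sm_apply S distrib_left)
    have 2: "?a (fps_nth (Jh * Aser (Suc t)) n) = (1 + q^2) * ?a (fps_nth (scl (Aser (Suc t)) * Jh) n)
        - q^2 * ?a (fps_nth (Aser (Suc t) * Jh) n)"
      using arg_cong[OF Suc[of "Suc t"], of ?a] by (simp add: sm_apply)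
    have "?a (fps_nth (Jh * Aser t) (Suc n)) = ?a (fps_nth Jh (Suc n) * \<rho> (XM t)) + ?a (fps_nth (Jh * Aser (Suc t)) n)"
      by (simp add: S3)
    also have "\<dots> = (1 + q^2) * (?a (\<rho> (XM t) * fps_nth Jh (Suc n)) + cc * ?a (fps_nth (scl (Aser (Suc t)) * Jh) n))
       - q^2 * (?a (\<rho> (XM t) * fps_nth Jh (Suc n)) + ?a (fps_nth (Aser (Suc t) * Jh) n))"
      unfolding 1 2 by (simp add: q4' algebra_simps)
    also have "\<dots> = ?a (sc (1 + q^2) * fps_nth (scl (Aser t) * Jh) (Suc n) - sc (q^2) * fps_nth (Aser t * Jh) (Suc n))"
      by (simp add: S S2 sm_apply distrib_left distrib_right)
    finally show "?a (fps_nth (Jh * Aser t) (Suc n))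
      = ?a (sc (1 + q^2) * fps_nth (scl (Aser t) * Jh) (Suc n) - sc (q^2) * fps_nth (Aser t * Jh) (Suc n))" .
  qed
qed

text \<open>The series starts at \<open>X^-_1\<close> because its commutator with
  \<open>X^+_0\<close> then involves only the \<open>J_t\<close> with t > 0, which are the ones
  collected in \<open>Jh\<close>.\<close>

abbreviation "A1 \<equiv> Aser (Suc 0)"
abbreviation "A1' \<equiv> scl A1"
abbreviation "fK \<equiv> fps_const (\<rho> KP)"
abbreviation "fE \<equiv> fps_const (\<rho> (XP 0))"
text \<open>The factor z restores the degree lost by starting \<open>A1\<close> at
  \<open>X^-_1\<close>, and \<open>q - inverse q\<close> is the normalisation of \<open>Jh\<close>;
  with both, the commutator of \<open>fE\<close> and \<open>A1\<close> is
  \<open>(Jh - 1) * fK\<close>.\<close>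

definition dl :: "'i lop fps" where "dl = fps_X * fsc (q - inverse q)"

lemma dl_nth [simp]:
  "fps_nth (dl * F) n = (if n = 0 then 0 else sc (q - inverse q) * fps_nth F (n - 1))"
  by (simp add: dl_def mult.assoc)

lemma dl_nth_0 [simp]: "fps_nth dl 0 = 0"
  by (simp add: dl_def)

lemma Jh_A1: "Jh * A1 = (A1' - fsc (q^2) * (A1 - A1')) * Jh"
proof -
  have "Jh * A1 = fsc (1 + q^2) * (A1' * Jh) - fsc (q^2) * (A1 * Jh)"
    by (rule fps_ext) (simp add: Jh_past_Aser)
  then show ?thesis by (simp add: sc_simps fps_const_add[symmetric] algebra_simps del: fps_const_add)
qed

text \<open>The relations among the \<open>X\<^sup>-\<^sub>t\<close> enter only here; the coefficients \<open>al\<close> in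
  \<open>reflected_sum_zero\<close> are chosen such that the relations telescope to this identity.\<close>

lemma ZA: "(A1 - A1') * A1 = fsc cc * (A1' * (A1 - A1'))"
proof -
  have "fps_nth ((A1 - A1') * A1) n = fps_nth (fsc cc * (A1' * (A1 - A1'))) n" for n
    unfolding lop_eq_iff
  proof (intro allI)
    fix x k
    let ?a = "\<lambda>A :: 'i lop. app A x k"
    define T where "T i = ?a (\<rho> (XM (i + 1)) * \<rho> (XM (n - i + 1)))" for i
    have "(\<Sum>i\<le>n. (1 - cc ^ i - cc ^ (i + 1) + cc ^ (n + 1)) * T i) = 0"
    proof (rule reflected_sum_zero[OF cc_ne1])
      fix i assume "i < n"
      then have e: "n - 1 - i + 1 = n - i" "n - (n - 1 - i) + 1 = i + 2" "n - (i + 1) + 1 = n - i" "n - (n - i) = i"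
        by auto
      show "T (i + 1) - cc * T (n - 1 - i) = cc * T i - T (n - i)"
        using arg_cong[OF XXm[of "i+1" "n-i"], of ?a]
        unfolding T_def e by (simp add: sm_apply cc_def)
    qed
    moreover have e2: "?a (fps_nth ((A1 - A1') * A1) n) = (\<Sum>i\<le>n. (1 - cc ^ i) * T i)"
      by (simp add: fps_mult_nth Aser_def sum_app sum_fun_apply T_def sm_apply left_diff_distrib atLeast0AtMost sum_subtractf)
    moreover have e3: "?a (fps_nth (fsc cc * (A1' * (A1 - A1'))) n) = (\<Sum>i\<le>n. (cc ^ (i + 1) - cc ^ (n + 1)) * T i)"
    proof -
      have "?a (fps_nth (fsc cc * (A1' * (A1 - A1'))) n)
         = (\<Sum>i\<le>n. cc * (cc ^ i * (T i - cc ^ (n - i) * T i)))"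
        unfolding fps_mult_left_const_nth unfolding fps_mult_nth
        by (simp add: Aser_def sum_app sum_fun_apply T_def sm_apply sum_distrib_left atLeast0AtMost algebra_simps)
      also have "\<dots> = (\<Sum>i\<le>n. (cc ^ (i + 1) - cc ^ (n + 1)) * T i)"
      proof (rule sum.cong, rule refl)
        fix i assume "i \<in> {..n}"
        then have "cc ^ (n + 1) = cc * (cc ^ i * cc ^ (n - i))" by (simp flip: power_add)
        moreover have "cc ^ (i + 1) = cc * cc ^ i" by simp
        ultimately show "cc * (cc ^ i * (T i - cc ^ (n - i) * T i)) = (cc ^ (i + 1) - cc ^ (n + 1)) * T i"
          by (simp only: left_diff_distrib right_diff_distrib mult_ac)
      qed
      finally show ?thesis .
    qed
    ultimately show "?a (fps_nth ((A1 - A1') * A1) n) = ?a (fps_nth (fsc cc * (A1' * (A1 - A1'))) n)"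
      unfolding e2 e3 by (simp add: left_diff_distrib distrib_right sum.distrib sum_subtractf) (simp add: algebra_simps)
  qed
  then show ?thesis by (rule fps_ext)
qed

lemma fsc_qs_Suc: "fsc (qs (Suc m)) = 1 + fsc (qs m) * fsc cc"
  by (simp only: qs_Suc fsc_simps mult.commute[of cc])

text \<open>By \<open>ZA\<close>, a factor \<open>A1\<close> to the right of \<open>A1 - A1'\<close>
  turns into \<open>cc * A1'\<close> to its left. Hence all terms of the expansion collect into a
  single one, and the powers of \<open>cc\<close> add up to a quantum number.\<close>

lemma A1_power: "A1 ^ Suc m = A1' ^ Suc m + fsc (qs m) * (A1' ^ m * (A1 - A1'))"
proof (induction m)
  case 0
  show ?case by (simp add: sc_simps)
next
  case (Suc m)
  let ?P = "A1' ^ Suc m" and ?Z = "A1 - A1'"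
  have "A1 ^ Suc (Suc m) = A1 ^ Suc m * A1" by (simp only: power_Suc2)
  also have "\<dots> = ?P * A1 + fsc (qs m) * (A1' ^ m * (?Z * A1))"
    unfolding Suc by (simp only: distrib_right mult.assoc)
  also have "A1' ^ m * (?Z * A1) = fsc cc * (A1' ^ m * A1' * ?Z)"
    unfolding ZA by (simp only: fsc_central[of "A1' ^ m"] mult.assoc[symmetric])
  also have "A1' ^ m * A1' = ?P" by (simp only: power_Suc2)
  also have "?P * A1 + fsc (qs m) * (fsc cc * (?P * ?Z)) = ?P * A1' + (1 + fsc (qs m) * fsc cc) * (?P * ?Z)"
    by (simp only: distrib_right right_diff_distrib mult.assoc mult_1_left) simp
  finally show ?case
    unfolding fsc_qs_Suc power_Suc2[of A1' "Suc m"] .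
qed

lemma fE_A1: "dl * (fE * A1) = dl * (A1 * fE) + (Jh - 1) * fK"
proof (rule fps_ext)
  fix n
  show "fps_nth (dl * (fE * A1)) n = fps_nth (dl * (A1 * fE) + (Jh - 1) * fK) n"
  proof (cases n)
    case (Suc k)
    have "\<rho> (XP 0) * \<rho> (XM (Suc k)) = \<rho> (XM (Suc k)) * \<rho> (XP 0) + \<rho> (JJ (Suc k)) * \<rho> KP"
      using XX[of 0 "Suc k"] by (simp add: KJ algebra_simps)
    then show ?thesis
      by (simp add: Suc mult.assoc Aser_def Jh_def ring_distribs sc_central)
  qed simp
qed

lemma fK_A1: "fK * A1 = fsc cc * (A1 * fK)"
  by (rule fps_ext) (simp add: Aser_def KXm' mult.assoc)

lemma dl_central: "F * dl = dl * F"
proof -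
  have "F * dl = fps_X * (F * fsc (q - inverse q))"
    by (simp only: dl_def fps_mult_fps_X_commute[of F] mult.assoc[symmetric])
  also have "\<dots> = dl * F" by (simp only: dl_def fsc_central[of F] mult.assoc)
  finally show ?thesis .
qed

text \<open>The right-hand side has this form because of what happens on a highest weight vector
  after multiplication by a series P with \<open>Jh * P = scl P\<close> there: the bracket becomes
  \<open>scl (A1 ^ m * P) - A1 ^ m * P\<close>, which merely multiplies the coefficient of degree r
  by \<open>cc ^ r - 1\<close>.\<close>

lemma E_A1_power:
  "dl * (fE * A1 ^ Suc m) = dl * (A1 ^ Suc m * fE) + fsc (qs m) * ((A1' ^ m * Jh - A1 ^ m) * fK)"
proof (induction m)
  case 0
  show ?case using fE_A1 by (simp add: sc_simps)
next
  case (Suc m)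
  let ?P = "A1 ^ Suc m" and ?Q = "A1' ^ Suc m" and ?Z = "A1 - A1'"
  define W where "W = A1' ^ m * (?Z * Jh)"
  have PA: "?P * A1 = A1 ^ Suc (Suc m)" by (simp only: power_Suc2)
  have QA: "A1' ^ m * (A1' * Jh) = ?Q * Jh" by (simp only: power_Suc2 mult.assoc)
  have AH: "A1' ^ m * (Jh * A1) = ?Q * Jh - fsc (q^2) * W"
    unfolding Jh_A1 W_def left_diff_distrib[of A1'] right_diff_distrib[of _ "A1' * Jh"] QA
    by (simp only: mult.assoc[symmetric] fsc_central[of "A1' ^ m"])
  have PH: "?P * Jh = ?Q * Jh + fsc (qs m) * W"
    unfolding A1_power W_def by (simp only: distrib_right mult.assoc)
  \<comment> \<open>\<open>W\<close> arises once from moving \<open>A1\<close> past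
    \<open>Jh\<close> and once from comparing \<open>A1 ^ Suc m\<close> with its substituted
    version. The two contributions cancel precisely because \<open>cc * q^2 = 1\<close>.\<close>
  have cW: "fsc cc * (fsc (q^2) * W) = W"
    by (simp only: mult.assoc[symmetric] fsc_simps(1)[symmetric] q2cc fsc_simps(3) mult_1_left)
  have "?P * (Jh - 1) + fsc (qs m) * (fsc cc * (A1' ^ m * (Jh * A1) - ?P))
     = ?Q * Jh - ?P + fsc (qs m) * (fsc cc * (?Q * Jh)) - fsc (qs m) * (fsc cc * ?P)"
    unfolding AH right_diff_distrib PH cW by simp
  also have "\<dots> = fsc (qs (Suc m)) * (?Q * Jh - ?P)"
    unfolding fsc_qs_Suc by (simp add: ring_distribs mult.assoc del: fps_const_mult power_Suc)
  finally have main: "?P * (Jh - 1) + fsc (qs m) * (fsc cc * (A1' ^ m * (Jh * A1) - ?P))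
     = fsc (qs (Suc m)) * (?Q * Jh - ?P)" .
  have "dl * (fE * A1 ^ Suc (Suc m)) = dl * (fE * ?P) * A1"
    by (simp only: mult.assoc PA)
  also have "\<dots> = ?P * (dl * (fE * A1)) + fsc (qs m) * ((A1' ^ m * Jh - A1 ^ m) * (fK * A1))"
    unfolding Suc distrib_right by (simp only: mult.assoc[symmetric] dl_central[of ?P])
  also have "?P * (dl * (fE * A1)) = dl * (?P * A1 * fE) + ?P * (Jh - 1) * fK"
    unfolding fE_A1 distrib_left by (simp only: mult.assoc[symmetric] dl_central[of ?P])
  also have "(A1' ^ m * Jh - A1 ^ m) * (fK * A1) = fsc cc * (A1' ^ m * (Jh * A1) - ?P) * fK"
  proof -
    have "(A1' ^ m * Jh - A1 ^ m) * (fK * A1) = fsc cc * ((A1' ^ m * Jh - A1 ^ m) * A1 * fK)"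
      unfolding fK_A1 by (simp only: mult.assoc[symmetric] fsc_central[of "A1' ^ m * Jh - A1 ^ m"])
    also have "(A1' ^ m * Jh - A1 ^ m) * A1 = A1' ^ m * (Jh * A1) - ?P"
      by (simp only: left_diff_distrib mult.assoc power_Suc2)
    finally show ?thesis by (simp only: mult.assoc)
  qed
  also have "dl * (?P * A1 * fE) + ?P * (Jh - 1) * fK + fsc (qs m) * (fsc cc * (A1' ^ m * (Jh * A1) - ?P) * fK)
     = dl * (?P * A1 * fE) + (?P * (Jh - 1) + fsc (qs m) * (fsc cc * (A1' ^ m * (Jh * A1) - ?P))) * fK"
    by (simp only: distrib_right mult.assoc add.assoc)
  finally show ?case unfolding main PA by (simp only: mult.assoc)
qed

text \<open>The coefficients of the Drinfeld polynomial are, up to nonzero factors, the vacuum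
  expectation values of \<open>(X\<^sup>+\<^sub>0)\<^sup>n (X\<^sup>-\<^sub>1)\<^sup>n\<close>.\<close>

lemma drinfeld_coeff_zero:
  fixes P u :: "nat \<Rightarrow> complex"
  assumes E: "app (\<rho> (XP 0)) v = 0" and K: "app (\<rho> KP) v = sm lam v" and lam: "lam \<noteq> 0"
    and J: "\<And>t. t > 0 \<Longrightarrow> app (\<rho> (JJ t)) v = sm (u t) v"
    and P0: "P 0 = 1"
    and P: "\<And>n. cc ^ n * P n = (\<Sum>i\<le>n. (if i = 0 then 1 else (q - inverse q) * u i) * P (n - i))"
    and v: "v \<noteq> 0" and nil: "app (\<rho> (XM 1) ^ n) v = 0"
  shows "P n = 0"
proof -
  define Pf :: "'i lop fps" where "Pf = Abs_fps (\<lambda>n. sc (P n))"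
  \<comment> \<open>Coefficients are evaluated at \<open>v\<close>, since \<open>Jh * Pf\<close> and
    \<open>scl Pf\<close> agree only there; \<open>act_cong\<close> allows the replacement in the
    rightmost factors.\<close>
  define act where "act F n = app (fps_nth F n) v" for F n
  have Pf_central: "F * Pf = Pf * F" for F
  proof (rule fps_ext)
    fix n
    show "fps_nth (F * Pf) n = fps_nth (Pf * F) n" unfolding fps_mult_nth
      by (rule sum.reindex_bij_witness[of _ "\<lambda>i. n - i" "\<lambda>i. n - i"]) (auto simp: Pf_def sc_central)
  qed
  have act_mult: "act (F * G) n = (\<Sum>i\<le>n. app (fps_nth F i) (act G (n - i)))" for F G n
    by (simp add: act_def fps_mult_nth sum_app atLeast0AtMost)
  have act_cong: "act (F * G) = act (F * H)" if "act G = act H" for F G H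
    by (rule ext) (simp add: act_mult that)
  have act_simps: "act (F + G) n = act F n + act G n" "act (F - G) n = act F n - act G n"
     "act (fsc c * F) n = sm c (act F n)" for F G n c
    by (auto simp: act_def)
  have act_const: "act (F * fps_const B) n = app (fps_nth F n) (app B v)" for F B n
    by (simp add: act_def)
  have JP: "act (Jh * Pf) = act (scl Pf)"
  proof (rule ext)
    fix n
    have "act (Jh * Pf) n = (\<Sum>i\<le>n. sm ((if i = 0 then 1 else (q - inverse q) * u i) * P (n - i)) v)"
      unfolding act_mult by (intro sum.cong refl) (auto simp: Pf_def act_def Jh_def J mult_ac)
    also have "\<dots> = act (scl Pf) n"
      by (simp only: sum_sm_left[symmetric] P[symmetric]) (simp add: act_def Pf_def mult.commute)
    finally show "act (Jh * Pf) n = act (scl Pf) n" .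
  qed
  \<comment> \<open>\<open>X^+_0\<close> trades one factor \<open>A1\<close> for one degree in z, up
    to a factor that is nonzero for every \<open>m\<close> and \<open>r\<close>.\<close>
  have step: "app (\<rho> (XP 0)) (act (A1 ^ Suc m * Pf) r)
     = sm (qs m * lam * (cc ^ Suc r - 1) / (q - inverse q)) (act (A1 ^ m * Pf) (Suc r))" for m r
  proof -
    have "act (dl * (fE * A1 ^ Suc m) * Pf) (Suc r) = sm (q - inverse q) (app (\<rho> (XP 0)) (act (A1 ^ Suc m * Pf) r))"
      by (simp add: act_def mult.assoc)
    also have "dl * (fE * A1 ^ Suc m) * Pf
      = (dl * A1 ^ Suc m * Pf) * fE + (fsc (qs m) * (A1' ^ m * (Jh * Pf) - A1 ^ m * Pf)) * fK"
      unfolding E_A1_power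
      by (simp only: distrib_right left_diff_distrib right_diff_distrib mult.assoc Pf_central[of fE] Pf_central[of fK])
    also have "act \<dots> (Suc r) = sm (qs m * lam) (act (A1' ^ m * (Jh * Pf) - A1 ^ m * Pf) (Suc r))"
      by (simp only: act_simps act_const E K app_lin' app_lin) (simp add: act_def mult.commute)
    also have "act (A1' ^ m * (Jh * Pf) - A1 ^ m * Pf) (Suc r) = act (scl (A1 ^ m * Pf)) (Suc r) - act (A1 ^ m * Pf) (Suc r)"
      by (simp only: act_simps act_cong[OF JP] scl_mult scl_power)
    also have "act (scl (A1 ^ m * Pf)) (Suc r) = sm (cc ^ Suc r) (act (A1 ^ m * Pf) (Suc r))"
      by (simp add: act_def)
    also have "sm (cc ^ Suc r) (act (A1 ^ m * Pf) (Suc r)) - act (A1 ^ m * Pf) (Suc r)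
       = sm (cc ^ Suc r - 1) (act (A1 ^ m * Pf) (Suc r))"
      by (simp only: sm_diff_left sm_simps)
    finally have "sm (1 / (q - inverse q)) (sm (q - inverse q) (app (\<rho> (XP 0)) (act (A1 ^ Suc m * Pf) r)))
       = sm (1 / (q - inverse q)) (sm (qs m * lam) (sm (cc ^ Suc r - 1) (act (A1 ^ m * Pf) (Suc r))))"
      by simp
    then show ?thesis using qd by (simp only: sm_simps) (simp add: field_simps)
  qed
  \<comment> \<open>Descent along the diagonal: at \<open>r = 0\<close> the coefficient is
    \<open>(X^-_1)^n v\<close>, which vanishes by assumption, and at \<open>r = n\<close> it is
    \<open>P n\<close> times \<open>v\<close>.\<close>
  have "act (A1 ^ (n - r) * Pf) r = 0" if "r \<le> n" for r
    using that
  proof (induction r)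
    case 0
    have "fps_nth (A1 ^ n * Pf) 0 = \<rho> (XM 1) ^ n"
      by (simp add: fps_power_zeroth Pf_def Aser_def P0 sc_simps)
    then show ?case using nil by (simp add: act_def)
  next
    case (Suc r)
    define m where "m = n - Suc r"
    have m: "n - r = Suc m" using Suc.prems by (simp add: m_def)
    have "act (A1 ^ Suc m * Pf) r = 0" using Suc by (simp only: m Suc_leD)
    then have "sm (qs m * lam * (cc ^ Suc r - 1) / (q - inverse q)) (act (A1 ^ m * Pf) (Suc r)) = 0"
      using step[of m r] by (simp only: app_lin')
    moreover have "qs m * lam * (cc ^ Suc r - 1) / (q - inverse q) \<noteq> 0"
      using qs_ne0[of m] lam cc_pow_ne1[of "Suc r"] qd by simp
    ultimately show ?case unfolding sm_eq_0_iff m_def by blast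
  qed
  from this[of n] have "sm (P n) v = 0" by (simp add: act_def Pf_def)
  then show ?thesis using v by (simp add: sm_eq_0_iff)
qed

end

section \<open>Families of highest weight vectors\<close>

declare plus_fun_apply [simp del] zero_fun_apply [simp del] minus_apply [simp del] uminus_apply [simp del]

lemmas fun_apply = plus_fun_apply zero_fun_apply minus_apply uminus_apply

definition subsp :: "('i \<Rightarrow> complex) set \<Rightarrow> bool" where
  "subsp W \<longleftrightarrow> 0 \<in> W \<and> (\<forall>x\<in>W. \<forall>y\<in>W. x + y \<in> W) \<and> (\<forall>c. \<forall>x\<in>W. sm c x \<in> W)"

lemma subspD:
  assumes "subsp W"
  shows "0 \<in> W" "x \<in> W \<Longrightarrow> y \<in> W \<Longrightarrow> x + y \<in> W" "x \<in> W \<Longrightarrow> sm c x \<in> W"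
    "x \<in> W \<Longrightarrow> y \<in> W \<Longrightarrow> x - y \<in> W"
proof -
  show *: "0 \<in> W" "x \<in> W \<Longrightarrow> y \<in> W \<Longrightarrow> x + y \<in> W" "x \<in> W \<Longrightarrow> sm c x \<in> W" for x y c
    using assms by (auto simp: subsp_def)
  show "x - y \<in> W" if "x \<in> W" "y \<in> W"
    using *(2)[OF that(1) *(3)[OF that(2), of "-1"]] by (simp add: sm_minus_left)
qed

lemma subsp_sum: "subsp W \<Longrightarrow> (\<And>i. i \<in> S \<Longrightarrow> f i \<in> W) \<Longrightarrow> sum f S \<in> W"
  by (induction S rule: infinite_finite_induct) (simp_all only: sum.infinite sum.empty sum.insert not_False_eq_True subspD insertI1 insertI2)

text \<open>Applying \<open>K - \<mu> (Suc N)\<close> removes the last summand and multiplies the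
  others by nonzero scalars, so induction applies. For \<open>W = {0}\<close> this is the linear
  independence of eigenvectors with distinct eigenvalues.\<close>

lemma eigen_components:
  fixes N :: nat
  assumes W: "subsp W" and K: "\<And>x. x \<in> W \<Longrightarrow> app K x \<in> W"
    and "\<forall>j\<le>N. app K (y j) = sm (\<mu> j) (y j)" and "inj_on \<mu> {..N}"
    and "(\<Sum>j\<le>N. y j) \<in> W" and "j \<le> N"
  shows "y j \<in> W"
  using assms(3-)
proof (induction N arbitrary: y j)
  case 0
  then show ?case by simp
next
  case (Suc N)
  let ?w = "\<Sum>j\<le>Suc N. y j"
  define z where "z j = sm (\<mu> j - \<mu> (Suc N)) (y j)" for j
  have "app K ?w - sm (\<mu> (Suc N)) ?w = (\<Sum>j\<le>Suc N. z j)"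
    unfolding app_sum sm_sum sum_subtractf[symmetric] z_def sm_diff_left
    using Suc.prems(1) by (intro sum.cong refl) simp
  also have "\<dots> = (\<Sum>j\<le>N. z j)" by (simp add: z_def)
  finally have "(\<Sum>j\<le>N. z j) \<in> W"
    using subspD[OF W] K Suc.prems(3) by metis
  moreover have "app K (z j) = sm (\<mu> j) (z j)" if "j \<le> N" for j
    using Suc.prems(1) that by (simp add: z_def mult_ac)
  moreover have "inj_on \<mu> {..N}" using Suc.prems(2) by (rule inj_on_subset) auto
  ultimately have zW: "z j \<in> W" if "j \<le> N" for j using Suc.IH that by blast
  have yW: "y j \<in> W" if "j \<le> N" for j
  proof -
    have ne: "\<mu> j - \<mu> (Suc N) \<noteq> 0" using inj_onD[OF Suc.prems(2), of j "Suc N"] that by auto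
    have "sm (1 / (\<mu> j - \<mu> (Suc N))) (z j) \<in> W" by (rule subspD(3)[OF W zW[OF that]])
    then show ?thesis using ne by (simp add: z_def)
  qed
  have "?w - (\<Sum>j\<le>N. y j) \<in> W"
    by (rule subspD(4)[OF W Suc.prems(3) subsp_sum[OF W yW]]) auto
  then have "y (Suc N) \<in> W" by simp
  then show ?case using yW Suc.prems(4) le_Suc_eq by auto
qed

lemma subsp_zero: "subsp {0}"
  by (auto simp: subsp_def)

text \<open>A family of highest weight vectors of the same weight, with coefficients varying in a
  ring \<open>C\<close> of functions on the index set: constants for comparing modules, convergent sequences
  for passing to a limit.\<close>

locale hwfam = quantum q for q +
  fixes \<rho> :: "'m \<Rightarrow> gen \<Rightarrow> 'i lop" and v :: "'m \<Rightarrow> 'i \<Rightarrow> complex"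
    and lam :: complex and u :: "'m \<Rightarrow> nat \<Rightarrow> complex" and C :: "('m \<Rightarrow> complex) set"
  assumes rep: "\<And>m. urep q (\<rho> m)" and lam: "lam \<noteq> 0"
    and vE: "\<And>m t. app (\<rho> m (XP t)) (v m) = 0"
    and vK: "\<And>m. app (\<rho> m KP) (v m) = sm lam (v m)"
    and vJ: "\<And>m t. t > 0 \<Longrightarrow> app (\<rho> m (JJ t)) (v m) = sm (u m t) (v m)"
    and C_const: "\<And>c. (\<lambda>_. c) \<in> C"
    and C_add: "\<And>c d. c \<in> C \<Longrightarrow> d \<in> C \<Longrightarrow> (\<lambda>m. c m + d m) \<in> C"
    and C_mult: "\<And>c d. c \<in> C \<Longrightarrow> d \<in> C \<Longrightarrow> (\<lambda>m. c m * d m) \<in> C"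
    and C_u: "\<And>t. t > 0 \<Longrightarrow> (\<lambda>m. u m t) \<in> C"
begin

text \<open>The submodule generated by the whole family: one expression is evaluated in every member
  simultaneously, so that its values in different members can be compared. Only lowering operators
  are constructors; closure under all generators is the content of \<open>G_gen\<close>.\<close>

inductive_set G :: "('m \<Rightarrow> 'i \<Rightarrow> complex) set" where
  G_v: "v \<in> G"
| G_XM: "x \<in> G \<Longrightarrow> (\<lambda>m. app (\<rho> m (XM t)) (x m)) \<in> G"
| G_add: "x \<in> G \<Longrightarrow> y \<in> G \<Longrightarrow> (\<lambda>m. x m + y m) \<in> G"
| G_sm: "x \<in> G \<Longrightarrow> c \<in> C \<Longrightarrow> (\<lambda>m. sm (c m) (x m)) \<in> G"

lemma G_smc: "x \<in> G \<Longrightarrow> (\<lambda>m. sm c (x m)) \<in> G"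
  by (rule G_sm[OF _ C_const])

lemma G_0: "(\<lambda>_. 0) \<in> G"
  using G_smc[OF G_v, of 0] by simp

lemma G_diff: "x \<in> G \<Longrightarrow> y \<in> G \<Longrightarrow> (\<lambda>m. x m - y m) \<in> G"
  using G_add[OF _ G_smc[of y "-1"], of x] by (simp add: sm_minus_left)

lemma G_KP: "x \<in> G \<Longrightarrow> (\<lambda>m. app (\<rho> m KP) (x m)) \<in> G"
proof (induction rule: G.induct)
  case G_v
  then show ?case unfolding vK by (rule G_smc[OF G.G_v])
next
  case (G_XM x t)
  have "app (\<rho> m KP) (app (\<rho> m (XM t)) (x m)) = sm cc (app (\<rho> m (XM t)) (app (\<rho> m KP) (x m)))" for m
    using arg_cong[OF urep.KXm'[OF rep, of m t], of "\<lambda>A. app A (x m)"] by simp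
  then show ?case by (simp only: G_smc G.G_XM G_XM)
next
  case (G_add x y)
  then show ?case by (simp add: G.G_add)
next
  case (G_sm x c)
  then show ?case using G.G_sm by simp
qed

lemma vKM: "app (\<rho> m KM) (v m) = sm (1 / lam) (v m)"
proof -
  have "app (\<rho> m KM * \<rho> m KP) (v m) = v m" by (simp add: urep.KK[OF rep])
  then have "sm (1 / lam) (sm lam (app (\<rho> m KM) (v m))) = sm (1 / lam) (v m)" by (simp add: vK)
  then show ?thesis using lam by simp
qed

lemma G_KM: "x \<in> G \<Longrightarrow> (\<lambda>m. app (\<rho> m KM) (x m)) \<in> G"
proof (induction rule: G.induct)
  case G_v
  then show ?case unfolding vKM by (rule G_smc[OF G.G_v])
next
  case (G_XM x t)
  have "app (\<rho> m KM) (app (\<rho> m (XM t)) (x m)) = sm (q^2) (app (\<rho> m (XM t)) (app (\<rho> m KM) (x m)))" for m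
    using arg_cong[OF urep.KmXm'[OF rep, of m t], of "\<lambda>A. app A (x m)"] by simp
  then show ?case by (simp only: G_smc G.G_XM G_XM)
next
  case (G_add x y)
  then show ?case by (simp add: G.G_add)
next
  case (G_sm x c)
  then show ?case using G.G_sm by simp
qed

lemma J0_KM: "app (\<rho> m (JJ 0)) x = sm (1 / (q - inverse q)) (x - app (\<rho> m KM) (app (\<rho> m KM) x))"
proof -
  have "app (\<rho> m KM) (app (\<rho> m KM) x) = x - sm (q - inverse q) (app (\<rho> m (JJ 0)) x)"
    using arg_cong[OF urep.KM2[OF rep, of m], of "\<lambda>A. app A x"] by simp
  then have "x - app (\<rho> m KM) (app (\<rho> m KM) x) = sm (q - inverse q) (app (\<rho> m (JJ 0)) x)"
    by simp
  then show ?thesis using qd by (simp only: sm_simps) simp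
qed

text \<open>Moving \<open>J_(t+1)\<close> past \<open>X^-_s\<close> costs terms with
  \<open>J_t\<close>, hence the outer induction on \<open>t\<close> for all elements of
  \<open>G\<close> and the inner one on the expression. The base case reduces \<open>J_0\<close> to
  \<open>K^-\<close>.\<close>

lemma G_J: "x \<in> G \<Longrightarrow> (\<lambda>m. app (\<rho> m (JJ t)) (x m)) \<in> G"
proof (induction t arbitrary: x)
  case 0
  then show ?case unfolding J0_KM by (intro G_smc G_diff G_KM)
next
  case (Suc t)
  show ?case using Suc.prems
  proof (induction rule: G.induct)
    case G_v
    show ?case using G_sm[OF G.G_v C_u[of "Suc t"]] by (simp add: vJ)
  next
    case (G_XM x s)
    have "app (\<rho> m (JJ (Suc t))) (app (\<rho> m (XM s)) (x m)) = app (\<rho> m (XM s)) (app (\<rho> m (JJ (Suc t))) (x m))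
       + (sm (inverse q^2) (app (\<rho> m (JJ t)) (app (\<rho> m (XM (s+1))) (x m)))
          - sm (q^2) (app (\<rho> m (XM (s+1))) (app (\<rho> m (JJ t)) (x m))))" for m
      using arg_cong[OF urep.JXm[OF rep, of m t s], of "\<lambda>A. app A (x m)"] by (simp add: algebra_simps)
    then show ?case by (simp only:) (intro G_add G_diff G_smc G.G_XM Suc.IH G_XM)
  next
    case (G_add x y)
    then show ?case by (simp add: G.G_add)
  next
    case (G_sm x c)
    then show ?case using G.G_sm by simp
  qed
qed

lemma G_XP: "x \<in> G \<Longrightarrow> (\<lambda>m. app (\<rho> m (XP t)) (x m)) \<in> G"
proof (induction rule: G.induct)
  case G_v
  then show ?case unfolding vE by (rule G_0)
next
  case (G_XM x s)
  have "app (\<rho> m (XP t)) (app (\<rho> m (XM s)) (x m)) = app (\<rho> m (XM s)) (app (\<rho> m (XP t)) (x m))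
      + app (\<rho> m KP) (app (\<rho> m (JJ (s + t))) (x m))" for m
    using arg_cong[OF urep.XX[OF rep, of m t s], of "\<lambda>A. app A (x m)"] by (simp add: algebra_simps)
  then show ?case by (simp only:) (intro G_add G.G_XM G_KP G_J G_XM)
next
  case (G_add x y)
  then show ?case by (simp add: G.G_add)
next
  case (G_sm x c)
  then show ?case using G.G_sm by simp
qed

lemma G_gen: "x \<in> G \<Longrightarrow> (\<lambda>m. app (\<rho> m g) (x m)) \<in> G"
  by (cases g) (auto intro: G_XP G_XM G_J G_KP G_KM)

text \<open>Decomposition into weight vectors \<open>xs j\<close> of weight \<open>lam cc\<^sup>j\<close>; the coefficient
  \<open>c\<close> of the top component is tracked because it depends on the member of the family only through
  \<open>C\<close>.\<close>

definition wdec :: "('m \<Rightarrow> 'i \<Rightarrow> complex) \<Rightarrow> ('m \<Rightarrow> complex) \<Rightarrow> nat \<Rightarrow> (nat \<Rightarrow> 'm \<Rightarrow> 'i \<Rightarrow> complex) \<Rightarrow> bool" where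
  "wdec x c N xs \<longleftrightarrow> c \<in> C \<and> (\<forall>j. xs j \<in> G) \<and> (\<forall>j m. app (\<rho> m KP) (xs j m) = sm (lam * cc ^ j) (xs j m))
     \<and> xs 0 = (\<lambda>m. sm (c m) (v m)) \<and> (\<forall>j>N. xs j = (\<lambda>_. 0)) \<and> (\<forall>m. x m = (\<Sum>j\<le>N. xs j m))"

lemma sum_pad: fixes N :: nat shows "(\<forall>j>N. f j = 0) \<Longrightarrow> N \<le> M \<Longrightarrow> (\<Sum>j\<le>M. f j) = (\<Sum>j\<le>N. f j :: 'b :: comm_monoid_add)"
  by (rule sum.mono_neutral_right) auto

lemma G_wdec: "x \<in> G \<Longrightarrow> \<exists>c N xs. wdec x c N xs"
proof (induction rule: G.induct)
  case G_v
  have "wdec v (\<lambda>_. 1) 0 (\<lambda>j. if j = 0 then v else (\<lambda>_. 0))"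
    by (simp add: wdec_def C_const G.G_v G_0 vK)
  then show ?case by blast
next
  case (G_XM x t)
  then obtain c N xs where w: "wdec x c N xs" by blast
  \<comment> \<open>\<open>X^-_t\<close> lowers every weight by one step, so the image has no top
    component and its coefficient is 0.\<close>
  define ys where "ys j = (case j of 0 \<Rightarrow> (\<lambda>_. 0) | Suc i \<Rightarrow> (\<lambda>m. app (\<rho> m (XM t)) (xs i m)))" for j
  have "app (\<rho> m KP) (ys j m) = sm (lam * cc ^ j) (ys j m)" for j m
  proof (cases j)
    case (Suc i)
    have "app (\<rho> m KP) (app (\<rho> m (XM t)) (xs i m)) = sm cc (app (\<rho> m (XM t)) (app (\<rho> m KP) (xs i m)))"
      using arg_cong[OF urep.KXm'[OF rep, of m t], of "\<lambda>A. app A (xs i m)"] by simp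
    then show ?thesis using w by (simp add: ys_def Suc wdec_def mult_ac)
  qed (simp add: ys_def)
  moreover have "(\<Sum>j\<le>Suc N. ys j m) = app (\<rho> m (XM t)) (x m)" for m
  proof -
    have "(\<Sum>j\<le>Suc N. ys j m) = (\<Sum>j\<le>N. app (\<rho> m (XM t)) (xs j m))"
      by (subst sum.atMost_Suc_shift) (simp add: ys_def)
    also have "\<dots> = app (\<rho> m (XM t)) (x m)" using w by (simp add: wdec_def app_sum)
    finally show ?thesis .
  qed
  moreover have "ys j \<in> G" for j
    using w by (cases j) (auto simp: ys_def wdec_def intro: G_0 G.G_XM)
  moreover have "\<forall>j>Suc N. ys j = (\<lambda>_. 0)"
    using w by (auto simp: ys_def wdec_def split: nat.split)
  ultimately have "wdec (\<lambda>m. app (\<rho> m (XM t)) (x m)) (\<lambda>_. 0) (Suc N) ys"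
    by (simp add: wdec_def C_const ys_def)
  then show ?case by blast
next
  case (G_add x y)
  then obtain c N xs d M ys where w: "wdec x c N xs" "wdec y d M ys" by blast
  let ?K = "max N M"
  have "x m = (\<Sum>j\<le>?K. xs j m)" "y m = (\<Sum>j\<le>?K. ys j m)" for m
    using w sum_pad[of N "\<lambda>j. xs j m" ?K] sum_pad[of M "\<lambda>j. ys j m" ?K] by (auto simp: wdec_def)
  then have "x m + y m = (\<Sum>j\<le>?K. xs j m + ys j m)" for m
    by (simp only: sum.distrib)
  then have "wdec (\<lambda>m. x m + y m) (\<lambda>m. c m + d m) ?K (\<lambda>j m. xs j m + ys j m)"
    using w by (auto simp: wdec_def C_add G.G_add sm_add_left)
  then show ?case by blast
next
  case (G_sm x d)
  then obtain c N xs where w: "wdec x c N xs" by blast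
  then have "wdec (\<lambda>m. sm (d m) (x m)) (\<lambda>m. d m * c m) N (\<lambda>j m. sm (d m) (xs j m))"
    using G_sm.hyps by (auto simp: wdec_def C_mult G.G_sm sm_sum mult_ac)
  then show ?case by blast
qed

lemma lam_inj: "inj_on (\<lambda>j. lam * cc ^ j) A"
  using lam by (auto simp: inj_on_def dest: cc_inj)

end

section \<open>Matrix modules\<close>

definition vf :: "complex vec \<Rightarrow> nat \<Rightarrow> complex" where
  "vf v = (\<lambda>i. if i < dim_vec v then vec_index v i else 0)"

definition Vn :: "nat \<Rightarrow> (nat \<Rightarrow> complex) set" where
  "Vn n = {x. \<forall>i\<ge>n. x i = 0}"

lemma vf_Vn: "v \<in> carrier_vec n \<Longrightarrow> vf v \<in> Vn n"
  by (auto simp: vf_def Vn_def)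

lemma vf_vec: "x \<in> Vn n \<Longrightarrow> vf (vec n x) = x"
  by (auto simp: vf_def Vn_def fun_eq_iff)

lemma vec_vf: "v \<in> carrier_vec n \<Longrightarrow> vec n (vf v) = v"
  by (auto simp: vf_def)

lemma vf_inj: "v \<in> carrier_vec n \<Longrightarrow> w \<in> carrier_vec n \<Longrightarrow> vf v = vf w \<longleftrightarrow> v = w"
  by (metis vec_vf)

lemma vf_simps:
  "v \<in> carrier_vec n \<Longrightarrow> w \<in> carrier_vec n \<Longrightarrow> vf (v + w) = vf v + vf w"
  "vf (c \<cdot>\<^sub>v v) = sm c (vf v)"
  "vf (0\<^sub>v n) = 0"
  by (auto simp: vf_def fun_eq_iff sm_def fun_apply)

lemma subsp_Vn: "subsp (Vn n)"
  by (auto simp: subsp_def Vn_def sm_def fun_apply)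

text \<open>A matrix acts on the first \<open>n\<close> coordinates and as the scalar \<open>d\<close> on the others. The relations
  are not homogeneous, so \<open>d\<close> has to be a one-dimensional representation: \<open>K\<^sup>+ = K\<^sup>- = 1\<close>, all other
  generators zero.\<close>

lift_definition ext :: "nat \<Rightarrow> complex \<Rightarrow> complex mat \<Rightarrow> nat lop" is
  "\<lambda>n d A x i. if i < n then (\<Sum>j<n. A $$ (i, j) * x j) else d * x i"
  by (auto simp: fun_eq_iff algebra_simps sum.distrib sm_def sum_distrib_left fun_apply)

lemma app_ext: "app (ext n d A) x i = (if i < n then (\<Sum>j<n. A $$ (i, j) * x j) else d * x i)"
  by (simp add: ext.rep_eq)

lemma ext_vf:
  assumes "A \<in> carrier_mat n n" "v \<in> carrier_vec n"
  shows "app (ext n d A) (vf v) = vf (A *\<^sub>v v)"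
  using assms by (auto simp: app_ext fun_eq_iff vf_def scalar_prod_def atLeast0LessThan intro!: sum.cong)

lemma ext_mult:
  assumes "A \<in> carrier_mat n n" "B \<in> carrier_mat n n"
  shows "ext n d A * ext n e B = ext n (d * e) (A * B)"
proof (rule lop_eqI, rule ext)
  fix x :: "nat \<Rightarrow> complex" and i
  show "app (ext n d A * ext n e B) x i = app (ext n (d * e) (A * B)) x i"
  proof (cases "i < n")
    case True
    have "(\<Sum>j<n. A $$ (i, j) * (\<Sum>k<n. B $$ (j, k) * x k)) = (\<Sum>k<n. (\<Sum>j<n. A $$ (i, j) * B $$ (j, k)) * x k)"
      unfolding sum_distrib_left sum_distrib_right by (subst sum.swap) (simp add: mult_ac)
    then show ?thesis using True assms by (simp add: app_ext scalar_prod_def atLeast0LessThan)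
  qed (simp add: app_ext)
qed

lemma ext_lin:
  assumes "A \<in> carrier_mat n n" "B \<in> carrier_mat n n"
  shows "ext n d A + ext n e B = ext n (d + e) (A + B)"
    "ext n d A - ext n e B = ext n (d - e) (A - B)"
  using assms
  by (auto intro!: lop_eqI simp: fun_eq_iff app_ext sm_def algebra_simps sum.distrib sum_subtractf sum_distrib_left fun_apply)

lemma ext_smult: "A \<in> carrier_mat n n \<Longrightarrow> sc c * ext n d A = ext n (c * d) (c \<cdot>\<^sub>m A)"
  by (auto intro!: lop_eqI simp: fun_eq_iff app_ext sm_def algebra_simps sum_distrib_left)

lemma ext_one: "ext n 1 (1\<^sub>m n) = 1"
proof (rule lop_eqI, rule ext)
  fix x :: "nat \<Rightarrow> complex" and i
  have "(\<Sum>j<n. (1\<^sub>m n) $$ (i, j) * x j) = (\<Sum>j<n. if j = i then x j else 0)" if "i < n"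
    using that by (intro sum.cong) auto
  then show "app (ext n 1 (1\<^sub>m n)) x i = app 1 x i" by (simp add: app_ext)
qed

fun reprM :: "umod \<Rightarrow> gen \<Rightarrow> nat lop" where
  "reprM M (XP t) = ext (dim M) 0 (Xp M t)"
| "reprM M (XM t) = ext (dim M) 0 (Xm M t)"
| "reprM M (JJ t) = ext (dim M) 0 (J M t)"
| "reprM M KP = ext (dim M) 1 (Kp M)"
| "reprM M KM = ext (dim M) 1 (Km M)"

fun matM :: "umod \<Rightarrow> gen \<Rightarrow> complex mat" where
  "matM M (XP t) = Xp M t"
| "matM M (XM t) = Xm M t"
| "matM M (JJ t) = J M t"
| "matM M KP = Kp M"
| "matM M KM = Km M"

lemma matM_carrier: "is_umod q M \<Longrightarrow> matM M g \<in> carrier_mat (dim M) (dim M)"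
  by (cases g) (auto simp: is_umod_def Let_def)

lemma reprM_vf:
  assumes "is_umod q M" "v \<in> carrier_vec (dim M)"
  shows "app (reprM M g) (vf v) = vf (matM M g *\<^sub>v v)"
  using matM_carrier[OF assms(1), of g] assms(2) by (cases g) (auto simp: ext_vf)

lemma matM_closed: "is_umod q M \<Longrightarrow> v \<in> carrier_vec (dim M) \<Longrightarrow> matM M g *\<^sub>v v \<in> carrier_vec (dim M)"
  using matM_carrier[of q M g] by (metis mult_mat_vec_carrier)

lemma reprM_Vn: "is_umod q M \<Longrightarrow> x \<in> Vn (dim M) \<Longrightarrow> app (reprM M g) x \<in> Vn (dim M)"
  using reprM_vf[of q M "vec (dim M) x" g] matM_closed[of q M "vec (dim M) x" g] vf_Vn vf_vec by auto

lemma urep_reprM: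
  assumes "quantum q" "is_umod q M"
  shows "urep q (reprM M)"
proof -
  interpret quantum q by fact
  note c = assms(2)[unfolded is_umod_def Let_def]
  have one: "1 = ext (dim M) 1 (1\<^sub>m (dim M))" by (simp add: ext_one)
  have C: "Xp M t \<in> carrier_mat (dim M) (dim M)" "Xm M t \<in> carrier_mat (dim M) (dim M)"
     "J M t \<in> carrier_mat (dim M) (dim M)" "Kp M \<in> carrier_mat (dim M) (dim M)" "Km M \<in> carrier_mat (dim M) (dim M)"
     "1\<^sub>m (dim M) \<in> carrier_mat (dim M) (dim M)" for t
    using c by auto
  note hom = ext_mult[where n = "dim M"] ext_lin[where n = "dim M"] ext_smult[where n = "dim M"]
  note Cc = mult_carrier_mat[where n = "dim M"] minus_carrier_mat smult_carrier_mat
  note sim = hom C Cc mult_zero_left mult_zero_right mult_1_left mult_1_right diff_zero diff_self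
  have R: "Kp M * J M t = J M t * Kp M" "J M s * J M t = J M t * J M s"
    "Kp M * Km M = 1\<^sub>m (dim M)" "Km M * Kp M = 1\<^sub>m (dim M)"
    "Km M * Km M = 1\<^sub>m (dim M) - (q - inverse q) \<cdot>\<^sub>m J M 0"
    "Xp M (t+1) * Xp M s - (q^2) \<cdot>\<^sub>m (Xp M s * Xp M (t+1))
            = (q^2) \<cdot>\<^sub>m (Xp M t * Xp M (s+1)) - Xp M (s+1) * Xp M t"
    "Xm M (t+1) * Xm M s - (inverse q^2) \<cdot>\<^sub>m (Xm M s * Xm M (t+1))
            = (inverse q^2) \<cdot>\<^sub>m (Xm M t * Xm M (s+1)) - Xm M (s+1) * Xm M t"
    "Kp M * Xp M t * Km M = (q^2) \<cdot>\<^sub>m Xp M t"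
    "Kp M * Xm M t * Km M = (inverse q^2) \<cdot>\<^sub>m Xm M t"
    "(q^2) \<cdot>\<^sub>m (J M 0 * Xp M t) - (inverse q^2) \<cdot>\<^sub>m (Xp M t * J M 0) = qbr q 2 \<cdot>\<^sub>m Xp M t"
    "(inverse q^2) \<cdot>\<^sub>m (J M 0 * Xm M t) - (q^2) \<cdot>\<^sub>m (Xm M t * J M 0) = (- qbr q 2) \<cdot>\<^sub>m Xm M t"
    "J M (s+1) * Xp M t - Xp M t * J M (s+1)
          = (q^2) \<cdot>\<^sub>m (J M s * Xp M (t+1)) - (inverse q^2) \<cdot>\<^sub>m (Xp M (t+1) * J M s)"
    "J M (s+1) * Xm M t - Xm M t * J M (s+1)
          = (inverse q^2) \<cdot>\<^sub>m (J M s * Xm M (t+1)) - (q^2) \<cdot>\<^sub>m (Xm M (t+1) * J M s)"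
    "Xp M t * Xm M s - Xm M s * Xp M t = Kp M * J M (s+t)" for s t
    using c unfolding comm_def by simp_all
  show ?thesis
    by unfold_locales (simp_all only: reprM.simps one sim R)
qed

definition simple_on :: "(gen \<Rightarrow> 'i lop) \<Rightarrow> ('i \<Rightarrow> complex) set \<Rightarrow> bool" where
  "simple_on \<rho> V \<longleftrightarrow> (\<forall>W. W \<subseteq> V \<and> subsp W \<and> (\<forall>x\<in>W. \<forall>g. app (\<rho> g) x \<in> W) \<longrightarrow> W = {0} \<or> W = V)"

lemma fd_simple_simple_on:
  assumes "fd_simple q M"
  shows "simple_on (reprM M) (Vn (dim M))"
  unfolding simple_on_def
proof (intro allI impI, elim conjE)
  fix W assume W: "W \<subseteq> Vn (dim M)" "subsp W" "\<forall>x\<in>W. \<forall>g. app (reprM M g) x \<in> W"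
  let ?n = "dim M"
  have M: "is_umod q M" using assms by (simp add: fd_simple_def)
  let ?U = "{v \<in> carrier_vec ?n. vf v \<in> W}"
  have g: "matM M g *\<^sub>v v \<in> ?U" if "v \<in> ?U" for g v
    using that W(3) reprM_vf[OF M, of v g] matM_closed[OF M, of v g] by (metis (mono_tags, lifting) mem_Collect_eq)
  have "is_submodule M ?U"
    unfolding is_submodule_def
    using subspD[OF W(2)] g[of _ "XP _"] g[of _ "XM _"] g[of _ "JJ _"] g[of _ KP] g[of _ KM]
    by (auto simp: vf_simps)
  then have "?U = {0\<^sub>v ?n} \<or> ?U = carrier_vec ?n" using assms by (auto simp: fd_simple_def)
  then show "W = {0} \<or> W = Vn ?n"
  proof
    assume U: "?U = {0\<^sub>v ?n}"
    have "x = 0" if "x \<in> W" for x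
    proof -
      have "vec ?n x \<in> ?U" using that W(1) vf_vec[of x ?n] by auto
      then have "vec ?n x = 0\<^sub>v ?n" using U by blast
      then show ?thesis using that W(1) vf_vec[of x ?n] by (auto simp: vf_simps)
    qed
    then show ?thesis using subspD(1)[OF W(2)] by auto
  next
    assume U: "?U = carrier_vec ?n"
    have "x \<in> W" if "x \<in> Vn ?n" for x
      using U that vf_vec[of x ?n] by (metis (mono_tags, lifting) mem_Collect_eq vec_carrier)
    then show ?thesis using W(1) by auto
  qed
qed

definition hw :: "(gen \<Rightarrow> 'i lop) \<Rightarrow> complex \<times> (nat \<Rightarrow> complex) \<Rightarrow> ('i \<Rightarrow> complex) \<Rightarrow> bool" where
  "hw \<rho> u v \<longleftrightarrow> v \<noteq> 0 \<and> (\<forall>t. app (\<rho> (XP t)) v = 0) \<and> app (\<rho> KP) v = sm (fst u) v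
      \<and> (\<forall>t>0. app (\<rho> (JJ t)) v = sm (snd u t) v)"

lemma hw_vf:
  assumes M: "is_umod q M" and v: "v \<in> carrier_vec (dim M)"
  shows "hw (reprM M) u (vf v) \<longleftrightarrow> v \<noteq> 0\<^sub>v (dim M) \<and> (\<forall>t. Xp M t *\<^sub>v v = 0\<^sub>v (dim M)) \<and>
        Kp M *\<^sub>v v = fst u \<cdot>\<^sub>v v \<and> (\<forall>t>0. J M t *\<^sub>v v = snd u t \<cdot>\<^sub>v v)"
proof -
  have z: "vf w = 0 \<longleftrightarrow> w = 0\<^sub>v (dim M)" if "w \<in> carrier_vec (dim M)" for w
    using that vf_inj[of w "dim M" "0\<^sub>v (dim M)"] by (simp add: vf_simps)
  have e: "vf w = sm c (vf v) \<longleftrightarrow> w = c \<cdot>\<^sub>v v" if "w \<in> carrier_vec (dim M)" for w c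
    using that v vf_inj[of w "dim M" "c \<cdot>\<^sub>v v"] by (simp add: vf_simps)
  have c: "matM M g *\<^sub>v v \<in> carrier_vec (dim M)" for g by (rule matM_closed[OF M v])
  show ?thesis
    unfolding hw_def reprM_vf[OF M v] z[OF c] z[OF v] e[OF c] by simp
qed

lemma is_L_iff:
  "is_L q M u \<longleftrightarrow> fd_simple q M \<and> (\<exists>x\<in>Vn (dim M). hw (reprM M) u x)"
proof -
  have "(\<exists>x\<in>Vn (dim M). hw (reprM M) u x) \<longleftrightarrow> (\<exists>v\<in>carrier_vec (dim M). hw (reprM M) u (vf v))"
    by (metis vf_Vn vf_vec vec_carrier)
  then show ?thesis unfolding is_L_def fd_simple_def using hw_vf[of q M _ u] by blast
qed

section \<open>Highest weights determine simple modules\<close>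

text \<open>Gaussian elimination, one equation per induction step; there are \<open>D + 1\<close>
  unknowns for at most \<open>D\<close> equations.\<close>

lemma underdetermined:
  fixes f :: "nat \<Rightarrow> 'a \<Rightarrow> complex"
  assumes "finite A" "card A \<le> D"
  shows "\<exists>c. (\<exists>i\<le>D. c i \<noteq> 0) \<and> (\<forall>a\<in>A. (\<Sum>i\<le>D. c i * f i a) = 0)"
  using assms
proof (induction A arbitrary: D f rule: finite_induct)
  case empty
  then show ?case by (intro exI[of _ "\<lambda>_. 1"]) auto
next
  case (insert a A)
  then obtain E where D: "D = Suc E" and E: "card A \<le> E" by (cases D) auto
  show ?case
  proof (cases "\<forall>i\<le>D. f i a = 0")
    case True
    have "card A \<le> D" using E D by simp
    then obtain c where "\<exists>i\<le>D. c i \<noteq> 0" "\<forall>a\<in>A. (\<Sum>i\<le>D. c i * f i a) = 0"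
      using insert.IH by blast
    then show ?thesis using True by (intro exI[of _ c]) auto
  next
    case False
    then obtain p where p: "p \<le> D" "f p a \<noteq> 0" by blast
    \<comment> \<open>The pivot \<open>p\<close> is swapped into the last position, so that the
      unknowns left after elimination are again an initial segment.\<close>
    define s where "s i = (if i = p then D else if i = D then p else i)" for i
    have s: "s i \<le> D" if "i \<le> D" for i using p that by (auto simp: s_def)
    have ss: "s (s i) = i" for i by (auto simp: s_def)
    have sD: "s D = p" by (auto simp: s_def)
    define g where "g i = f (s i)" for i
    have gD: "g D a \<noteq> 0" using p by (simp add: g_def sD)
    obtain c where c: "\<exists>i\<le>E. c i \<noteq> 0" "\<forall>b\<in>A. (\<Sum>i\<le>E. c i * (g i b - g i a / g D a * g D b)) = 0"
      using insert.IH[OF E, of "\<lambda>i b. g i b - g i a / g D a * g D b"] by blast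
    define d where "d i = (if i \<le> E then c i else - (\<Sum>i\<le>E. c i * g i a) / g D a)" for i
    have sum: "(\<Sum>i\<le>D. d i * g i b) = (\<Sum>i\<le>E. c i * (g i b - g i a / g D a * g D b))" for b
    proof -
      have "(\<Sum>i\<le>D. d i * g i b) = (\<Sum>i\<le>E. c i * g i b) - (\<Sum>i\<le>E. c i * g i a) / g D a * g D b"
      proof -
        have "(\<Sum>i\<le>D. d i * g i b) = (\<Sum>i\<le>E. d i * g i b) + d D * g D b" by (simp add: D)
        also have "d D = - (\<Sum>i\<le>E. c i * g i a) / g D a" by (simp add: d_def D)
        finally show ?thesis by (simp add: d_def)
      qed
      also have "\<dots> = (\<Sum>i\<le>E. c i * (g i b - g i a / g D a * g D b))"
      proof -
        have "(\<Sum>i\<le>E. c i * g i a) / g D a * g D b = (\<Sum>i\<le>E. c i * (g i a / g D a * g D b))"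
          by (simp add: sum_divide_distrib sum_distrib_right mult.assoc)
        then show ?thesis by (simp only: right_diff_distrib sum_subtractf)
      qed
      finally show ?thesis .
    qed
    have reidx: "(\<Sum>i\<le>D. d (s i) * f i b) = (\<Sum>i\<le>D. d i * g i b)" for b
      by (rule sum.reindex_bij_witness[of _ s s]) (auto simp: s ss g_def)
    have "\<forall>b\<in>insert a A. (\<Sum>i\<le>D. d (s i) * f i b) = 0"
      unfolding reidx sum using c(2) gD by simp
    moreover have "\<exists>i\<le>D. d (s i) \<noteq> 0"
    proof -
      obtain i where "i \<le> E" "c i \<noteq> 0" using c(1) by blast
      then show ?thesis using s[of i] D by (intro exI[of _ "s i"]) (auto simp: ss d_def)
    qed
    ultimately show ?thesis by (intro exI[of _ "\<lambda>i. d (s i)"]) blast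
  qed
qed

section \<open>Comparing two members of a family\<close>

definition stable :: "(gen \<Rightarrow> 'i lop) \<Rightarrow> ('i \<Rightarrow> complex) set \<Rightarrow> bool" where
  "stable \<rho> V \<longleftrightarrow> subsp V \<and> (\<forall>x\<in>V. \<forall>g. app (\<rho> g) x \<in> V)"

lemma stable_Vn: "is_umod q M \<Longrightarrow> stable (reprM M) (Vn (dim M))"
  using reprM_Vn subsp_Vn by (auto simp: stable_def)

lemma simple_onD: "simple_on \<rho> V \<Longrightarrow> stable \<rho> W \<Longrightarrow> W \<subseteq> V \<Longrightarrow> W = {0} \<or> W = V"
  by (auto simp: simple_on_def stable_def)

lemma hw_fst_ne0: "urep q \<rho> \<Longrightarrow> hw \<rho> u v \<Longrightarrow> fst u \<noteq> 0"
proof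
  assume r: "urep q \<rho>" "hw \<rho> u v" "fst u = 0"
  then have "app (\<rho> KM * \<rho> KP) v = 0" by (simp add: hw_def)
  then show False using r by (simp add: urep.KK hw_def)
qed

context hwfam
begin

lemma G_in_stable:
  assumes "stable (\<rho> m) V" "v m \<in> V" "x \<in> G"
  shows "x m \<in> V"
  using assms(3) by (induction rule: G.induct) (use assms(1,2) in \<open>auto simp: stable_def subspD\<close>)

lemma stable_values: "stable (\<rho> m) ((\<lambda>x. x m) ` G)"
proof -
  have img: "x m \<in> (\<lambda>x. x m) ` G" if "x \<in> G" for x using that by (rule imageI)
  have "app (\<rho> m g) (x m) \<in> (\<lambda>x. x m) ` G" if "x \<in> G" for x g
    by (rule img[OF G_gen[OF that]])
  moreover have "x m + y m \<in> (\<lambda>x. x m) ` G" if "x \<in> G" "y \<in> G" for x y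
    by (rule img[OF G_add[OF that]])
  moreover have "sm c (x m) \<in> (\<lambda>x. x m) ` G" if "x \<in> G" for x c
    by (rule img[OF G_smc[OF that]])
  moreover have "0 \<in> (\<lambda>x. x m) ` G" by (rule img[OF G_0])
  ultimately show ?thesis unfolding stable_def subsp_def by blast
qed

lemma values_eq:
  assumes "simple_on (\<rho> m) V" "stable (\<rho> m) V" "v m \<in> V" "v m \<noteq> 0"
  shows "(\<lambda>x. x m) ` G = V"
proof -
  have "v m \<in> (\<lambda>x. x m) ` G" by (rule imageI[OF G_v])
  moreover have "(\<lambda>x. x m) ` G \<subseteq> V" using G_in_stable[OF assms(2,3)] by blast
  ultimately show ?thesis using simple_onD[OF assms(1) stable_values] assms(4) by blast
qed

lemma wdec_zero:
  assumes "wdec x c N xs" "x m = 0"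
  shows "xs j m = 0"
proof (cases "j \<le> N")
  case True
  have "xs j m \<in> {0}"
    by (rule eigen_components[OF subsp_zero, of "\<rho> m KP" N "\<lambda>j. xs j m" "\<lambda>j. lam * cc ^ j"])
       (use assms True lam_inj in \<open>auto simp: wdec_def\<close>)
  then show ?thesis by simp
next
  case False
  then show ?thesis using assms by (auto simp: wdec_def)
qed

text \<open>If all coefficients agree at \<open>a\<close> and \<open>b\<close>, then the pairs \<open>(x a, x b)\<close> with \<open>x \<in> G\<close> form
  the graph of an isomorphism: a vector in the kernel of the first projection has no top component
  in \<open>b\<close>, hence generates a proper submodule.\<close>

lemma kernel_avoids:
  assumes C: "\<And>c. c \<in> C \<Longrightarrow> c a = c b" and v: "v a \<noteq> 0" "v b \<noteq> 0"
    and x: "x \<in> G" "x a = 0"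
  shows "x b \<noteq> v b"
proof
  assume xb: "x b = v b"
  obtain c N xs where w: "wdec x c N xs" using G_wdec[OF x(1)] by blast
  have "xs 0 a = 0" by (rule wdec_zero[OF w x(2)])
  then have "c a = 0" using w v by (auto simp: wdec_def sm_eq_0_iff)
  then have "c b = 0" using C[of c] w by (simp add: wdec_def)
  then have x0: "xs 0 b = 0" using w by (simp add: wdec_def)
  \<comment> \<open>Subtracting \<open>v\<close> gives a family that vanishes at \<open>b\<close>
    but whose top component there is \<open>- v b\<close>, contradicting
    \<open>wdec_zero\<close>.\<close>
  have "wdec (\<lambda>m. x m - v m) (\<lambda>m. c m - 1) N (\<lambda>j m. if j = 0 then xs j m - v m else xs j m)"
  proof -
    have "(\<Sum>j\<le>N. if j = 0 then xs j m - v m else xs j m) = (\<Sum>j\<le>N. xs j m) - v m" for m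
    proof -
      have "(\<Sum>j\<le>N. if j = 0 then xs j m - v m else xs j m) = (\<Sum>j\<le>N. xs j m - (if j = 0 then v m else 0))"
        by (rule sum.cong) auto
      then show ?thesis by (simp add: sum_subtractf)
    qed
    moreover have "(\<lambda>m. c m - 1) \<in> C" using w C_add[of c "\<lambda>_. -1"] C_const by (simp add: wdec_def)
    moreover have "(\<lambda>m. if j = 0 then xs j m - v m else xs j m) \<in> G" for j
    proof -
      have X: "xs j \<in> G" for j using w by (simp add: wdec_def)
      show ?thesis using G_diff[OF X[of 0] G_v] X[of j] by (cases "j = 0") simp_all
    qed
    ultimately show ?thesis using w by (auto simp: wdec_def vK sm_diff_left mult_ac)
  qed
  then have "(if (0::nat) = 0 then xs 0 b - v b else xs 0 b) = 0"
    by (rule wdec_zero) (simp add: xb)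
  then show False using x0 v by simp
qed

text \<open>The values at \<open>b\<close> of all families vanishing at \<open>a\<close> form a
  submodule, which misses \<open>v b\<close> by \<open>kernel_avoids\<close>; simplicity of the
  member \<open>b\<close> makes it zero.\<close>

lemma kernel_trivial:
  assumes C: "\<And>c. c \<in> C \<Longrightarrow> c a = c b" and v: "v a \<noteq> 0" "v b \<noteq> 0"
    and V: "simple_on (\<rho> b) V" "stable (\<rho> b) V" "v b \<in> V"
    and x: "x \<in> G" "x a = 0"
  shows "x b = 0"
proof -
  let ?W = "{x b | x. x \<in> G \<and> x a = 0}"
  have "stable (\<rho> b) ?W"
  proof -
    have "app (\<rho> b g) (x b) \<in> ?W" if "x \<in> G" "x a = 0" for x g
      using G_gen[OF that(1), of g] that(2) by force
    moreover have "x b + y b \<in> ?W" if "x \<in> G" "y \<in> G" "x a = 0" "y a = 0" for x y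
      using G_add[OF that(1,2)] that(3,4) by force
    moreover have "sm c (x b) \<in> ?W" if "x \<in> G" "x a = 0" for x c
      using G_smc[OF that(1), of c] that(2) by force
    moreover have "0 \<in> ?W" using G_0 by force
    ultimately show ?thesis unfolding stable_def subsp_def by blast
  qed
  moreover have "?W \<subseteq> V" using G_in_stable[OF V(2,3)] by blast
  moreover have "?W \<noteq> V"
  proof
    assume "?W = V"
    then obtain y where "y \<in> G" "y a = 0" "v b = y b" using V(3) by fastforce
    then show False using kernel_avoids[of a b y] C v by metis
  qed
  ultimately have "?W = {0}" using simple_onD[OF V(1)] by blast
  then show ?thesis using x by blast
qed

end

section \<open>Linear maps between coordinate spaces and their matrices\<close>

lemma mat_eqI_vec:
  assumes "A \<in> carrier_mat m n" "B \<in> carrier_mat m n"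
    and "\<And>v. v \<in> carrier_vec n \<Longrightarrow> A *\<^sub>v v = B *\<^sub>v v"
  shows "A = (B :: complex mat)"
proof (rule eq_matI)
  fix i j assume ij: "i < dim_row B" "j < dim_col B"
  have "A *\<^sub>v unit_vec n j = B *\<^sub>v unit_vec n j" by (rule assms(3)) simp
  then have "vec_index (A *\<^sub>v unit_vec n j) i = vec_index (B *\<^sub>v unit_vec n j) i" by simp
  then show "A $$ (i, j) = B $$ (i, j)" using ij assms(1,2) by simp
qed (use assms in auto)

text \<open>Linearity is required on a subspace only: the maps to be turned into matrices are
  defined by choice and are uncontrolled elsewhere.\<close>

definition lin_on :: "('i \<Rightarrow> complex) set \<Rightarrow> (('i \<Rightarrow> complex) \<Rightarrow> 'j \<Rightarrow> complex) \<Rightarrow> bool" where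
  "lin_on V f \<longleftrightarrow> (\<forall>x\<in>V. \<forall>y\<in>V. f (x + y) = f x + f y) \<and> (\<forall>x\<in>V. \<forall>c. f (sm c x) = sm c (f x))"

lemma lin_on_sum:
  assumes V: "subsp V" and f: "lin_on V f" and x: "\<And>i. i \<in> S \<Longrightarrow> x i \<in> V"
  shows "f (\<Sum>i\<in>S. sm (c i) (x i)) = (\<Sum>i\<in>S. sm (c i) (f (x i)))"
proof -
  have z: "f 0 = 0"
    using f subspD(1)[OF V] unfolding lin_on_def by (metis sm_simps(6))
  show ?thesis using x
  proof (induction S rule: infinite_finite_induct)
    case (insert i S)
    have "(\<Sum>i\<in>S. sm (c i) (x i)) \<in> V" by (rule subsp_sum[OF V]) (simp add: insert.prems subspD[OF V])
    then show ?case using insert f subspD(3)[OF V] by (simp add: lin_on_def)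
  qed (simp_all add: z)
qed

definition ue :: "nat \<Rightarrow> nat \<Rightarrow> complex" where "ue j = (\<lambda>i. if i = j then 1 else 0)"

lemma ue_Vn: "j < n \<Longrightarrow> ue j \<in> Vn n"
  by (auto simp: ue_def Vn_def)

lemma Vn_ue: "x \<in> Vn n \<Longrightarrow> x = (\<Sum>j<n. sm (x j) (ue j))"
proof
  fix i assume x: "x \<in> Vn n"
  have "(\<Sum>j<n. sm (x j) (ue j)) i = (\<Sum>j<n. if j = i then x i else 0)"
    unfolding sum_fun_apply by (rule sum.cong) (auto simp: sm_def ue_def)
  then show "x i = (\<Sum>j<n. sm (x j) (ue j)) i" using x by (auto simp: Vn_def)
qed

lemma lin_on_matrix:
  assumes f: "lin_on (Vn n) f" "\<And>x. x \<in> Vn n \<Longrightarrow> f x \<in> Vn m"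
  obtains P where "P \<in> carrier_mat m n" "\<And>v. v \<in> carrier_vec n \<Longrightarrow> vf (P *\<^sub>v v) = f (vf v)"
proof
  let ?P = "mat m n (\<lambda>(i, j). f (ue j) i)"
  show "?P \<in> carrier_mat m n" by simp
  fix v :: "complex vec" assume v: "v \<in> carrier_vec n"
  have "f (vf v) = f (\<Sum>j<n. sm (vf v j) (ue j))" using Vn_ue[OF vf_Vn[OF v]] by simp
  also have "\<dots> = (\<Sum>j<n. sm (vf v j) (f (ue j)))"
    by (rule lin_on_sum[OF subsp_Vn f(1)]) (simp add: ue_Vn)
  also have "\<dots> = vf (?P *\<^sub>v v)"
  proof
    fix i
    have "f (ue j) i = 0" if "j < n" "\<not> i < m" for j
      using f(2)[OF ue_Vn[OF that(1)]] that(2) by (auto simp: Vn_def)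
    then show "(\<Sum>j<n. sm (vf v j) (f (ue j))) i = vf (?P *\<^sub>v v) i"
      using v by (auto simp: sum_fun_apply sm_def vf_def scalar_prod_def atLeast0LessThan mult_ac intro!: sum.cong sum.neutral)
  qed
  finally show "vf (?P *\<^sub>v v) = f (vf v)" ..
qed

lemma lin_on_inj_dim:
  assumes f: "lin_on (Vn n) f" "\<And>x. x \<in> Vn n \<Longrightarrow> f x \<in> Vn m"
    and inj: "\<And>x. x \<in> Vn n \<Longrightarrow> f x = 0 \<Longrightarrow> x = 0"
  shows "n \<le> m"
proof (rule ccontr)
  assume "\<not> n \<le> m"
  then obtain D where D: "n = Suc D" "m \<le> D" by (metis Suc_le_D not_less_eq_eq Suc_le_mono)
  obtain c where c: "\<exists>i\<le>D. c i \<noteq> 0" "\<forall>a\<in>{..<m}. (\<Sum>i\<le>D. c i * f (ue i) a) = 0"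
    using underdetermined[of "{..<m}" D "\<lambda>i. f (ue i)"] D by auto
  let ?x = "\<Sum>i\<le>D. sm (c i) (ue i)"
  have x: "?x \<in> Vn n" by (rule subsp_sum[OF subsp_Vn]) (simp add: D subspD[OF subsp_Vn] ue_Vn)
  have "f ?x = (\<Sum>i\<le>D. sm (c i) (f (ue i)))"
    by (rule lin_on_sum[OF subsp_Vn f(1)]) (simp add: ue_Vn D)
  also have "\<dots> = 0"
  proof
    fix a
    show "(\<Sum>i\<le>D. sm (c i) (f (ue i))) a = 0 a"
    proof (cases "a < m")
      case True then show ?thesis using c(2) by (simp add: sum_fun_apply sm_def fun_apply)
    next
      case False
      have "f (ue i) a = 0" if "i \<le> D" for i
        using f(2)[OF ue_Vn[of i n]] that D False by (auto simp: Vn_def)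
      then show ?thesis by (simp add: sum_fun_apply sm_def fun_apply)
    qed
  qed
  finally have "?x = 0" using inj[OF x] by simp
  then have "?x i = 0" for i by (simp add: fun_apply)
  moreover have "?x i = c i" if "i \<le> D" for i
  proof -
    have "?x i = (\<Sum>j\<le>D. if j = i then c i else 0)"
      unfolding sum_fun_apply by (rule sum.cong) (auto simp: sm_def ue_def)
    then show ?thesis using that by simp
  qed
  ultimately show False using c(1) by metis
qed

lemma hw_modules_iso:
  assumes q: "quantum q" and M: "is_L q M u" and N: "is_L q N u"
  shows "umod_iso M N"
proof -
  interpret quantum q by fact
  \<comment> \<open>The two modules are the members of a family indexed by \<open>bool\<close>,
    which makes the situation symmetric.\<close>
  define \<rho> where "\<rho> m = reprM (if m then M else N)" for m
  define V where "V m = Vn (dim (if m then M else N))" for m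
  have um: "is_umod q (if m then M else N)" for m
    using M N by (auto simp: is_L_def fd_simple_def)
  have "\<exists>w. w \<in> V m \<and> hw (\<rho> m) u w" for m
    using M N by (auto simp: is_L_iff V_def \<rho>_def)
  then obtain v where v: "\<And>m. v m \<in> V m" "\<And>m. hw (\<rho> m) u (v m)" by metis
  have rep: "urep q (\<rho> m)" for m unfolding \<rho>_def by (rule urep_reprM[OF q um])
  \<comment> \<open>Constants suffice as coefficients because both members have the same weight;
    then \<open>c a = c b\<close> for every coefficient, as \<open>kernel_trivial\<close>
    requires.\<close>
  define C :: "(bool \<Rightarrow> complex) set" where "C = range (\<lambda>c _. c)"
  interpret hwfam q \<rho> v "fst u" "\<lambda>_. snd u" C
    by (intro hwfam.intro hwfam_axioms.intro q)
      (use rep hw_fst_ne0[OF rep v(2)] v(2) in \<open>auto simp: hw_def C_def\<close>)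
  have C: "c a = c b" if "c \<in> C" for c a b using that by (auto simp: C_def)
  have simple: "simple_on (\<rho> m) (V m)" for m
    unfolding \<rho>_def V_def using M N by (auto simp: is_L_def intro: fd_simple_simple_on)
  have st: "stable (\<rho> m) (V m)" for m
    unfolding \<rho>_def V_def by (rule stable_Vn[OF um])
  have v0: "v m \<noteq> 0" for m using v(2) by (auto simp: hw_def)
  have ker: "x b = 0" if "x \<in> G" "x a = 0" for x a b
    using kernel_trivial[of a b "V b" x] C v0 simple st v(1) that by blast
  have val: "(\<lambda>x. x m) ` G = V m" for m
    by (rule values_eq[OF simple st v(1) v0])
  have valI: "x m \<in> V m" if "x \<in> G" for x m
    using imageI[OF that, of "\<lambda>x. x m"] val[of m] by simp
  have valE: "\<exists>x. x \<in> G \<and> x m = y" if "y \<in> V m" for y m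
  proof -
    have "y \<in> (\<lambda>x. x m) ` G" using that val[of m] by simp
    then show ?thesis by (elim imageE) auto
  qed
  define lift where "lift m y = (SOME x. x \<in> G \<and> x m = y)" for m y
  have lift: "lift m y \<in> G" "lift m y m = y" if "y \<in> V m" for m y
  proof -
    from someI_ex[OF valE[OF that]] show "lift m y \<in> G" "lift m y m = y" by (auto simp: lift_def)
  qed
  have uniq: "x b = y b" if "x \<in> G" "y \<in> G" "x a = y a" for x y a b
    using ker[OF G_diff[OF that(1,2)], of a b] that(3) by simp
  \<comment> \<open>A value at \<open>a\<close> is sent to the value at \<open>b\<close> of the same
    family; \<open>uniq\<close> shows that the choice of the family does not matter.\<close>
  define f where "f a b y = lift a y b" for a b y
  have f: "f a b (x a) = x b" if "x \<in> G" for x a b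
  proof -
    note l = lift[OF valI[OF that, of a]]
    show ?thesis unfolding f_def by (rule uniq[OF l(1) that l(2)])
  qed
  have f_lin: "lin_on (V a) (f a b)" for a b
    unfolding lin_on_def
  proof (intro conjI ballI allI)
    fix y z c assume "y \<in> V a"
    then obtain x where x: "x \<in> G" "y = x a" using valE[of y a] by auto
    show "f a b (sm c y) = sm c (f a b y)"
      using f[OF G_smc[OF x(1), of c], of a b] f[OF x(1)] x(2) by simp
    assume "z \<in> V a"
    then obtain w where w: "w \<in> G" "z = w a" using valE[of z a] by auto
    show "f a b (y + z) = f a b y + f a b z"
      using f[OF G_add[OF x(1) w(1)], of a b] f[OF x(1)] f[OF w(1)] x(2) w(2) by simp
  qed
  have f_V: "f a b y \<in> V b" if "y \<in> V a" for a b y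
    unfolding f_def by (rule valI[OF lift(1)[OF that]])
  have f_inv: "f b a (f a b y) = y" if "y \<in> V a" for a b y
    using f[OF lift(1)[OF that], of b a] lift(2)[OF that] by (simp add: f_def)
  have f_gen: "f a b (app (\<rho> a g) y) = app (\<rho> b g) (f a b y)" if "y \<in> V a" for a b g y
    using f[OF G_gen[OF lift(1)[OF that], of g], of a b] lift(2)[OF that] by (simp add: f_def)
  have f0: "f a b 0 = 0" for a b
    using f[OF G_0, of a b] by simp
  have finj: "y = 0" if "y \<in> V a" "f a b y = 0" for a b y
    using f_inv[OF that(1), of b] that(2) f0 by simp
  have "dim M \<le> dim N" using lin_on_inj_dim[of "dim M" "f True False" "dim N"] f_lin f_V finj
    by (metis V_def)
  moreover have "dim N \<le> dim M" using lin_on_inj_dim[of "dim N" "f False True" "dim M"] f_lin f_V finj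
    by (metis V_def)
  ultimately have d: "dim M = dim N" by simp
  then have V: "V m = Vn (dim N)" for m by (simp add: V_def)
  obtain P where P: "P \<in> carrier_mat (dim N) (dim N)" "\<And>w. w \<in> carrier_vec (dim N) \<Longrightarrow> vf (P *\<^sub>v w) = f True False (vf w)"
    by (rule lin_on_matrix[of "dim N" "f True False" "dim N"]) (use f_lin[of True] f_V[of _ True] in \<open>auto simp: V\<close>)
  obtain Q where Q: "Q \<in> carrier_mat (dim N) (dim N)" "\<And>w. w \<in> carrier_vec (dim N) \<Longrightarrow> vf (Q *\<^sub>v w) = f False True (vf w)"
    by (rule lin_on_matrix[of "dim N" "f False True" "dim N"]) (use f_lin[of False] f_V[of _ False] in \<open>auto simp: V\<close>)
  have PQc: "P *\<^sub>v w \<in> carrier_vec (dim N)" "Q *\<^sub>v w \<in> carrier_vec (dim N)" if "w \<in> carrier_vec (dim N)" for w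
    using P Q that by auto
  have vV: "vf w \<in> V m" if "w \<in> carrier_vec (dim N)" for w m using vf_Vn[OF that] by (simp add: V)
  have PQ: "P * Q = 1\<^sub>m (dim N)"
  proof (rule mat_eqI_vec)
    fix w :: "complex vec" assume w: "w \<in> carrier_vec (dim N)"
    have "vf (P *\<^sub>v (Q *\<^sub>v w)) = vf w"
      using P(2)[OF PQc(2)[OF w]] Q(2)[OF w] f_inv[OF vV[OF w]] by simp
    then have "P *\<^sub>v (Q *\<^sub>v w) = w"
      using vf_inj[OF PQc(1)[OF PQc(2)[OF w]] w] by blast
    then show "P * Q *\<^sub>v w = 1\<^sub>m (dim N) *\<^sub>v w"
      using P(1) Q(1) w by simp
  qed (use P Q in auto)
  have QP: "Q * P = 1\<^sub>m (dim N)"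
  proof (rule mat_eqI_vec)
    fix w :: "complex vec" assume w: "w \<in> carrier_vec (dim N)"
    have "vf (Q *\<^sub>v (P *\<^sub>v w)) = vf w"
      using Q(2)[OF PQc(1)[OF w]] P(2)[OF w] f_inv[OF vV[OF w]] by simp
    then have "Q *\<^sub>v (P *\<^sub>v w) = w"
      using vf_inj[OF PQc(2)[OF PQc(1)[OF w]] w] by blast
    then show "Q * P *\<^sub>v w = 1\<^sub>m (dim N) *\<^sub>v w"
      using P(1) Q(1) w by simp
  qed (use P Q in auto)
  have Mc: "matM M g \<in> carrier_mat (dim N) (dim N)" "matM N g \<in> carrier_mat (dim N) (dim N)" for g
    using matM_carrier[OF um[of True], of g] matM_carrier[OF um[of False], of g] d by auto
  have inter: "P * matM M g = matM N g * P" for g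
  proof (rule mat_eqI_vec)
    fix w :: "complex vec" assume w: "w \<in> carrier_vec (dim N)"
    have wM: "matM M g *\<^sub>v w \<in> carrier_vec (dim N)" by (rule mult_mat_vec_carrier[OF Mc(1) w])
    have "vf (P *\<^sub>v (matM M g *\<^sub>v w)) = f True False (app (\<rho> True g) (vf w))"
      using P(2)[OF wM] reprM_vf[OF um[of True], of w g] w d by (simp add: \<rho>_def)
    also have "\<dots> = app (\<rho> False g) (f True False (vf w))" by (rule f_gen[OF vV[OF w]])
    also have "\<dots> = vf (matM N g *\<^sub>v (P *\<^sub>v w))"
      using P(2)[OF w] reprM_vf[OF um[of False], of "P *\<^sub>v w" g] PQc(1)[OF w] by (simp add: \<rho>_def)
    finally have "P *\<^sub>v (matM M g *\<^sub>v w) = matM N g *\<^sub>v (P *\<^sub>v w)"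
      using vf_inj[OF PQc(1)[OF wM] mult_mat_vec_carrier[OF Mc(2) PQc(1)[OF w]]] by blast
    then show "P * matM M g *\<^sub>v w = matM N g * P *\<^sub>v w"
      using P(1) Mc(1)[of g] Mc(2)[of g] w by (metis assoc_mult_mat_vec)
  qed (use P(1) Mc in \<open>auto intro: mult_carrier_mat\<close>)
  show ?thesis
    unfolding umod_iso_def
    using d P(1) Q(1) PQ QP inter[of "XP _"] inter[of "XM _"] inter[of "JJ _"] inter[of KP] inter[of KM]
    by (intro conjI exI[of _ P] exI[of _ Q]) simp_all
qed

text \<open>The module is spanned by vectors of weights \<open>fst u * cc ^ j\<close>, so the weight
  of \<open>w\<close> is among them. If it is the top weight, \<open>w\<close> is a multiple of
  \<open>v\<close>, and the \<open>J_t\<close> have the same eigenvalues.\<close>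

lemma hw_weight_unique_aux:
  assumes rep: "urep q \<rho>" and V: "simple_on \<rho> V" "stable \<rho> V"
    and v: "hw \<rho> u v" "v \<in> V" and w: "hw \<rho> u' w" "w \<in> V"
  shows "\<exists>j. fst u' = fst u * (inverse q ^ 2) ^ j"
    and "fst u' = fst u \<Longrightarrow> t > 0 \<Longrightarrow> snd u' t = snd u t"
proof -
  interpret urep q \<rho> by fact
  define C :: "(unit \<Rightarrow> complex) set" where "C = UNIV"
  interpret F: hwfam q "\<lambda>_. \<rho>" "\<lambda>_. v" "fst u" "\<lambda>_. snd u" C
    by unfold_locales (use rep hw_fst_ne0[OF rep v(1)] v(1) in \<open>auto simp: hw_def C_def\<close>)
  have v0: "v \<noteq> 0" and w0: "w \<noteq> 0" using v w by (auto simp: hw_def)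
  have "(\<lambda>x. x ()) ` F.G = V" by (rule F.values_eq[OF V v(2) v0])
  then have "w \<in> (\<lambda>x. x ()) ` F.G" using w by simp
  then obtain x where x: "x \<in> F.G" "x () = w" by (elim imageE) auto
  obtain c N xs where d: "F.wdec x c N xs" using F.G_wdec[OF x(1)] by blast
  \<comment> \<open>Applying \<open>K^+ - fst u'\<close> to \<open>w\<close> gives 0, hence by
    independence of the weight vectors every component of \<open>w\<close> is killed
    separately.\<close>
  have e: "sm (fst u * cc ^ j - fst u') (xs j ()) = 0" if "j \<le> N" for j
  proof -
    have "app (\<rho> KP) w - sm (fst u') w = 0" using w by (simp add: hw_def)
    also have "w = (\<Sum>j\<le>N. xs j ())" using d x by (simp add: F.wdec_def)
    finally have "(\<Sum>j\<le>N. sm (fst u * cc ^ j - fst u') (xs j ())) = 0"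
      using d by (simp add: F.wdec_def app_sum sm_sum sm_diff_left sum_subtractf)
    then have "sm (fst u * cc ^ j - fst u') (xs j ()) \<in> {0}"
      by (intro eigen_components[OF subsp_zero, of "\<rho> KP" N "\<lambda>j. sm (fst u * cc ^ j - fst u') (xs j ())" "\<lambda>j. fst u * cc ^ j"])
        (use d that F.lam_inj in \<open>auto simp: F.wdec_def mult_ac\<close>)
    then show ?thesis by simp
  qed
  have "w = (\<Sum>j\<le>N. xs j ())" using d x by (simp add: F.wdec_def)
  then obtain j where j: "j \<le> N" "xs j () \<noteq> 0" using w0 by (metis atMost_iff sum.neutral)
  then have "fst u' = fst u * (inverse q ^ 2) ^ j"
    using e[OF j(1)] by (simp add: sm_eq_0_iff cc_def)
  then show "\<exists>j. fst u' = fst u * (inverse q ^ 2) ^ j" by blast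
  assume eq: "fst u' = fst u" and t: "t > 0"
  have "xs j () = 0" if "j \<le> N" "j > 0" for j
    using e[OF that(1)] eq F.lam cc_pow_ne1[OF that(2)] by (auto simp: sm_eq_0_iff)
  then have "(\<Sum>j\<le>N. xs j ()) = (\<Sum>j\<le>N. if j = 0 then xs 0 () else 0)"
    by (intro sum.cong) auto
  then have wc: "w = sm (c ()) v" using d x by (simp add: F.wdec_def)
  have "sm (snd u' t) w = sm (snd u t) w"
  proof -
    have "sm (snd u' t) w = app (\<rho> (JJ t)) w" using w t by (simp add: hw_def)
    also have "\<dots> = sm (snd u t) w" unfolding wc using v t by (simp add: hw_def mult_ac)
    finally show ?thesis .
  qed
  then have "sm (snd u' t - snd u t) w = 0" by (simp add: sm_diff_left)
  then show "snd u' t = snd u t" using w0 by (simp add: sm_eq_0_iff)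
qed

text \<open>Each of the two highest weights is the other one times a power of \<open>cc\<close>; as
  \<open>cc\<close> is not a root of unity, both exponents are 0.\<close>

lemma is_L_weight_unique:
  assumes q: "quantum q" and M: "is_L q M u" and M': "is_L q M u'"
  shows "fst u = fst u'" "t > 0 \<Longrightarrow> snd u t = snd u' t"
proof -
  interpret quantum q by fact
  have um: "is_umod q M" and fs: "fd_simple q M" using M by (auto simp: is_L_def fd_simple_def)
  have rep: "urep q (reprM M)" by (rule urep_reprM[OF q um])
  obtain v w where v: "hw (reprM M) u v" "v \<in> Vn (dim M)" and w: "hw (reprM M) u' w" "w \<in> Vn (dim M)"
    using M M' by (auto simp: is_L_iff)
  note aux = hw_weight_unique_aux[OF rep fd_simple_simple_on[OF fs] stable_Vn[OF um]]
  obtain i where i: "fst u' = fst u * cc ^ i" using aux(1)[OF v w] unfolding cc_def by blast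
  obtain j where j: "fst u = fst u' * cc ^ j" using aux(1)[OF w v] unfolding cc_def by blast
  have "fst u = fst u * cc ^ (i + j)" by (subst j, subst i) (simp add: power_add mult_ac)
  then have "cc ^ (i + j) = 1" using hw_fst_ne0[OF rep v(1)] by simp
  then have "i + j = 0" using cc_pow_ne1 by blast
  then show 1: "fst u = fst u'" using i by simp
  show "snd u t = snd u' t" if "t > 0" using aux(2)[OF w v 1 that] .
qed

lemma is_L_iso:
  assumes M: "is_L q M u" and N: "fd_simple q N" and iso: "umod_iso M N"
  shows "is_L q N u"
proof -
  obtain P Q where P: "P \<in> carrier_mat (dim N) (dim M)" "Q \<in> carrier_mat (dim M) (dim N)"
     "Q * P = 1\<^sub>m (dim M)" and d: "dim M = dim N" and
     g: "\<And>t. P * Xp M t = Xp N t * P" "\<And>t. P * J M t = J N t * P" "P * Kp M = Kp N * P"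
    using iso unfolding umod_iso_def by blast
  obtain v where v: "v \<in> carrier_vec (dim M)" "v \<noteq> 0\<^sub>v (dim M)" "\<And>t. Xp M t *\<^sub>v v = 0\<^sub>v (dim M)"
        "Kp M *\<^sub>v v = fst u \<cdot>\<^sub>v v" "\<And>t. t>0 \<Longrightarrow> J M t *\<^sub>v v = snd u t \<cdot>\<^sub>v v"
    using M unfolding is_L_def by blast
  have um: "is_umod q M" "is_umod q N" using M N by (auto simp: is_L_def fd_simple_def)
  note c = matM_carrier[OF um(1)] matM_carrier[OF um(2)]
  have tr: "matM N g *\<^sub>v (P *\<^sub>v v) = P *\<^sub>v (matM M g *\<^sub>v v)" if "P * matM M g = matM N g * P" for g
    using that c[of g] P(1) v(1) by (metis assoc_mult_mat_vec)
  have "Q *\<^sub>v (P *\<^sub>v v) = v" using P v by (metis assoc_mult_mat_vec one_mult_mat_vec)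
  moreover have "Q *\<^sub>v 0\<^sub>v (dim N) = 0\<^sub>v (dim M)" using P(2) by (intro eq_vecI) auto
  ultimately have ne: "P *\<^sub>v v \<noteq> 0\<^sub>v (dim N)" using v(2) by auto
  have Pc: "P *\<^sub>v v \<in> carrier_vec (dim N)" using P(1) v(1) by simp
  have P0: "P *\<^sub>v 0\<^sub>v (dim M) = 0\<^sub>v (dim N)" using P(1) by (intro eq_vecI) auto
  show ?thesis unfolding is_L_def
  proof (intro conjI exI[of _ "P *\<^sub>v v"] allI impI)
    show "fd_simple q N" by fact
    show "P *\<^sub>v v \<in> carrier_vec (dim N)" "P *\<^sub>v v \<noteq> 0\<^sub>v (dim N)" by fact+
    show "Xp N t *\<^sub>v (P *\<^sub>v v) = 0\<^sub>v (dim N)" for t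
      using tr[of "XP t"] g(1)[of t] v(3)[of t] P0 by simp
    show "Kp N *\<^sub>v (P *\<^sub>v v) = fst u \<cdot>\<^sub>v (P *\<^sub>v v)"
      using tr[of KP] g(3) v(4) P(1) v(1) by (simp add: mult_mat_vec)
    show "J N t *\<^sub>v (P *\<^sub>v v) = snd u t \<cdot>\<^sub>v (P *\<^sub>v v)" if "t > 0" for t
      using tr[of "JJ t"] g(2)[of t] v(5)[OF that] P(1) v(1) by (simp add: mult_mat_vec)
  qed
qed

section \<open>Drinfeld polynomials\<close>

definition comps :: "nat \<Rightarrow> nat \<Rightarrow> nat list set" where
  "comps k t = {\<alpha>. length \<alpha> = k \<and> sum_list \<alpha> = t}"

lemma finite_comps: "finite (comps k t)"
proof (rule finite_subset)
  show "comps k t \<subseteq> {xs. set xs \<subseteq> {..t} \<and> length xs = k}"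
    by (auto simp: comps_def dest: member_le_sum_list)
  show "finite {xs. set xs \<subseteq> {..t} \<and> length xs = k}"
    by (rule finite_lists_length_eq) simp
qed

lemma fps_nth_prod_list:
  "fps_nth (prod_list Fs) t = (\<Sum>\<alpha>\<in>comps (length Fs) t. \<Prod>i<length Fs. fps_nth (Fs ! i) (\<alpha> ! i) :: complex)"
proof (induction Fs arbitrary: t)
  case Nil
  have "comps 0 t = (if t = 0 then {[]} else {})" by (auto simp: comps_def)
  then show ?case by simp
next
  case (Cons F Fs)
  let ?k = "length Fs"
  have "fps_nth (prod_list (F # Fs)) t
     = (\<Sum>a\<in>{0..t}. \<Sum>\<alpha>\<in>comps ?k (t - a). fps_nth F a * (\<Prod>i<?k. fps_nth (Fs ! i) (\<alpha> ! i)))"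
    by (simp add: fps_mult_nth Cons sum_distrib_left)
  also have "\<dots> = (\<Sum>(a, \<alpha>)\<in>Sigma {0..t} (\<lambda>a. comps ?k (t - a)). fps_nth F a * (\<Prod>i<?k. fps_nth (Fs ! i) (\<alpha> ! i)))"
    by (subst sum.Sigma) (auto simp: finite_comps)
  also have "\<dots> = (\<Sum>\<alpha>\<in>comps (Suc ?k) t. \<Prod>i<Suc ?k. fps_nth ((F # Fs) ! i) (\<alpha> ! i))"
  proof (rule sum.reindex_bij_witness[of _ "\<lambda>\<alpha>. (hd \<alpha>, tl \<alpha>)" "\<lambda>(a, \<alpha>). a # \<alpha>"])
    fix \<alpha> assume "\<alpha> \<in> comps (Suc ?k) t"
    then show "(hd \<alpha>, tl \<alpha>) \<in> Sigma {0..t} (\<lambda>a. comps ?k (t - a))"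
      and "(case (hd \<alpha>, tl \<alpha>) of (a, \<alpha>) \<Rightarrow> a # \<alpha>) = \<alpha>"
      by (auto simp: comps_def length_Suc_conv)
  next
    fix p assume "p \<in> Sigma {0..t} (\<lambda>a. comps ?k (t - a))"
    then show "(case p of (a, \<alpha>) \<Rightarrow> a # \<alpha>) \<in> comps (Suc ?k) t"
      and "(hd (case p of (a, \<alpha>) \<Rightarrow> a # \<alpha>), tl (case p of (a, \<alpha>) \<Rightarrow> a # \<alpha>)) = p"
      and "(\<Prod>i<Suc ?k. fps_nth ((F # Fs) ! i) ((case p of (a, \<alpha>) \<Rightarrow> a # \<alpha>) ! i))
         = (case p of (a, \<alpha>) \<Rightarrow> fps_nth F a * (\<Prod>i<?k. fps_nth (Fs ! i) (\<alpha> ! i)))"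
      by (auto simp: comps_def prod.lessThan_Suc_shift simp del: prod.lessThan_Suc)
  qed
  finally show ?case by simp
qed

lemma finite_partitions_le: "finite (partitions_le t k)"
proof (rule finite_subset)
  show "partitions_le t k \<subseteq> mset ` {xs. set xs \<subseteq> {..t} \<and> length xs \<le> k}"
  proof
    fix lam assume l: "lam \<in> partitions_le t k"
    obtain xs where xs: "mset xs = lam" using ex_mset by blast
    have "sum_list xs = t" "length xs \<le> k"
      using l xs by (auto simp: partitions_le_def simp flip: sum_mset_sum_list)
    then have "set xs \<subseteq> {..t}" by (auto dest: member_le_sum_list)
    then show "lam \<in> mset ` {xs. set xs \<subseteq> {..t} \<and> length xs \<le> k}"
      using xs \<open>length xs \<le> k\<close> by blast
  qed
  show "finite (mset ` {xs. set xs \<subseteq> {..t} \<and> length xs \<le> k})"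
    by (intro finite_imageI finite_lists_length_le) simp
qed

lemma sum_filter_nonzero: "sum_mset (filter_mset (\<lambda>a. a \<noteq> 0) (mset \<alpha>)) = sum_list (\<alpha> :: nat list)"
  by (induction \<alpha>) auto

lemma prod_nonzero_power:
  "(\<Prod>i<length \<alpha>. if \<alpha> ! i = 0 then 1 else c) = (c :: complex) ^ size (filter_mset (\<lambda>a. a \<noteq> 0) (mset \<alpha>))"
  by (induction \<alpha>) (auto simp: prod.lessThan_Suc_shift simp del: prod.lessThan_Suc)

section \<open>Generating series of the weights\<close>

context quantum
begin

text \<open>The expansion of (1 - cc g z) / (1 - g z), that is, the ratio of the linear factor of P
  at z/q^2 and at z.\<close>

definition rootfac :: "complex \<Rightarrow> complex fps" where
  "rootfac g = Abs_fps (\<lambda>a. if a = 0 then 1 else (1 - cc) * g ^ a)"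

text \<open>A coefficient of the product is a sum over exponent vectors, each weighted by a factor
  \<open>1 - cc\<close> per nonzero entry. Grouping the vectors by the multiset of nonzero entries
  gives the monomial symmetric functions, and \<open>1 - cc = inverse q * (q - inverse q)\<close>
  explains the constants in \<open>p_poly\<close>.\<close>

lemma p_poly_gen_fun:
  assumes t: "t > 0"
  shows "(q - inverse q) * p_poly t q xs = fps_nth (prod_list (map rootfac xs)) t"
proof -
  let ?k = "length xs" and ?d = "q - inverse q"
  let ?h = "\<lambda>\<alpha>. filter_mset (\<lambda>a. a \<noteq> 0) (mset (\<alpha> :: nat list))"
  define X where "X \<alpha> = (\<Prod>i<?k. xs ! i ^ (\<alpha> ! i))" for \<alpha> :: "nat list"
  have cc: "1 - cc = inverse q * ?d" using q0 by (simp add: cc_def field_simps power2_eq_square)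
  have img: "?h ` comps ?k t \<subseteq> partitions_le t ?k"
  proof (rule image_subsetI)
    fix \<alpha> assume a: "\<alpha> \<in> comps ?k t"
    have "size (?h \<alpha>) \<le> size (mset \<alpha>)" by (intro size_mset_mono multiset_filter_subset)
    moreover have "sum_mset (?h \<alpha>) = t" "length \<alpha> = ?k"
      using a sum_filter_nonzero[of \<alpha>] by (simp_all only: comps_def mem_Collect_eq)
    ultimately show "?h \<alpha> \<in> partitions_le t ?k"
      unfolding partitions_le_def by (intro CollectI conjI) auto
  qed
  have "fps_nth (prod_list (map rootfac xs)) t = (\<Sum>\<alpha>\<in>comps ?k t. (1 - cc) ^ size (?h \<alpha>) * X \<alpha>)"
  proof -
    have "(\<Prod>i<?k. fps_nth (map rootfac xs ! i) (\<alpha> ! i)) = (1 - cc) ^ size (?h \<alpha>) * X \<alpha>"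
      if "\<alpha> \<in> comps ?k t" for \<alpha>
    proof -
      have l: "length \<alpha> = ?k" using that by (simp add: comps_def)
      have "(\<Prod>i<?k. fps_nth (map rootfac xs ! i) (\<alpha> ! i))
         = (\<Prod>i<?k. (if \<alpha> ! i = 0 then 1 else 1 - cc) * xs ! i ^ (\<alpha> ! i))"
        by (intro prod.cong) (auto simp: rootfac_def)
      then show ?thesis using prod_nonzero_power[of \<alpha> "1 - cc"] l by (simp add: prod.distrib X_def)
    qed
    then show ?thesis by (simp add: fps_nth_prod_list)
  qed
  also have "\<dots> = (\<Sum>lam\<in>partitions_le t ?k. \<Sum>\<alpha>\<in>{\<alpha>\<in>comps ?k t. ?h \<alpha> = lam}. (1 - cc) ^ size (?h \<alpha>) * X \<alpha>)"
    by (rule sum.group[symmetric, OF finite_comps finite_partitions_le img])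
  also have "\<dots> = (\<Sum>lam\<in>partitions_le t ?k. ?d * (inverse q ^ size lam * ?d ^ (size lam - 1) * mon_sym lam xs))"
  proof (rule sum.cong, rule refl)
    fix lam assume l: "lam \<in> partitions_le t ?k"
    \<comment> \<open>As \<open>t > 0\<close>, the partition has a part, so the exponent
      \<open>size lam - 1\<close> is not truncated and the missing factor is the
      \<open>q - inverse q\<close> in front.\<close>
    have "lam \<noteq> {#}" using l t by (auto simp: partitions_le_def)
    then have "size lam \<noteq> 0" by auto
    then obtain s where s: "size lam = Suc s" by (cases "size lam") auto
    have "{\<alpha>\<in>comps ?k t. ?h \<alpha> = lam} = {\<alpha>. length \<alpha> = ?k \<and> ?h \<alpha> = lam}"
    proof (intro Collect_cong)
      fix \<alpha>
      have "sum_list \<alpha> = t" if "?h \<alpha> = lam"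
        using sum_filter_nonzero[of \<alpha>] that l by (simp add: partitions_le_def)
      then show "\<alpha> \<in> comps ?k t \<and> ?h \<alpha> = lam \<longleftrightarrow> length \<alpha> = ?k \<and> ?h \<alpha> = lam"
        by (auto simp: comps_def)
    qed
    then have "(\<Sum>\<alpha>\<in>{\<alpha>\<in>comps ?k t. ?h \<alpha> = lam}. (1 - cc) ^ size (?h \<alpha>) * X \<alpha>)
      = (\<Sum>\<alpha>\<in>{\<alpha>. length \<alpha> = ?k \<and> ?h \<alpha> = lam}. (1 - cc) ^ size lam * X \<alpha>)"
      by (intro sum.cong) auto
    also have "\<dots> = (1 - cc) ^ size lam * mon_sym lam xs"
      by (simp add: mon_sym_def X_def sum_distrib_left)
    also have "(1 - cc) ^ size lam = ?d * (inverse q ^ size lam * ?d ^ (size lam - 1))"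
      unfolding cc s power_mult_distrib by simp
    finally show "(\<Sum>\<alpha>\<in>{\<alpha>\<in>comps ?k t. ?h \<alpha> = lam}. (1 - cc) ^ size (?h \<alpha>) * X \<alpha>)
      = ?d * (inverse q ^ size lam * ?d ^ (size lam - 1) * mon_sym lam xs)" by (simp add: mult.assoc)
  qed
  also have "\<dots> = ?d * p_poly t q xs" by (simp add: p_poly_def sum_distrib_left)
  finally show ?thesis ..
qed

definition uhat :: "(nat \<Rightarrow> complex) \<Rightarrow> complex fps" where
  "uhat u = Abs_fps (\<lambda>i. if i = 0 then 1 else (q - inverse q) * u i)"

definition csc :: "complex fps \<Rightarrow> complex fps" where
  "csc F = Abs_fps (\<lambda>n. cc ^ n * fps_nth F n)"

lemma csc_nth [simp]: "fps_nth (csc F) n = cc ^ n * fps_nth F n"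
  by (simp add: csc_def)

lemma csc_mult: "csc (F * G) = csc F * csc G"
proof (rule fps_ext)
  fix n
  have "cc ^ n * (\<Sum>i=0..n. fps_nth F i * fps_nth G (n - i))
      = (\<Sum>i=0..n. cc ^ i * fps_nth F i * (cc ^ (n - i) * fps_nth G (n - i)))"
    unfolding sum_distrib_left
  proof (rule sum.cong, rule refl)
    fix i assume "i \<in> {0..n}"
    then have "cc ^ n = cc ^ i * cc ^ (n - i)" by (simp flip: power_add)
    then show "cc ^ n * (fps_nth F i * fps_nth G (n - i))
        = cc ^ i * fps_nth F i * (cc ^ (n - i) * fps_nth G (n - i))" by simp
  qed
  then show "fps_nth (csc (F * G)) n = fps_nth (csc F * csc G) n" by (simp add: fps_mult_nth)
qed

lemma csc_1: "csc 1 = 1"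
  by (rule fps_ext) simp

text \<open>The eigenvalues of the \<open>J\<^sub>t\<close> and the coefficients of the (reversed) Drinfeld polynomial
  determine each other through this relation.\<close>

definition drel :: "complex fps \<Rightarrow> complex fps \<Rightarrow> bool" where
  "drel U P \<longleftrightarrow> fps_nth P 0 = 1 \<and> U * P = csc P"

lemma drel_unique_left: "drel U P \<Longrightarrow> drel U' P \<Longrightarrow> U = U'"
  by (metis drel_def fps_nonzeroI mult_right_cancel zero_neq_one)

text \<open>The n-th coefficient of the relation determines \<open>cc ^ n - 1\<close> times that of
  \<open>P\<close> from the lower ones; the factor is nonzero for n > 0 since \<open>q\<close> is
  not a root of unity.\<close>

lemma drel_unique_right:
  assumes "drel U P" "drel U P'" and U: "fps_nth U 0 = 1"
  shows "P = P'"
proof (rule fps_ext)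
  fix n show "fps_nth P n = fps_nth P' n"
  proof (induction n rule: less_induct)
    case (less n)
    show ?case
    proof (cases "n = 0")
      case True then show ?thesis using assms by (simp add: drel_def)
    next
      case False
      have rec: "(cc ^ n - 1) * fps_nth Q n = (\<Sum>i=1..n. fps_nth U i * fps_nth Q (n - i))"
        if "drel U Q" for Q
      proof -
        have "cc ^ n * fps_nth Q n = fps_nth (U * Q) n" using that by (simp add: drel_def)
        also have "\<dots> = fps_nth Q n + (\<Sum>i=1..n. fps_nth U i * fps_nth Q (n - i))"
          by (simp add: fps_mult_nth sum.atLeast_Suc_atMost U)
        finally show ?thesis by (simp add: algebra_simps)
      qed
      have "(\<Sum>i=1..n. fps_nth U i * fps_nth P (n - i)) = (\<Sum>i=1..n. fps_nth U i * fps_nth P' (n - i))"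
        using False by (intro sum.cong) (auto simp: less)
      then have "(cc ^ n - 1) * fps_nth P n = (cc ^ n - 1) * fps_nth P' n"
        using rec[OF assms(1)] rec[OF assms(2)] by simp
      then show ?thesis using cc_pow_ne1[of n] False by simp
    qed
  qed
qed

text \<open>The relation is multiplicative, and for one root it says that \<open>rootfac g\<close>
  times 1 - g z is 1 - cc g z.\<close>

lemma drel_prod_list:
  "drel (prod_list (map rootfac gs)) (\<Prod>g\<leftarrow>gs. fps_of_poly [:1, - g:])"
proof (induction gs)
  case Nil
  then show ?case by (simp add: drel_def csc_1)
next
  case (Cons g gs)
  have lin: "fps_of_poly [:1, - g:] = 1 - fps_const g * fps_X"
    by (rule fps_ext) (auto simp: coeff_pCons split: nat.splits)
  have r: "rootfac g * fps_of_poly [:1, - g:] = csc (fps_of_poly [:1, - g:])"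
  proof (rule fps_ext)
    fix n
    have "fps_nth (rootfac g * fps_of_poly [:1, - g:]) n
       = fps_nth (rootfac g) n - (if n = 0 then 0 else g * fps_nth (rootfac g) (n - 1))"
      unfolding lin by (simp add: right_diff_distrib mult.left_commute)
    also have "\<dots> = cc ^ n * coeff [:1, - g:] n"
    proof (cases n)
      case (Suc m)
      then show ?thesis by (cases m) (auto simp: rootfac_def algebra_simps)
    qed (simp add: rootfac_def)
    finally show "fps_nth (rootfac g * fps_of_poly [:1, - g:]) n = fps_nth (csc (fps_of_poly [:1, - g:])) n"
      by simp
  qed
  have e: "(rootfac g * prod_list (map rootfac gs)) * (fps_of_poly [:1, - g:] * (\<Prod>g\<leftarrow>gs. fps_of_poly [:1, - g:]))
    = (rootfac g * fps_of_poly [:1, - g:]) * (prod_list (map rootfac gs) * (\<Prod>g\<leftarrow>gs. fps_of_poly [:1, - g:]))"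
    by (simp only: mult_ac)
  show ?case using Cons unfolding drel_def list.map prod_list.Cons csc_mult e r
    by simp
qed

text \<open>The product of the factors 1 - \<gamma> z over the roots: the leading coefficient is
  \<plusminus>1, so multiplying by it normalises the constant term to 1. Roots equal to 0 contribute
  the factor 1, so this series alone does not know the degree of \<open>\<phi>\<close>.\<close>

definition revP :: "complex poly \<Rightarrow> complex fps" where
  "revP \<phi> = fps_of_poly (smult (lead_coeff \<phi>) (reflect_poly \<phi>))"

lemma revP_nth:
  "fps_nth (revP \<phi>) n = (if n > degree \<phi> then 0 else lead_coeff \<phi> * coeff \<phi> (degree \<phi> - n))"
  by (simp add: revP_def coeff_reflect_poly)

lemma C0_sq: "\<phi> \<in> C0 \<Longrightarrow> lead_coeff \<phi> * lead_coeff \<phi> = 1" "\<phi> \<in> C0 \<Longrightarrow> lead_coeff \<phi> \<noteq> 0"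
  by (auto simp: C0_def)

lemma root_list:
  assumes "\<phi> \<in> C0"
  shows "\<phi> = smult (lead_coeff \<phi>) (\<Prod>g\<leftarrow>root_list \<phi>. [:- g, 1:])" "length (root_list \<phi>) = degree \<phi>"
proof -
  have nz: "\<phi> \<noteq> 0" using assms by (auto simp: C0_def)
  obtain A where "\<phi> = smult (lead_coeff \<phi>) (\<Prod>x\<in>#A. [:- x, 1:])"
    using complex_poly_decompose_multiset[of \<phi>] by metis
  moreover obtain gs where "mset gs = A" using ex_mset by blast
  ultimately have "\<phi> = smult (lead_coeff \<phi>) (\<Prod>g\<leftarrow>gs. [:- g, 1:])"
    by (metis mset_map prod_mset_prod_list)
  then show 1: "\<phi> = smult (lead_coeff \<phi>) (\<Prod>g\<leftarrow>root_list \<phi>. [:- g, 1:])"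
    unfolding root_list_def by (rule someI)
  have "degree (\<Prod>g\<leftarrow>gs. [:- g, 1:]) = length gs" for gs :: "complex list"
  proof (induction gs)
    case (Cons a gs)
    have "(\<Prod>g\<leftarrow>gs. [:- g, 1:]) \<noteq> 0" by (induction gs) (auto simp del: mult_pCons_left)
    then show ?case using Cons degree_mult_eq[of "[:- a, 1:]" "\<Prod>g\<leftarrow>gs. [:- g, 1:]"]
      by (simp del: mult_pCons_left)
  qed simp
  then show "length (root_list \<phi>) = degree \<phi>"
    using arg_cong[OF 1, of degree] nz by simp
qed

lemma revP_roots:
  assumes "\<phi> \<in> C0"
  shows "revP \<phi> = (\<Prod>g\<leftarrow>root_list \<phi>. fps_of_poly [:1, - g:])"
proof -
  have r: "reflect_poly [:- g, 1:] = [:1, - g:]" for g :: complex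
    by (rule poly_eqI) (auto simp: coeff_reflect_poly coeff_pCons split: nat.splits)
  have "reflect_poly \<phi> = smult (lead_coeff \<phi>) (\<Prod>g\<leftarrow>root_list \<phi>. [:1, - g:])"
    using arg_cong[OF root_list(1)[OF assms], of reflect_poly]
    by (simp add: reflect_poly_smult reflect_poly_prod_list r o_def)
  then have "smult (lead_coeff \<phi>) (reflect_poly \<phi>) = (\<Prod>g\<leftarrow>root_list \<phi>. [:1, - g:])"
    using C0_sq(1)[OF assms] by (metis smult_1_left smult_smult)
  then show ?thesis by (simp add: revP_def fps_of_poly_prod_list o_def)
qed

lemma fst_u0: "fst (u0 q \<phi>) = lead_coeff \<phi> * q ^ degree \<phi>"
  by (simp add: u0_def)

lemma snd_u0:
  assumes "\<phi> \<in> C0" "t > 0"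
  shows "snd (u0 q \<phi>) t = p_poly t q (root_list \<phi>)"
proof (cases "degree \<phi> = 0")
  case True
  have "root_list \<phi> = []" using root_list(2)[OF assms(1)] True by simp
  moreover have "partitions_le t 0 = {}" using assms(2) by (auto simp: partitions_le_def)
  ultimately show ?thesis using True by (simp add: u0_def p_poly_def)
qed (simp add: u0_def)

lemma uhat_u0: "\<phi> \<in> C0 \<Longrightarrow> uhat (snd (u0 q \<phi>)) = prod_list (map rootfac (root_list \<phi>))"
proof (rule fps_ext)
  fix n assume p: "\<phi> \<in> C0"
  have 0: "fps_nth (prod_list (map rootfac gs)) 0 = 1" for gs
    by (induction gs) (auto simp: rootfac_def)
  show "fps_nth (uhat (snd (u0 q \<phi>))) n = fps_nth (prod_list (map rootfac (root_list \<phi>))) n"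
    by (cases "n = 0") (auto simp: uhat_def 0 snd_u0[OF p] p_poly_gen_fun)
qed

lemma drel_u0: "\<phi> \<in> C0 \<Longrightarrow> drel (uhat (snd (u0 q \<phi>))) (revP \<phi>)"
  using drel_prod_list[of "root_list \<phi>"] by (simp add: uhat_u0 revP_roots)

lemma uhat_eq_iff: "uhat u = uhat u' \<longleftrightarrow> (\<forall>t>0. u t = u' t)"
  using qd by (auto simp: uhat_def fps_eq_iff)

text \<open>Squaring the first components removes the sign and yields equal degrees, then equal
  signs. With the degree known, the reversed polynomial determines all coefficients, zero roots
  included.\<close>

lemma u0_inj:
  assumes "\<phi> \<in> C0" "\<psi> \<in> C0" and f: "fst (u0 q \<phi>) = fst (u0 q \<psi>)"
    and s: "\<And>t. t > 0 \<Longrightarrow> snd (u0 q \<phi>) t = snd (u0 q \<psi>) t"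
  shows "\<phi> = \<psi>"
proof -
  have e: "lead_coeff \<phi> * q ^ degree \<phi> = lead_coeff \<psi> * q ^ degree \<psi>" using f by (simp add: fst_u0)
  have "(lead_coeff \<phi> * q ^ degree \<phi>) ^ 2 = (lead_coeff \<psi> * q ^ degree \<psi>) ^ 2" using e by simp
  then have "(q ^ 2) ^ degree \<phi> = (q ^ 2) ^ degree \<psi>"
    using assms(1,2) by (auto simp: C0_def power_mult_distrib simp flip: power_mult) (simp_all add: mult.commute)
  then have "inverse ((q ^ 2) ^ degree \<phi>) = inverse ((q ^ 2) ^ degree \<psi>)" by simp
  then have "cc ^ degree \<phi> = cc ^ degree \<psi>" by (simp add: cc_def power_inverse)
  then have d: "degree \<phi> = degree \<psi>" by (rule cc_inj)
  then have l: "lead_coeff \<phi> = lead_coeff \<psi>" using e q0 by simp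
  have "uhat (snd (u0 q \<phi>)) = uhat (snd (u0 q \<psi>))" using s by (simp add: uhat_eq_iff)
  then have "revP \<phi> = revP \<psi>"
    using drel_unique_right[of _ "revP \<phi>" "revP \<psi>"] drel_u0[OF assms(1)] drel_u0[OF assms(2)]
    by (simp add: uhat_def)
  then have r: "fps_nth (revP \<phi>) n = fps_nth (revP \<psi>) n" for n by simp
  show ?thesis
  proof (rule poly_eqI)
    fix n
    show "coeff \<phi> n = coeff \<psi> n"
    proof (cases "n \<le> degree \<phi>")
      case True
      then have "fps_nth (revP \<chi>) (degree \<phi> - n) = lead_coeff \<chi> * coeff \<chi> n" if "degree \<chi> = degree \<phi>" for \<chi>
        unfolding revP_nth that by auto
      then have "lead_coeff \<phi> * coeff \<phi> n = lead_coeff \<psi> * coeff \<psi> n"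
        using r[of "degree \<phi> - n"] d by metis
      then show ?thesis using l C0_sq(2)[OF assms(2)] by (metis mult_left_cancel)
    next
      case False
      then show ?thesis using d by (simp add: coeff_eq_0)
    qed
  qed
qed

text \<open>The solution \<open>P\<close> of \<open>drel (uhat u) P\<close>, coefficient by
  coefficient; the denominator comes from bringing the two terms with the n-th coefficient to one
  side.\<close>

fun drinfeld :: "(nat \<Rightarrow> complex) \<Rightarrow> nat \<Rightarrow> complex" where
  "drinfeld u n = (if n = 0 then 1 else (\<Sum>i<n. (q - inverse q) * u (n - i) * drinfeld u i) / (cc ^ n - 1))"

declare drinfeld.simps [simp del]

lemma drel_drinfeld: "drel (uhat u) (Abs_fps (drinfeld u))"
  unfolding drel_def
proof
  show "fps_nth (Abs_fps (drinfeld u)) 0 = 1" by (simp add: drinfeld.simps)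
  show "uhat u * Abs_fps (drinfeld u) = csc (Abs_fps (drinfeld u))"
  proof (rule fps_ext)
    fix n
    show "fps_nth (uhat u * Abs_fps (drinfeld u)) n = fps_nth (csc (Abs_fps (drinfeld u))) n"
    proof (cases "n = 0")
      case False
      have "fps_nth (uhat u * Abs_fps (drinfeld u)) n
          = drinfeld u n + (\<Sum>i=1..n. (q - inverse q) * u i * drinfeld u (n - i))"
        by (simp add: fps_mult_nth sum.atLeast_Suc_atMost uhat_def)
      also have "(\<Sum>i=1..n. (q - inverse q) * u i * drinfeld u (n - i)) = (\<Sum>i<n. (q - inverse q) * u (n - i) * drinfeld u i)"
        by (rule sum.reindex_bij_witness[of _ "\<lambda>i. n - i" "\<lambda>i. n - i"]) auto
      also have "\<dots> = (cc ^ n - 1) * drinfeld u n"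
        using cc_pow_ne1[of n] False by (subst (2) drinfeld.simps) simp
      finally show ?thesis by (simp add: algebra_simps)
    qed (simp add: drinfeld.simps uhat_def)
  qed
qed

text \<open>The coefficients are reversed with respect to \<open>k\<close>, which may exceed the
  degree of \<open>P\<close>. The difference turns into roots at 0, which raise the power of
  \<open>q\<close> in the weight without changing \<open>P\<close>.\<close>

lemma poly_of_drel:
  assumes P: "drel (uhat u) P" and k: "\<And>n. n > k \<Longrightarrow> fps_nth P n = 0"
    and b: "b = 1 \<or> b = -1"
  shows "\<exists>\<phi>\<in>C0. fst (u0 q \<phi>) = b * q ^ k \<and> (\<forall>t>0. snd (u0 q \<phi>) t = u t)"
proof -
  define \<phi> where "\<phi> = (\<Sum>i\<le>k. monom (b * fps_nth P (k - i)) i)"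
  have c: "coeff \<phi> n = (if n \<le> k then b * fps_nth P (k - n) else 0)" for n
    by (simp add: \<phi>_def coeff_sum)
  have P0: "fps_nth P 0 = 1" using P by (simp add: drel_def)
  have "degree \<phi> = k"
  proof (rule antisym)
    show "degree \<phi> \<le> k" by (rule degree_le) (simp add: c)
    show "k \<le> degree \<phi>" by (rule le_degree) (use b in \<open>auto simp: c P0\<close>)
  qed
  then have l: "lead_coeff \<phi> = b" and d: "degree \<phi> = k" by (simp_all add: c P0)
  have C: "\<phi> \<in> C0" using b l by (auto simp: C0_def)
  have bb: "b * b = 1" using b by auto
  have "revP \<phi> = P"
    by (rule fps_ext) (use k in \<open>auto simp: revP_nth l d c bb P0 simp flip: mult.assoc\<close>)
  then have "uhat (snd (u0 q \<phi>)) = uhat u"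
    using drel_unique_left[OF drel_u0[OF C]] P by simp
  then show ?thesis using C l d by (intro bexI[of _ \<phi>]) (auto simp: uhat_eq_iff fst_u0)
qed

end

section \<open>Finite dimensional simple modules have highest weights\<close>

definition pT :: "'i lop \<Rightarrow> complex poly \<Rightarrow> 'i lop" where
  "pT T p = fold_coeffs (\<lambda>a A. sc a + T * A) p 0"

lemma pT_pCons: "pT T (pCons a p) = sc a + T * pT T p"
  by (cases "p = 0 \<and> a = 0") (auto simp: pT_def fold_coeffs_pCons_eq sc_simps)

lemma pT_0 [simp]: "pT T 0 = 0"
  by (simp add: pT_def)

lemma pT_add: "pT T (p + r) = pT T p + pT T r"
  by (induction p r rule: poly_induct2) (simp_all add: pT_pCons sc_simps distrib_left add_ac)

lemma pT_smult: "pT T (smult c p) = sc c * pT T p"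
  by (induction p)
     (simp_all add: pT_pCons sc_simps distrib_left sc_central[of T] flip: mult.assoc)

lemma pT_mult_linear: "pT T ([:- a, 1:] * r) = T * pT T r - sc a * pT T r"
proof -
  have e: "[:- a, 1:] * r = pCons 0 r + smult (- a) r" by simp
  show ?thesis unfolding e pT_add pT_smult pT_pCons by (simp add: sc_simps)
qed

lemma pT_monom: "pT T (monom c i) = sc c * T ^ i"
  by (induction i) (simp_all add: monom_0 monom_Suc pT_pCons sc_simps sc_central[of T] mult.assoc[symmetric])

lemma pT_sum: "pT T (\<Sum>i\<in>A. f i) = (\<Sum>i\<in>A. pT T (f i))"
  by (induction A rule: infinite_finite_induct) (simp_all add: pT_add)

lemma app_pT_in: "subsp W \<Longrightarrow> (\<And>x. x \<in> W \<Longrightarrow> app T x \<in> W) \<Longrightarrow> x \<in> W \<Longrightarrow> app (pT T p) x \<in> W"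
  by (induction p) (simp_all add: pT_pCons subspD)

text \<open>A linear factor is split off from \<open>p\<close>: either the quotient still kills
  \<open>w\<close>, and the degree has dropped, or the quotient applied to \<open>w\<close> is the
  desired eigenvector.\<close>

lemma eigenvector_of_annihilator:
  assumes W: "subsp W" "\<And>x. x \<in> W \<Longrightarrow> app T x \<in> W"
    and w: "w \<in> W" "w \<noteq> 0" and p: "p \<noteq> 0" "app (pT T p) w = 0"
  shows "\<exists>\<mu>. \<exists>x\<in>W. x \<noteq> 0 \<and> app T x = sm \<mu> x"
  using p
proof (induction "degree p" arbitrary: p rule: less_induct)
  case less
  show ?case
  proof (cases "degree p = 0")
    case True
    then obtain a where a: "p = [:a:]" by (metis degree_eq_zeroE)
    then show ?thesis using less.prems w by (simp add: pT_pCons sm_eq_0_iff)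
  next
    case False
    then obtain a where "poly p a = 0" using alg_closed_imp_poly_has_root[of p] by auto
    then obtain r where r: "p = [:- a, 1:] * r" by (metis dvdE poly_eq_0_iff_dvd)
    have r0: "r \<noteq> 0" using r less.prems(1) by auto
    then have "degree p = degree [:- a, 1:] + degree r" unfolding r by (intro degree_mult_eq) auto
    then have deg: "degree r < degree p" by simp
    show ?thesis
    proof (cases "app (pT T r) w = 0")
      case True
      then show ?thesis using less.hyps[OF deg r0] by blast
    next
      case F: False
      have "app T (app (pT T r) w) = sm a (app (pT T r) w)"
        using less.prems(2) unfolding r pT_mult_linear by simp
      then show ?thesis using F app_pT_in[OF W w(1)] by blast
    qed
  qed
qed

text \<open>A bound on the dimension by linear relations instead of bases, because relations are
  what survives the passage to a limit.\<close>

definition dimle :: "('i \<Rightarrow> complex) set \<Rightarrow> nat \<Rightarrow> bool" where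
  "dimle W D \<longleftrightarrow> (\<forall>g. (\<forall>i\<le>D. g i \<in> W) \<longrightarrow> (\<exists>c. (\<exists>i\<le>D. c i \<noteq> 0) \<and> (\<Sum>i\<le>D. sm (c i) (g i)) = 0))"

lemma dimleD:
  assumes "dimle W D" "\<And>i. i \<le> D \<Longrightarrow> g i \<in> W"
  obtains c where "\<exists>i\<le>D. c i \<noteq> 0" "(\<Sum>i\<le>D. sm (c i) (g i)) = 0"
  using assms(1)[unfolded dimle_def, rule_format, of g] assms(2) by blast

lemma dimle_mono: "dimle W D \<Longrightarrow> U \<subseteq> W \<Longrightarrow> dimle U D"
  unfolding dimle_def by blast

lemma dimle_support:
  assumes "finite A" "card A \<le> D" "\<And>x i. x \<in> W \<Longrightarrow> i \<notin> A \<Longrightarrow> x i = 0"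
  shows "dimle W D"
  unfolding dimle_def
proof (intro allI impI)
  fix g assume g: "\<forall>i\<le>D. g i \<in> W"
  obtain c where c: "\<exists>i\<le>D. c i \<noteq> 0" "\<forall>a\<in>A. (\<Sum>i\<le>D. c i * g i a) = 0"
    using underdetermined[OF assms(1,2), of g] by blast
  have "(\<Sum>i\<le>D. sm (c i) (g i)) a = 0" for a
    using c(2) g assms(3) by (cases "a \<in> A") (auto simp: sum_fun_apply sm_def intro!: sum.neutral)
  then show "\<exists>c. (\<exists>i\<le>D. c i \<noteq> 0) \<and> (\<Sum>i\<le>D. sm (c i) (g i)) = 0"
    using c(1) by (intro exI[of _ c]) (auto simp: fun_eq_iff fun_apply)
qed

lemma dimle_Vn: "dimle (Vn n) n"
  by (rule dimle_support[of "{..<n}"]) (auto simp: Vn_def)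

lemma dimle_0: "subsp W \<Longrightarrow> dimle W 0 \<longleftrightarrow> W = {0}"
proof
  assume W: "subsp W" and d: "dimle W 0"
  have "x = 0" if "x \<in> W" for x
    using d[unfolded dimle_def, rule_format, of "\<lambda>_. x"] that by (auto simp: sm_eq_0_iff)
  then show "W = {0}" using subspD(1)[OF W] by auto
next
  assume "W = {0}"
  then show "dimle W 0" unfolding dimle_def by (intro allI impI exI[of _ "\<lambda>_. 1"]) simp
qed

lemma dimle_proper:
  assumes W: "subsp W" "dimle W (Suc D)" and U: "subsp U" "U \<subseteq> W" "U \<noteq> W"
  shows "dimle U D"
  unfolding dimle_def
proof (intro allI impI)
  fix g assume g: "\<forall>i\<le>D. g i \<in> U"
  obtain x where x: "x \<in> W" "x \<notin> U" using U by blast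
  have "(if i \<le> D then g i else x) \<in> W" for i using g x U(2) by auto
  then obtain c where c: "\<exists>i\<le>Suc D. c i \<noteq> 0" "(\<Sum>i\<le>Suc D. sm (c i) (if i \<le> D then g i else x)) = 0"
    by (rule dimleD[OF W(2)])
  then have s: "(\<Sum>i\<le>D. sm (c i) (g i)) + sm (c (Suc D)) x = 0" by simp
  have "c (Suc D) = 0"
  proof (rule ccontr)
    assume n: "c (Suc D) \<noteq> 0"
    have "sm (c (Suc D)) x = - (\<Sum>i\<le>D. sm (c i) (g i))" using s by (simp add: eq_neg_iff_add_eq_0 add.commute)
    then have "sm (1 / c (Suc D)) (sm (c (Suc D)) x) = sm (- 1 / c (Suc D)) (\<Sum>i\<le>D. sm (c i) (g i))"
      by (simp add: sm_minus_left)
    moreover have "sm (- 1 / c (Suc D)) (\<Sum>i\<le>D. sm (c i) (g i)) \<in> U"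
      by (intro subspD(3)[OF U(1)] subsp_sum[OF U(1)]) (use g in auto)
    ultimately show False using n x(2) by simp
  qed
  then show "\<exists>c. (\<exists>i\<le>D. c i \<noteq> 0) \<and> (\<Sum>i\<le>D. sm (c i) (g i)) = 0"
    using c(1) s by (intro exI[of _ c]) (auto simp: le_Suc_eq)
qed

lemma eigenvector_exists:
  assumes W: "subsp W" "dimle W D" "W \<noteq> {0}" and T: "\<And>x. x \<in> W \<Longrightarrow> app T x \<in> W"
  shows "\<exists>\<mu>. \<exists>x\<in>W. x \<noteq> 0 \<and> app T x = sm \<mu> x"
proof -
  obtain w where w: "w \<in> W" "w \<noteq> 0" using W subspD(1)[OF W(1)] by blast
  have "app (T ^ i) w \<in> W" for i by (induction i) (auto simp: w T)
  then obtain c where c: "\<exists>i\<le>D. c i \<noteq> 0" "(\<Sum>i\<le>D. sm (c i) (app (T ^ i) w)) = 0"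
    by (rule dimleD[OF W(2)])
  define p where "p = (\<Sum>i\<le>D. monom (c i) i)"
  have "coeff p n = (if n \<le> D then c n else 0)" for n by (simp add: p_def coeff_sum)
  then have "p \<noteq> 0" using c(1) by (metis coeff_0)
  moreover have "app (pT T p) w = 0"
    using c(2) by (simp add: p_def pT_sum pT_monom sum_app)
  ultimately show ?thesis using eigenvector_of_annihilator[of W T w p] W(1) T w by blast
qed

text \<open>There are infinitely many operators, so the argument takes a nonzero invariant subspace
  with the least dimension bound. Each eigenspace in it is again invariant by commutation, hence
  everything, and all operators act on it as scalars.\<close>

lemma common_eigenvector:
  fixes T :: "nat \<Rightarrow> 'i lop"
  assumes W0: "subsp W0" "dimle W0 D" "W0 \<noteq> {0}" "\<And>t x. x \<in> W0 \<Longrightarrow> app (T t) x \<in> W0"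
    and comm: "\<And>s t. T s * T t = T t * T s"
  obtains x u where "x \<in> W0" "x \<noteq> 0" "\<And>t. app (T t) x = sm (u t) x"
proof -
  define good where "good W \<longleftrightarrow> subsp W \<and> W \<noteq> {0} \<and> W \<subseteq> W0 \<and> (\<forall>t. \<forall>x\<in>W. app (T t) x \<in> W)" for W
  have "\<exists>D W. good W \<and> dimle W D" using W0 unfolding good_def by blast
  then obtain D where D: "\<exists>W. good W \<and> dimle W D" "\<And>E. E < D \<Longrightarrow> \<not> (\<exists>W. good W \<and> dimle W E)"
    using exists_least_iff[of "\<lambda>D. \<exists>W. good W \<and> dimle W D"] by blast
  then obtain W where W: "good W" "dimle W D" by blast
  have sW: "subsp W" "W \<noteq> {0}" using W(1) by (auto simp: good_def)
  have "D \<noteq> 0" using dimle_0[OF sW(1)] W(2) sW(2) by metis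
  then obtain E where E: "D = Suc E" by (cases D) auto
  have all: "\<exists>\<mu>. \<forall>x\<in>W. app (T t) x = sm \<mu> x" for t
  proof -
    obtain \<mu> y where y: "y \<in> W" "y \<noteq> 0" "app (T t) y = sm \<mu> y"
      using eigenvector_exists[OF sW(1) W(2) sW(2), of "T t"] W(1) by (auto simp: good_def)
    let ?U = "{x \<in> W. app (T t) x = sm \<mu> x}"
    have tc: "app (T t) (app (T s) x) = app (T s) (app (T t) x)" for s x
      using arg_cong[OF comm[of t s], of "\<lambda>A. app A x"] by simp
    have U: "subsp ?U" unfolding subsp_def using subspD[OF sW(1)] by (auto simp: mult.commute)
    moreover have "?U \<noteq> {0}" using y by blast
    ultimately have "good ?U"
      using W(1) unfolding good_def by (auto simp: tc)
    then have "\<not> dimle ?U E" using D(2)[of E] E by blast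
    then have "?U = W" using dimle_proper[OF sW(1) W(2)[unfolded E] U] by blast
    then show ?thesis by blast
  qed
  then obtain u where u: "\<And>t x. x \<in> W \<Longrightarrow> app (T t) x = sm (u t) x" by metis
  obtain x where "x \<in> W" "x \<noteq> 0" using sW subspD(1)[OF sW(1)] by blast
  then show ?thesis using that u W(1) unfolding good_def by blast
qed

lemma finite_eigen_indices:
  fixes \<mu> :: "nat \<Rightarrow> complex"
  assumes inj: "inj \<mu>" and D: "dimle W D"
  shows "finite {j. \<exists>x\<in>W. x \<noteq> 0 \<and> app K x = sm (\<mu> j) x}"
proof (rule ccontr)
  let ?A = "{j. \<exists>x\<in>W. x \<noteq> 0 \<and> app K x = sm (\<mu> j) x}"
  assume inf: "infinite ?A"
  define e where "e = enumerate ?A"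
  have e: "inj e" unfolding e_def using strict_mono_enumerate[OF inf] by (rule strict_mono_imp_inj_on)
  have "\<forall>i. \<exists>x\<in>W. x \<noteq> 0 \<and> app K x = sm (\<mu> (e i)) x"
    using enumerate_in_set[OF inf] unfolding e_def by blast
  then obtain g where g: "\<And>i. g i \<in> W" "\<And>i. g i \<noteq> 0" "\<And>i. app K (g i) = sm (\<mu> (e i)) (g i)" by metis
  obtain c where c: "\<exists>i\<le>D. c i \<noteq> 0" "(\<Sum>i\<le>D. sm (c i) (g i)) = 0"
    by (rule dimleD[OF D g(1)])
  have "sm (c i) (g i) \<in> {0}" if "i \<le> D" for i
    by (rule eigen_components[OF subsp_zero, of K D "\<lambda>i. sm (c i) (g i)" "\<lambda>i. \<mu> (e i)"])
       (use g c(2) that inj e in \<open>auto simp: mult_ac inj_on_def\<close>)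
  then show False using c(1) g(2) by (auto simp: sm_eq_0_iff)
qed

text \<open>The vectors \<open>F ^ j\<close> applied to \<open>x\<close> have distinct eigenvalues,
  so only finitely many of them are nonzero.\<close>

lemma nilpotent_string:
  fixes \<mu> :: "nat \<Rightarrow> complex"
  assumes inj: "inj \<mu>" and D: "dimle W D" and x: "x \<noteq> 0"
    and w: "\<And>j. app (F ^ j) x \<in> W" "\<And>j. app K (app (F ^ j) x) = sm (\<mu> j) (app (F ^ j) x)"
  obtains k where "app (F ^ k) x \<noteq> 0" "app (F ^ Suc k) x = 0"
proof -
  have "\<exists>j. app (F ^ j) x = 0"
  proof (rule ccontr)
    assume "\<nexists>j. app (F ^ j) x = 0"
    then have "{j. \<exists>y\<in>W. y \<noteq> 0 \<and> app K y = sm (\<mu> j) y} = UNIV" using w by blast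
    then show False using finite_eigen_indices[OF inj D, of K] by simp
  qed
  then obtain j where j: "app (F ^ j) x = 0" "\<And>i. i < j \<Longrightarrow> app (F ^ i) x \<noteq> 0"
    using exists_least_iff[of "\<lambda>j. app (F ^ j) x = 0"] by blast
  have "j \<noteq> 0" using j(1) x by (metis app_simps(2) power_0)
  then obtain k where "j = Suc k" by (cases j) auto
  then show ?thesis using that j by blast
qed

text \<open>The computation with \<open>sl\<^sub>2\<close>-strings: the trace of \<open>[A, B]\<close> on a finite string vanishes.\<close>

lemma string_relation:
  fixes A B H :: "'i lop"
  assumes AB: "A * B = B * A + H" and A: "app A v = 0"
    and H: "\<And>j. app H (app (B ^ j) v) = sm (h j) (app (B ^ j) v)"
    and k: "app (B ^ k) v \<noteq> 0" "app (B ^ Suc k) v = 0"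
  shows "(\<Sum>j\<le>k. h j) = 0"
proof -
  have "app A (app (B ^ Suc j) v) = sm (\<Sum>i\<le>j. h i) (app (B ^ j) v)" for j
  proof (induction j)
    case 0
    show ?case using arg_cong[OF AB, of "\<lambda>T. app T v"] A H[of 0] by simp
  next
    case (Suc j)
    have "app A (app (B ^ Suc (Suc j)) v) = app (A * B) (app (B ^ Suc j) v)" by simp
    also have "\<dots> = app B (app A (app (B ^ Suc j) v)) + sm (h (Suc j)) (app (B ^ Suc j) v)"
      unfolding AB using H[of "Suc j"] by simp
    also have "\<dots> = sm (\<Sum>i\<le>Suc j. h i) (app (B ^ Suc j) v)"
      unfolding Suc by (simp add: sm_add_left)
    finally show ?case .
  qed
  from this[of k] show ?thesis using k by (simp add: sm_eq_0_iff)
qed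

section \<open>Strings for the quantum sl_2 in degree 0\<close>

context quantum
begin

lemma sum_q2: "(\<Sum>i\<le>k. (q\<^sup>2) ^ i) = (q\<^sup>2) ^ k * qs k"
proof -
  have "(\<Sum>i\<le>k. (q\<^sup>2) ^ i) = (\<Sum>i\<le>k. (q\<^sup>2) ^ (k - i))"
    by (rule sum.reindex_bij_witness[of _ "\<lambda>i. k - i" "\<lambda>i. k - i"]) auto
  also have "\<dots> = (\<Sum>i\<le>k. (q\<^sup>2) ^ k * cc ^ i)"
  proof (rule sum.cong, rule refl)
    fix i assume "i \<in> {..k}"
    then have "(q\<^sup>2) ^ k = (q\<^sup>2) ^ (k - i) * (q\<^sup>2) ^ i" by (simp flip: power_add)
    then have "(q\<^sup>2) ^ k * cc ^ i = (q\<^sup>2) ^ (k - i) * (q\<^sup>2 * cc) ^ i"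
      by (simp only: power_mult_distrib mult.assoc)
    then show "(q\<^sup>2) ^ (k - i) = (q\<^sup>2) ^ k * cc ^ i" by simp
  qed
  finally show ?thesis by (simp add: qs_def sum_distrib_left)
qed

lemma q2_inj: "(q\<^sup>2) ^ i = (q\<^sup>2) ^ j \<Longrightarrow> i = j"
proof -
  assume "(q\<^sup>2) ^ i = (q\<^sup>2) ^ j"
  then have "inverse ((q\<^sup>2) ^ i) = inverse ((q\<^sup>2) ^ j)" by simp
  then have "cc ^ i = cc ^ j" by (simp add: cc_def power_inverse)
  then show ?thesis by (rule cc_inj)
qed

lemma cc_q2: "cc ^ i * (q\<^sup>2) ^ i = 1"
  by (simp flip: power_mult_distrib)

lemma inverse_cc: "inverse (cc ^ i) = (q\<^sup>2) ^ i"
  using cc_q2[of i] by (simp add: inverse_unique)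

end

context urep
begin

lemma EF: "\<rho> (XP 0) * \<rho> (XM 0) = \<rho> (XM 0) * \<rho> (XP 0) + \<rho> KP * \<rho> (JJ 0)"
  using XX[of 0 0] by (simp add: algebra_simps)

lemma KJ0_eigen:
  assumes "app (\<rho> KP) x = sm \<mu> x" "\<mu> \<noteq> 0"
  shows "app (\<rho> KP * \<rho> (JJ 0)) x = sm ((\<mu> - inverse \<mu>) / (q - inverse q)) x"
proof -
  have "app (\<rho> KM) (app (\<rho> KP) x) = x" using arg_cong[OF KK(2), of "\<lambda>A. app A x"] by simp
  then have "sm (inverse \<mu>) (sm \<mu> (app (\<rho> KM) x)) = sm (inverse \<mu>) x" using assms(1) by simp
  then have KMx: "app (\<rho> KM) x = sm (inverse \<mu>) x" using assms(2) by simp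
  have "sm (q - inverse q) (app (\<rho> KP * \<rho> (JJ 0)) x) = sm (\<mu> - inverse \<mu>) x"
    using arg_cong[OF KP_J, of "\<lambda>A. app A x"] assms(1) KMx by (simp add: sm_diff_left)
  then have "sm (1 / (q - inverse q)) (sm (q - inverse q) (app (\<rho> KP * \<rho> (JJ 0)) x))
     = sm (1 / (q - inverse q)) (sm (\<mu> - inverse \<mu>) x)" by simp
  then show ?thesis using qd by (simp only: sm_simps) simp
qed

lemma XM_weight:
  assumes "app (\<rho> KP) x = sm \<mu> x"
  shows "app (\<rho> KP) (app (\<rho> (XM t) ^ j) x) = sm (\<mu> * cc ^ j) (app (\<rho> (XM t) ^ j) x)"
proof (induction j)
  case (Suc j)
  have "app (\<rho> KP) (app (\<rho> (XM t)) y) = sm cc (app (\<rho> (XM t)) (app (\<rho> KP) y))" for y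
    using arg_cong[OF KXm'[of t], of "\<lambda>A. app A y"] by simp
  then show ?case using Suc by (simp add: mult_ac)
qed (simp add: assms)

lemma XP_weight:
  assumes "app (\<rho> KP) x = sm \<mu> x"
  shows "app (\<rho> KP) (app (\<rho> (XP t) ^ j) x) = sm (\<mu> * (q\<^sup>2) ^ j) (app (\<rho> (XP t) ^ j) x)"
proof (induction j)
  case (Suc j)
  have "app (\<rho> KP) (app (\<rho> (XP t)) y) = sm (q\<^sup>2) (app (\<rho> (XP t)) (app (\<rho> KP) y))" for y
    using arg_cong[OF KXp'[of t], of "\<lambda>A. app A y"] by simp
  then show ?case using Suc by (simp add: mult_ac)
qed (simp add: assms)

text \<open>The eigenvalues of \<open>K^+ J_0\<close> on the string sum to 0. The sum is a
  difference of two geometric sums, and by \<open>sum_q2\<close> both are multiples of the nonzero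
  \<open>qs k\<close>.\<close>

lemma highest_weight_string:
  assumes E: "app (\<rho> (XP 0)) v = 0" and K: "app (\<rho> KP) v = sm lam v" and lam: "lam \<noteq> 0"
    and k: "app (\<rho> (XM 0) ^ k) v \<noteq> 0" "app (\<rho> (XM 0) ^ Suc k) v = 0"
  shows "lam ^ 2 = (q\<^sup>2) ^ k"
proof -
  let ?d = "q - inverse q"
  have "(\<Sum>j\<le>k. (lam * cc ^ j - inverse (lam * cc ^ j)) / ?d) = 0"
    by (rule string_relation[OF EF E _ k]) (rule KJ0_eigen[OF XM_weight[OF K]], use lam in simp)
  then have "(\<Sum>j\<le>k. lam * cc ^ j - inverse (lam * cc ^ j)) = 0"
    using qd by (simp flip: sum_divide_distrib)
  then have "lam * (\<Sum>j\<le>k. cc ^ j) = inverse lam * (\<Sum>j\<le>k. (q\<^sup>2) ^ j)"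
    by (simp add: sum_subtractf inverse_cc flip: sum_distrib_left)
  then have "lam * qs k = inverse lam * ((q\<^sup>2) ^ k * qs k)"
    unfolding sum_q2 qs_def .
  then show ?thesis using qs_ne0[of k] lam by (simp add: field_simps power2_eq_square)
qed

text \<open>The mirror image of \<open>highest_weight_string\<close>, with \<open>X^+_0\<close>
  moving along the string and \<open>- (K^+ J_0)\<close> as the commutator.\<close>

lemma lowest_weight_string:
  assumes F: "app (\<rho> (XM 0)) w = 0" and K: "app (\<rho> KP) w = sm \<mu> w" and mu: "\<mu> \<noteq> 0"
    and l: "app (\<rho> (XP 0) ^ l) w \<noteq> 0" "app (\<rho> (XP 0) ^ Suc l) w = 0"
  shows "\<mu> ^ 2 * (q\<^sup>2) ^ l = 1"
proof -
  let ?d = "q - inverse q"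
  have FE: "\<rho> (XM 0) * \<rho> (XP 0) = \<rho> (XP 0) * \<rho> (XM 0) + - (\<rho> KP * \<rho> (JJ 0))"
    using EF by (simp add: algebra_simps)
  have q2: "(q\<^sup>2) ^ j \<noteq> 0" for j using q0 by simp
  have "(\<Sum>j\<le>l. - ((\<mu> * (q\<^sup>2) ^ j - inverse (\<mu> * (q\<^sup>2) ^ j)) / ?d)) = 0"
  proof (rule string_relation[OF FE F _ l])
    fix j
    have "app (\<rho> KP * \<rho> (JJ 0)) (app (\<rho> (XP 0) ^ j) w)
       = sm ((\<mu> * (q\<^sup>2) ^ j - inverse (\<mu> * (q\<^sup>2) ^ j)) / ?d) (app (\<rho> (XP 0) ^ j) w)"
      by (rule KJ0_eigen[OF XP_weight[OF K]]) (use mu q2 in simp)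
    then show "app (- (\<rho> KP * \<rho> (JJ 0))) (app (\<rho> (XP 0) ^ j) w)
       = sm (- ((\<mu> * (q\<^sup>2) ^ j - inverse (\<mu> * (q\<^sup>2) ^ j)) / ?d)) (app (\<rho> (XP 0) ^ j) w)"
      by (simp only: app_simps sm_minus_left)
  qed
  then have "(\<Sum>j\<le>l. \<mu> * (q\<^sup>2) ^ j - inverse (\<mu> * (q\<^sup>2) ^ j)) = 0"
    using qd by (simp add: sum_negf flip: sum_divide_distrib)
  moreover have "inverse ((q\<^sup>2) ^ j) = cc ^ j" for j
    using inverse_cc[of j] by (metis inverse_inverse_eq)
  ultimately have "\<mu> * (\<Sum>j\<le>l. (q\<^sup>2) ^ j) = inverse \<mu> * (\<Sum>j\<le>l. cc ^ j)"
    by (simp add: sum_subtractf flip: sum_distrib_left)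
  then have "\<mu> * ((q\<^sup>2) ^ l * qs l) = inverse \<mu> * qs l"
    unfolding sum_q2 qs_def .
  then have "\<mu> * (q\<^sup>2) ^ l = inverse \<mu>" using qs_ne0[of l] by (simp flip: mult.assoc)
  then show ?thesis using mu by (simp add: field_simps power2_eq_square)
qed

end

lemma fd_simple_highest_weight:
  assumes q: "quantum q" and M: "fd_simple q M"
  shows "\<exists>\<phi>\<in>C0. is_L q M (u0 q \<phi>)"
proof -
  have um: "is_umod q M" and n: "dim M > 0" using M by (auto simp: fd_simple_def)
  define \<rho> where "\<rho> = reprM M"
  define V where "V = Vn (dim M)"
  interpret urep q \<rho> unfolding \<rho>_def by (rule urep_reprM[OF q um])
  have V: "subsp V" "dimle V (dim M)" "\<And>x g. x \<in> V \<Longrightarrow> app (\<rho> g) x \<in> V"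
    unfolding V_def \<rho>_def using subsp_Vn dimle_Vn reprM_Vn[OF um] by auto
  have pow_V: "app (\<rho> g ^ j) x \<in> V" if "x \<in> V" for g j x
    by (induction j) (auto simp: that V)
  have ne: "V \<noteq> {0}"
  proof
    assume "V = {0}"
    moreover have "ue 0 \<in> V" unfolding V_def using n by (rule ue_Vn)
    ultimately have "ue 0 = 0" by simp
    then have "ue 0 0 = 0" by (simp add: fun_apply)
    then show False by (simp add: ue_def)
  qed
  define ev where "ev \<mu> \<longleftrightarrow> (\<exists>x\<in>V. x \<noteq> 0 \<and> app (\<rho> KP) x = sm \<mu> x)" for \<mu>
  have ev0: "\<mu> \<noteq> 0" if "ev \<mu>" for \<mu>
  proof
    assume "\<mu> = 0"
    then obtain x where x: "x \<noteq> 0" "app (\<rho> KP) x = 0" using \<open>ev \<mu>\<close> by (auto simp: ev_def)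
    have "app (\<rho> KM * \<rho> KP) x = 0" using x by simp
    then show False using x KK by simp
  qed
  obtain \<mu>0 where mu0: "ev \<mu>0"
    using eigenvector_exists[OF V(1,2) ne, of "\<rho> KP"] V(3) by (auto simp: ev_def)
  have inj2: "inj (\<lambda>j. \<mu> * (q\<^sup>2) ^ j)" if "\<mu> \<noteq> 0" for \<mu>
    using that by (auto simp: inj_def dest: q2_inj)
  have injc: "inj (\<lambda>j. \<mu> * cc ^ j)" if "\<mu> \<noteq> 0" for \<mu>
    using that by (auto simp: inj_def dest: cc_inj)
  \<comment> \<open>The exponents by which the weight \<open>\<mu>0\<close> can be raised; there are
    finitely many, and the largest gives a weight \<open>lam\<close> above which, in steps of
    \<open>q\<^sup>2\<close>, no weight occurs.\<close>
  define A where "A = {j. ev (\<mu>0 * (q\<^sup>2) ^ j)}"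
  have "finite A" unfolding A_def ev_def by (rule finite_eigen_indices[OF inj2[OF ev0[OF mu0]] V(2)])
  have A: "j \<in> A \<longleftrightarrow> ev (\<mu>0 * (q\<^sup>2) ^ j)" for j by (simp add: A_def)
  have "0 \<in> A" using mu0 by (simp add: A)
  define lam where "lam = \<mu>0 * (q\<^sup>2) ^ Max A"
  have "Max A \<in> A" using Max_in[OF \<open>finite A\<close>] \<open>0 \<in> A\<close> by blast
  then have lam: "ev lam" unfolding A lam_def .
  have top: "\<not> ev (lam * (q\<^sup>2) ^ j)" if "j > 0" for j
  proof
    assume "ev (lam * (q\<^sup>2) ^ j)"
    then have "Max A + j \<in> A" by (simp add: A lam_def power_add mult.assoc)
    then show False using Max_ge[OF \<open>finite A\<close>, of "Max A + j"] that by simp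
  qed
  have lam0: "lam \<noteq> 0" using ev0 lam by blast
  \<comment> \<open>The \<open>J_t\<close> preserve the weight space of \<open>lam\<close>. A common
    eigenvector in it is killed by every \<open>X^+_t\<close>, which would otherwise produce a
    weight above \<open>lam\<close>.\<close>
  let ?W = "{x \<in> V. app (\<rho> KP) x = sm lam x}"
  have W: "subsp ?W" unfolding subsp_def using subspD[OF V(1)] by (auto simp: mult.commute)
  have WV: "dimle ?W (dim M)" by (rule dimle_mono[OF V(2)]) auto
  have Wne: "?W \<noteq> {0}" using lam unfolding ev_def by blast
  have WJ: "app (\<rho> (JJ t)) x \<in> ?W" if "x \<in> ?W" for t x
    using that V(3) arg_cong[OF KJ[of t], of "\<lambda>A. app A x"] by simp
  obtain v u where v: "v \<in> ?W" "v \<noteq> 0" "\<And>t. app (\<rho> (JJ t)) v = sm (u t) v"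
  proof (rule common_eigenvector[where T = "\<lambda>t. \<rho> (JJ t)", OF W WV Wne])
    show "app (\<rho> (JJ t)) x \<in> ?W" if "x \<in> ?W" for t x by (rule WJ[OF that])
    show "\<rho> (JJ s) * \<rho> (JJ t) = \<rho> (JJ t) * \<rho> (JJ s)" for s t by (rule JJ)
  qed (rule that)
  have vV: "v \<in> V" and vK: "app (\<rho> KP) v = sm lam v" using v by auto
  have vE: "app (\<rho> (XP t)) v = 0" for t
  proof (rule ccontr)
    assume "app (\<rho> (XP t)) v \<noteq> 0"
    then have "ev (lam * (q\<^sup>2) ^ 1)"
      unfolding ev_def using XP_weight[OF vK, of t 1] V(3)[OF vV] by (auto intro!: bexI[of _ "app (\<rho> (XP t)) v"])
    then show False using top[of 1] by simp
  qed
  obtain k where k: "app (\<rho> (XM 0) ^ k) v \<noteq> 0" "app (\<rho> (XM 0) ^ Suc k) v = 0"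
    by (rule nilpotent_string[OF injc[OF lam0] V(2) v(2) pow_V[OF vV] XM_weight[OF vK]])
  have lam2: "lam ^ 2 = (q\<^sup>2) ^ k" by (rule highest_weight_string[OF vE vK lam0 k])
  have "lam\<^sup>2 = (q ^ k)\<^sup>2" using lam2 by (simp add: mult.commute flip: power_mult)
  then have "lam = 1 * q ^ k \<or> lam = (-1) * q ^ k" by (simp add: power2_eq_iff)
  then obtain b where b: "lam = b * q ^ k" "b = 1 \<or> b = -1" by blast
  \<comment> \<open>Otherwise one descends further by \<open>X^-_0\<close> to a lowest vector, of
    weight \<open>lam * cc ^ (n + j)\<close>. Its string upwards has length l with
    \<open>k + l = 2 * (n + j)\<close>; since \<open>n > k\<close>, l exceeds \<open>n + j\<close>
    and the string ends above \<open>lam\<close>.\<close>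
  have nil: "app (\<rho> (XM 1) ^ n) v = 0" if nk: "n > k" for n
  proof (rule ccontr)
    let ?w = "app (\<rho> (XM 1) ^ n) v"
    assume w0: "?w \<noteq> 0"
    have wV: "?w \<in> V" by (rule pow_V[OF vV])
    have wK: "app (\<rho> KP) ?w = sm (lam * cc ^ n) ?w" by (rule XM_weight[OF vK])
    obtain j where j: "app (\<rho> (XM 0) ^ j) ?w \<noteq> 0" "app (\<rho> (XM 0) ^ Suc j) ?w = 0"
      by (rule nilpotent_string[OF injc V(2) w0 pow_V[OF wV] XM_weight[OF wK]]) (use lam0 in simp)
    let ?x = "app (\<rho> (XM 0) ^ j) ?w" and ?\<mu> = "lam * cc ^ n * cc ^ j"
    have xV: "?x \<in> V" by (rule pow_V[OF wV])
    have xK: "app (\<rho> KP) ?x = sm ?\<mu> ?x" by (rule XM_weight[OF wK])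
    have mu: "?\<mu> \<noteq> 0" using lam0 by simp
    obtain l where l: "app (\<rho> (XP 0) ^ l) ?x \<noteq> 0" "app (\<rho> (XP 0) ^ Suc l) ?x = 0"
      by (rule nilpotent_string[OF inj2[OF mu] V(2) j(1) pow_V[OF xV] XP_weight[OF xK]])
    have "app (\<rho> (XM 0)) ?x = 0" using j(2) by simp
    then have "?\<mu> ^ 2 * (q\<^sup>2) ^ l = 1" by (rule lowest_weight_string[OF _ xK mu l])
    then have "(q\<^sup>2) ^ k * (cc ^ (n + j)) ^ 2 * (q\<^sup>2) ^ l = 1"
      by (simp add: power_mult_distrib lam2 power_add mult_ac)
    then have "((cc ^ (n + j)) * (q\<^sup>2) ^ (n + j)) ^ 2 * (q\<^sup>2) ^ (k + l) = ((q\<^sup>2) ^ (n + j)) ^ 2"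
      by (simp only: power_mult_distrib power_add[of _ k l]) (simp add: mult_ac)
    then have "(q\<^sup>2) ^ (k + l) = (q\<^sup>2) ^ ((n + j) * 2)"
      by (simp only: cc_q2 power_mult power_one mult_1_left)
    then have kl: "k + l = (n + j) * 2" by (rule q2_inj)
    then obtain i where i: "l = (n + j) + i" "i > 0" using nk by (intro that[of "l - (n + j)"]) auto
    have "?\<mu> * (q\<^sup>2) ^ l = lam * (cc ^ (n + j) * (q\<^sup>2) ^ (n + j)) * (q\<^sup>2) ^ i"
      by (simp add: i power_add mult_ac)
    then have "?\<mu> * (q\<^sup>2) ^ l = lam * (q\<^sup>2) ^ i" by (simp add: cc_q2)
    then have "app (\<rho> KP) (app (\<rho> (XP 0) ^ l) ?x) = sm (lam * (q\<^sup>2) ^ i) (app (\<rho> (XP 0) ^ l) ?x)"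
      using XP_weight[OF xK, of 0 l] by (simp only:)
    then have "ev (lam * (q\<^sup>2) ^ i)"
      unfolding ev_def using l(1) pow_V[OF xV, of "XP 0" l] by blast
    then show False using top[OF i(2)] by blast
  qed
  have P: "drinfeld u n = 0" if "n > k" for n
  proof (rule drinfeld_coeff_zero[OF vE vK lam0 _ _ _ v(2) nil[OF that]])
    show "app (\<rho> (JJ t)) v = sm (u t) v" for t by (rule v(3))
    show "drinfeld u 0 = 1" by (simp add: drinfeld.simps)
    fix m
    have "fps_nth (uhat u * Abs_fps (drinfeld u)) m = fps_nth (csc (Abs_fps (drinfeld u))) m"
      using drel_drinfeld[of u] by (simp add: drel_def)
    then show "cc ^ m * drinfeld u m = (\<Sum>i\<le>m. (if i = 0 then 1 else (q - inverse q) * u i) * drinfeld u (m - i))"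
      by (simp add: fps_mult_nth uhat_def atLeast0AtMost)
  qed
  obtain \<phi> where phi: "\<phi> \<in> C0" "fst (u0 q \<phi>) = b * q ^ k" "\<And>t. t > 0 \<Longrightarrow> snd (u0 q \<phi>) t = u t"
    using poly_of_drel[OF drel_drinfeld[of u] _ b(2), of k] P by auto
  have "hw \<rho> (u0 q \<phi>) v"
    unfolding hw_def using v vE vK b phi by simp
  then have "is_L q M (u0 q \<phi>)" unfolding is_L_iff using M vV by (auto simp: \<rho>_def V_def)
  then show ?thesis using phi(1) by blast
qed

section \<open>Generic modules\<close>

lift_definition dop :: "('i \<Rightarrow> complex) \<Rightarrow> 'i lop" is "\<lambda>d x S. d S * x S"
  by (auto simp: fun_eq_iff sm_def fun_apply algebra_simps)

text \<open>The common shape of \<open>X^+_t\<close> and \<open>X^-_t\<close>: one summand for each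
  admissible change of the index. Relations linear in them can then be checked on the coefficients,
  by \<open>mixop_cong\<close>.\<close>

lift_definition mixop :: "('i \<Rightarrow> nat set) \<Rightarrow> ('i \<Rightarrow> nat \<Rightarrow> complex) \<Rightarrow> ('i \<Rightarrow> nat \<Rightarrow> 'i) \<Rightarrow> 'i lop" is
  "\<lambda>R a f x S. \<Sum>i\<in>R S. a S i * x (f S i)"
  by (auto simp: fun_eq_iff sm_def fun_apply algebra_simps sum.distrib sum_distrib_left)

lemma app_dop: "app (dop d) x S = d S * x S"
  by (simp add: dop.rep_eq)

lemma app_mixop: "app (mixop R a f) x S = (\<Sum>i\<in>R S. a S i * x (f S i))"
  by (simp add: mixop.rep_eq)

text \<open>Used for the quadratic relations, where the sum runs over ordered pairs of elements that
  are added or removed.\<close>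

lemma sum_off_diagonal_antisym:
  fixes f :: "nat \<Rightarrow> nat \<Rightarrow> complex"
  assumes S: "finite S" and f: "\<And>i j. i \<in> S \<Longrightarrow> j \<in> S \<Longrightarrow> i \<noteq> j \<Longrightarrow> f i j + f j i = 0"
  shows "(\<Sum>i\<in>S. \<Sum>j\<in>S - {i}. f i j) = 0"
proof -
  have e: "(\<Sum>i\<in>S. \<Sum>j\<in>S - {i}. h i j) = (\<Sum>i\<in>S. \<Sum>j\<in>S. if i = j then 0 else h i j)" for h :: "nat \<Rightarrow> nat \<Rightarrow> complex"
  proof (rule sum.cong, rule refl)
    fix i assume "i \<in> S"
    then have "(\<Sum>j\<in>S. if i = j then 0 else h i j) = (\<Sum>j\<in>S - {i}. if i = j then 0 else h i j)"
      using S by (simp add: sum.remove[of S i])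
    then show "(\<Sum>j\<in>S - {i}. h i j) = (\<Sum>j\<in>S. if i = j then 0 else h i j)"
      by (auto intro: sum.cong)
  qed
  have "(\<Sum>i\<in>S. \<Sum>j\<in>S - {i}. f i j) = (\<Sum>i\<in>S. \<Sum>j\<in>S. if i = j then 0 else f j i)"
    unfolding e by (subst sum.swap) (auto intro!: sum.cong)
  then have "2 * (\<Sum>i\<in>S. \<Sum>j\<in>S - {i}. f i j) = (\<Sum>i\<in>S. \<Sum>j\<in>S. (if i = j then 0 else f i j) + (if i = j then 0 else f j i))"
    unfolding sum.distrib using e[of f] by simp
  also have "\<dots> = 0" by (intro sum.neutral ballI) (auto simp: f)
  finally show ?thesis by simp
qed

lemma coeff_prod_linear:
  assumes "finite A"
  shows "degree (\<Prod>j\<in>A. [:a j, b j:]) \<le> card A \<and> coeff (\<Prod>j\<in>A. [:a j, b j:]) (card A) = (\<Prod>j\<in>A. b j :: complex)"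
  using assms
proof (induction A rule: finite_induct)
  case (insert x A)
  let ?p = "\<Prod>j\<in>A. [:a j, b j:]"
  have "degree ([:a x, b x:] * ?p) \<le> degree [:a x, b x:] + degree ?p" by (rule degree_mult_le)
  also have "\<dots> \<le> 1 + card A" using insert.IH by (intro add_mono) auto
  finally have d: "degree ([:a x, b x:] * ?p) \<le> Suc (card A)" by simp
  have "coeff ?p (Suc (card A)) = 0" using insert.IH by (intro coeff_eq_0) simp
  then have "coeff ([:a x, b x:] * ?p) (Suc (card A)) = b x * (\<Prod>j\<in>A. b j)"
    using insert.IH by simp
  then show ?case using insert.hyps d by (simp del: mult_pCons_left)
qed simp

text \<open>For pairwise distinct nonzero roots \<open>\<gamma>\<^sub>i\<close>, a module with a basis of joint eigenvectors of
  the \<open>J\<^sub>t\<close>, indexed by the subsets \<open>S\<close> of \<open>{..<k}\<close>: \<open>X\<^sup>-\<^sub>t\<close> adds an element to \<open>S\<close>,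
  \<open>X\<^sup>+\<^sub>t\<close> removes one. The operators act on coordinate vectors, so that the coordinate at
  \<open>S\<close> of \<open>X\<^sup>-\<^sub>t x\<close> involves the coordinates of \<open>x\<close> at \<open>S - {i}\<close>.\<close>

locale genericmod = quantum q for q +
  fixes k :: nat and \<gamma> :: "nat \<Rightarrow> complex" and \<beta> :: complex
  assumes inj: "inj_on \<gamma> {..<k}" and nz: "\<And>i. i < k \<Longrightarrow> \<gamma> i \<noteq> 0" and \<beta>: "\<beta> * \<beta> = 1"
begin

text \<open>Chosen so that \<open>g_antisym_m\<close> and \<open>g_antisym_p\<close> hold: these
  encode the quadratic relations among the \<open>X^-_t\<close> and among the
  \<open>X^+_t\<close>.\<close>

definition g :: "nat \<Rightarrow> nat \<Rightarrow> complex" where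
  "g i j = (q * \<gamma> i - \<gamma> j / q) / (\<gamma> i - \<gamma> j)"
definition am :: "nat set \<Rightarrow> nat \<Rightarrow> complex" where "am S i = (\<Prod>j\<in>{..<k} - S. g i j)"
definition ap :: "nat set \<Rightarrow> nat \<Rightarrow> complex" where "ap S i = (\<Prod>j\<in>S. g j i)"
text \<open>The residues in \<open>partial_fractions\<close>, up to sign and
  \<open>q - inverse q\<close>. \<open>am\<close> and \<open>ap\<close> are the parts of this
  product outside and inside \<open>S\<close>; on the diagonal, \<open>X^+ X^-\<close> and
  \<open>X^- X^+\<close> reassemble it.\<close>

definition bs :: "nat set \<Rightarrow> nat \<Rightarrow> complex" where
  "bs S i = (\<Prod>j\<in>{..<k} - {i}. if j \<in> S then g j i else g i j)"
definition jj :: "nat \<Rightarrow> nat set \<Rightarrow> complex" where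
  "jj n S = (\<Sum>i<k. (if i \<in> S then -1 else 1) * \<gamma> i ^ n * bs S i)"
definition mu :: "nat set \<Rightarrow> complex" where "mu S = q ^ k * cc ^ card S"
definition jn :: "nat \<Rightarrow> nat set \<Rightarrow> complex" where "jn n S = jj n S / mu S"

text \<open>The sign \<open>\<beta>\<close> enters \<open>X^+_t\<close> and \<open>K^+\<close>
  alike, so the commutator relation is respected, and it disappears from \<open>J_0\<close> because
  \<open>K^-\<close> occurs there squared. On indices that are not subsets of \<open>{..<k}\<close>
  the generators act by \<open>K^+ = K^- = 1\<close> and zero otherwise, a one-dimensional
  representation.\<close>

fun \<rho> :: "gen \<Rightarrow> nat set lop" where
  "\<rho> (XM t) = mixop (\<lambda>S. if S \<subseteq> {..<k} then S else {}) (\<lambda>S i. \<gamma> i ^ t * am S i) (\<lambda>S i. S - {i})"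
| "\<rho> (XP t) = mixop (\<lambda>S. if S \<subseteq> {..<k} then {..<k} - S else {}) (\<lambda>S i. \<beta> * \<gamma> i ^ t * ap S i) (\<lambda>S i. insert i S)"
| "\<rho> (JJ t) = dop (\<lambda>S. if S \<subseteq> {..<k} then jn t S else 0)"
| "\<rho> KP = dop (\<lambda>S. if S \<subseteq> {..<k} then \<beta> * mu S else 1)"
| "\<rho> KM = dop (\<lambda>S. if S \<subseteq> {..<k} then \<beta> / mu S else 1)"

lemma mu0: "mu S \<noteq> 0" using q0 by (simp add: mu_def)

lemma gam_ne: "i < k \<Longrightarrow> j < k \<Longrightarrow> i \<noteq> j \<Longrightarrow> \<gamma> i - \<gamma> j \<noteq> 0"
  using inj by (auto simp: inj_on_def)

lemma mu_remove: "finite S \<Longrightarrow> i \<in> S \<Longrightarrow> mu S = cc * mu (S - {i})"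
  by (metis mu_def card_Suc_Diff1 mult.left_commute power_Suc)

lemma mu_insert: "finite S \<Longrightarrow> i \<notin> S \<Longrightarrow> mu (insert i S) = cc * mu S"
  by (simp add: mu_def)

lemma am_remove:
  assumes "S \<subseteq> {..<k}" "i \<in> S"
  shows "am (S - {i}) j = g j i * am S j"
proof -
  have "{..<k} - (S - {i}) = insert i ({..<k} - S)" using assms by auto
  then show ?thesis using assms by (simp add: am_def)
qed

lemma ap_insert: "finite S \<Longrightarrow> i \<notin> S \<Longrightarrow> ap (insert i S) j = g i j * ap S j"
  by (simp add: ap_def)

lemma q_inv: "1 / q = q * cc" using q0 by (simp add: cc_def power2_eq_square inverse_eq_divide)

text \<open>The numerator of \<open>g j i\<close> is q times \<gamma> j - cc \<gamma> i, so the
  product of the numerators is symmetric in \<open>i\<close> and \<open>j\<close>, while the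
  denominator changes sign.\<close>

lemma g_antisym_m:
  assumes "\<gamma> i - \<gamma> j \<noteq> 0"
  shows "(\<gamma> i - cc * \<gamma> j) * g j i + (\<gamma> j - cc * \<gamma> i) * g i j = 0"
proof -
  have s: "(\<gamma> i - cc * \<gamma> j) * (q * \<gamma> j - \<gamma> i / q) = (\<gamma> j - cc * \<gamma> i) * (q * \<gamma> i - \<gamma> j / q)"
    using q0 by (simp add: cc_def field_simps power2_eq_square)
  have "g j i = - ((q * \<gamma> j - \<gamma> i / q) / (\<gamma> i - \<gamma> j))"
    unfolding g_def by (metis minus_diff_eq minus_divide_right)
  then have "(\<gamma> i - cc * \<gamma> j) * g j i = - ((\<gamma> i - cc * \<gamma> j) * (q * \<gamma> j - \<gamma> i / q) / (\<gamma> i - \<gamma> j))" by simp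
  also have "\<dots> = - ((\<gamma> j - cc * \<gamma> i) * g i j)" unfolding s by (simp add: g_def)
  finally show ?thesis by simp
qed

lemma g_antisym_p:
  assumes "\<gamma> i - \<gamma> j \<noteq> 0"
  shows "(\<gamma> i - q^2 * \<gamma> j) * g i j + (\<gamma> j - q^2 * \<gamma> i) * g j i = 0"
proof -
  have s: "(\<gamma> i - q^2 * \<gamma> j) * (q * \<gamma> i - \<gamma> j / q) = (\<gamma> j - q^2 * \<gamma> i) * (q * \<gamma> j - \<gamma> i / q)"
    using q0 by (simp add: field_simps power2_eq_square)
  have "g j i = - ((q * \<gamma> j - \<gamma> i / q) / (\<gamma> i - \<gamma> j))"
    unfolding g_def by (metis minus_diff_eq minus_divide_right)
  then have "(\<gamma> j - q^2 * \<gamma> i) * g j i = - ((\<gamma> j - q^2 * \<gamma> i) * (q * \<gamma> j - \<gamma> i / q) / (\<gamma> i - \<gamma> j))" by simp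
  also have "\<dots> = - ((\<gamma> i - q^2 * \<gamma> j) * g i j)" unfolding s[symmetric] by (simp add: g_def)
  finally show ?thesis by simp
qed

lemma XM_XM:
  assumes "S \<subseteq> {..<k}"
  shows "app (\<rho> (XM a)) (app (\<rho> (XM b)) x) S
    = (\<Sum>i\<in>S. \<Sum>j\<in>S - {i}. \<gamma> i ^ a * \<gamma> j ^ b * g j i * (am S i * am S j * x (S - {i} - {j})))"
proof -
  have s: "S - {i} \<subseteq> {..<k}" for i using assms by auto
  show ?thesis using assms s
    by (simp add: app_mixop sum_distrib_left am_remove mult_ac cong: sum.cong)
qed

lemma app_XP:
  assumes "S \<subseteq> {..<k}"
  shows "app (\<rho> (XP t)) x S = (\<Sum>i\<in>{..<k} - S. \<beta> * \<gamma> i ^ t * ap S i * x (insert i S))"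
  using assms by (simp add: app_mixop)

lemma app_XM:
  assumes "S \<subseteq> {..<k}"
  shows "app (\<rho> (XM t)) x S = (\<Sum>i\<in>S. \<gamma> i ^ t * am S i * x (S - {i}))"
  using assms by (simp add: app_mixop)

lemma XP_XP:
  assumes "S \<subseteq> {..<k}"
  shows "app (\<rho> (XP a)) (app (\<rho> (XP b)) x) S
    = (\<Sum>i\<in>{..<k} - S. \<Sum>j\<in>{..<k} - S - {i}. \<gamma> i ^ a * \<gamma> j ^ b * g i j * (\<beta> * \<beta> * ap S i * ap S j * x (insert j (insert i S))))"
  unfolding app_XP[OF assms]
proof (rule sum.cong, rule refl)
  fix i assume i: "i \<in> {..<k} - S"
  have fin: "finite S" using assms finite_subset by blast
  have s: "insert i S \<subseteq> {..<k}" and ni: "i \<notin> S" using assms i by auto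
  have e: "{..<k} - insert i S = {..<k} - S - {i}" by auto
  show "\<beta> * \<gamma> i ^ a * ap S i * app (\<rho> (XP b)) x (insert i S)
    = (\<Sum>j\<in>{..<k} - S - {i}. \<gamma> i ^ a * \<gamma> j ^ b * g i j * (\<beta> * \<beta> * ap S i * ap S j * x (insert j (insert i S))))"
    unfolding app_XP[OF s] e sum_distrib_left ap_insert[OF fin ni]
    by (rule sum.cong) (simp_all only: mult_ac)
qed

lemma rel_XM:
  "\<rho> (XM (t+1)) * \<rho> (XM s) - sc (inverse q^2) * (\<rho> (XM s) * \<rho> (XM (t+1)))
    = sc (inverse q^2) * (\<rho> (XM t) * \<rho> (XM (s+1))) - \<rho> (XM (s+1)) * \<rho> (XM t)"
  unfolding lop_eq_iff
proof (intro allI)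
  fix x S
  let ?X = "\<lambda>a b. app (\<rho> (XM a)) (app (\<rho> (XM b)) x) S"
  have "?X (t+1) s - cc * ?X s (t+1) - (cc * ?X t (s+1) - ?X (s+1) t) = 0"
  proof (cases "S \<subseteq> {..<k}")
    case True
    \<comment> \<open>The part of the summand that is symmetric in \<open>i\<close> and
      \<open>j\<close>; what remains is antisymmetric by \<open>g_antisym_m\<close>.\<close>
    define W where "W i j = (\<gamma> i ^ t * \<gamma> j ^ s + \<gamma> i ^ s * \<gamma> j ^ t) * (am S i * am S j * x (S - {i} - {j}))" for i j
    have Wsym: "W i j = W j i" for i j
    proof -
      have "S - {i} - {j} = S - {j} - {i}" by auto
      then show ?thesis by (simp add: W_def mult_ac add_ac)
    qed
    have "?X (t+1) s - cc * ?X s (t+1) - (cc * ?X t (s+1) - ?X (s+1) t)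
       = (\<Sum>i\<in>S. \<Sum>j\<in>S - {i}. (\<gamma> i - cc * \<gamma> j) * g j i * W i j)"
      unfolding XM_XM[OF True] sum_distrib_left sum_subtractf[symmetric]
      by (intro sum.cong refl) (simp add: W_def algebra_simps)
    also have "\<dots> = 0"
    proof (rule sum_off_diagonal_antisym)
      show "finite S" using True finite_subset by blast
      fix i j assume "i \<in> S" "j \<in> S" "i \<noteq> j"
      then have "\<gamma> i - \<gamma> j \<noteq> 0" using True gam_ne by blast
      from g_antisym_m[OF this] show "(\<gamma> i - cc * \<gamma> j) * g j i * W i j + (\<gamma> j - cc * \<gamma> i) * g i j * W j i = 0"
        unfolding Wsym[of j i] by (simp flip: distrib_right)
    qed
    finally show ?thesis .
  qed (simp add: app_mixop)
  then show "app (\<rho> (XM (t+1)) * \<rho> (XM s) - sc (inverse q^2) * (\<rho> (XM s) * \<rho> (XM (t+1)))) x S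
    = app (sc (inverse q^2) * (\<rho> (XM t) * \<rho> (XM (s+1))) - \<rho> (XM (s+1)) * \<rho> (XM t)) x S"
    by (simp add: sm_apply cc_def fun_apply del: \<rho>.simps)
qed

lemma rel_XP:
  "\<rho> (XP (t+1)) * \<rho> (XP s) - sc (q^2) * (\<rho> (XP s) * \<rho> (XP (t+1)))
    = sc (q^2) * (\<rho> (XP t) * \<rho> (XP (s+1))) - \<rho> (XP (s+1)) * \<rho> (XP t)"
  unfolding lop_eq_iff
proof (intro allI)
  fix x S
  let ?X = "\<lambda>a b. app (\<rho> (XP a)) (app (\<rho> (XP b)) x) S"
  have "?X (t+1) s - q^2 * ?X s (t+1) - (q^2 * ?X t (s+1) - ?X (s+1) t) = 0"
  proof (cases "S \<subseteq> {..<k}")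
    case True
    define W where "W i j = (\<gamma> i ^ t * \<gamma> j ^ s + \<gamma> i ^ s * \<gamma> j ^ t) * (\<beta> * \<beta> * ap S i * ap S j * x (insert j (insert i S)))" for i j
    have Wsym: "W i j = W j i" for i j
      by (simp add: W_def mult_ac add_ac insert_commute)
    have "?X (t+1) s - q^2 * ?X s (t+1) - (q^2 * ?X t (s+1) - ?X (s+1) t)
       = (\<Sum>i\<in>{..<k} - S. \<Sum>j\<in>{..<k} - S - {i}. (\<gamma> i - q^2 * \<gamma> j) * g i j * W i j)"
      unfolding XP_XP[OF True] sum_distrib_left sum_subtractf[symmetric]
      by (intro sum.cong refl) (simp add: W_def algebra_simps)
    also have "\<dots> = 0"
    proof (rule sum_off_diagonal_antisym)
      show "finite ({..<k} - S)" by simp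
      fix i j assume "i \<in> {..<k} - S" "j \<in> {..<k} - S" "i \<noteq> j"
      then have "\<gamma> i - \<gamma> j \<noteq> 0" using gam_ne by blast
      from g_antisym_p[OF this] show "(\<gamma> i - q^2 * \<gamma> j) * g i j * W i j + (\<gamma> j - q^2 * \<gamma> i) * g j i * W j i = 0"
        unfolding Wsym[of j i] by (simp flip: distrib_right)
    qed
    finally show ?thesis .
  qed (simp add: app_mixop)
  then show "app (\<rho> (XP (t+1)) * \<rho> (XP s) - sc (q^2) * (\<rho> (XP s) * \<rho> (XP (t+1)))) x S
    = app (sc (q^2) * (\<rho> (XP t) * \<rho> (XP (s+1))) - \<rho> (XP (s+1)) * \<rho> (XP t)) x S"
    by (simp add: sm_apply fun_apply del: \<rho>.simps)
qed

section \<open>Eigenvalues of the \<open>J_t\<close> on the basis vectors\<close>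

definition qq :: "nat set \<Rightarrow> nat \<Rightarrow> complex" where "qq S j = (if j \<in> S then 1 / q else q)"

text \<open>Through \<open>qq\<close>, the contribution of one index to \<open>mu S\<close>, the two
  cases in \<open>bs\<close> become one formula, so that partial fractions can be treated for all
  \<open>S\<close> at once.\<close>

lemma bs_qq:
  assumes "i < k"
  shows "bs S i = (\<Prod>j\<in>{..<k} - {i}. (qq S j * \<gamma> i - \<gamma> j / qq S j) / (\<gamma> i - \<gamma> j))"
  unfolding bs_def
proof (rule prod.cong, rule refl)
  fix j assume j: "j \<in> {..<k} - {i}"
  have "g j i = (\<gamma> i / q - q * \<gamma> j) / (\<gamma> i - \<gamma> j)"
    unfolding g_def by (metis minus_diff_eq minus_divide_divide)
  then show "(if j \<in> S then g j i else g i j) = (qq S j * \<gamma> i - \<gamma> j / qq S j) / (\<gamma> i - \<gamma> j)"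
    using q0 by (simp add: qq_def g_def mult.commute)
qed

text \<open>Partial fractions for the eigenvalue of the series \<open>\<Sum> J\<^sub>t z\<^sup>t\<close> on a basis vector: both
  sides have the same leading coefficient and agree at the points \<open>1/\<gamma>\<^sub>i\<close>.\<close>

lemma partial_fractions:
  "smult (\<Prod>j<k. 1 / qq S j) (\<Prod>j<k. [:1, - \<gamma> j:])
    + (\<Sum>i<k. smult ((qq S i - 1 / qq S i) * bs S i) (\<Prod>j\<in>{..<k} - {i}. [:1, - \<gamma> j:]))
   = (\<Prod>j<k. [:qq S j, - \<gamma> j / qq S j:])"
proof -
  let ?l = "\<Prod>j<k. [:1, - \<gamma> j:]" and ?m = "\<lambda>i. \<Prod>j\<in>{..<k} - {i}. [:1, - \<gamma> j:]"
    and ?r = "\<Prod>j<k. [:qq S j, - \<gamma> j / qq S j:]"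
  let ?s = "\<Sum>i<k. smult ((qq S i - 1 / qq S i) * bs S i) (?m i)"
  define D where "D = smult (\<Prod>j<k. 1 / qq S j) ?l + ?s - ?r"
  have dm: "degree (?m i) < k" if "i < k" for i
  proof -
    have "degree (?m i) \<le> card ({..<k} - {i})" using coeff_prod_linear[of "{..<k} - {i}" "\<lambda>_. 1" "\<lambda>j. - \<gamma> j"] by simp
    then show ?thesis using that by simp
  qed
  have cm: "coeff ?s n = 0" if "n \<ge> k" for n
  proof -
    have "coeff (?m i) n = 0" if "i < k" for i
      by (rule coeff_eq_0[OF less_le_trans[OF dm[OF that] \<open>n \<ge> k\<close>]])
    then show ?thesis by (simp add: coeff_sum)
  qed
  have cl: "coeff ?l k = (\<Prod>j<k. - \<gamma> j)" "degree ?l \<le> k"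
    using coeff_prod_linear[of "{..<k}" "\<lambda>_. 1" "\<lambda>j. - \<gamma> j"] by auto
  have cr: "coeff ?r k = (\<Prod>j<k. - \<gamma> j / qq S j)" "degree ?r \<le> k"
    using coeff_prod_linear[of "{..<k}" "qq S" "\<lambda>j. - \<gamma> j / qq S j"] by auto
  have cD: "coeff D n = 0" if "n \<ge> k" for n
  proof (cases "n = k")
    case True
    have "(\<Prod>j<k. 1 / qq S j) * (\<Prod>j<k. - \<gamma> j) = (\<Prod>j<k. - \<gamma> j / qq S j)"
      by (simp flip: prod.distrib)
    then show ?thesis using cm[of k] cl cr by (simp add: D_def True)
  next
    case False
    then have "coeff ?l n = 0" "coeff ?r n = 0" using that cl cr by (auto intro!: coeff_eq_0)
    then show ?thesis using cm[OF that] by (simp add: D_def)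
  qed
  have root: "poly D (1 / \<gamma> i) = 0" if i: "i < k" for i
  proof -
    have gi: "\<gamma> i \<noteq> 0" by (rule nz[OF i])
    have l0: "poly ?l (1 / \<gamma> i) = 0"
      using i gi by (auto simp: poly_prod prod_zero_iff intro!: bexI[of _ i])
    have m0: "poly (?m n) (1 / \<gamma> i) = 0" if "n < k" "n \<noteq> i" for n
      using i gi that by (auto simp: poly_prod prod_zero_iff intro!: bexI[of _ i])
    have "poly ?s (1 / \<gamma> i) = (\<Sum>n<k. if n = i then (qq S i - 1 / qq S i) * bs S i * poly (?m i) (1 / \<gamma> i) else 0)"
      unfolding poly_sum by (intro sum.cong refl) (auto simp: m0)
    also have "\<dots> = (qq S i - 1 / qq S i) * (bs S i * poly (?m i) (1 / \<gamma> i))" using i by simp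
    also have "bs S i * poly (?m i) (1 / \<gamma> i) = (\<Prod>j\<in>{..<k} - {i}. qq S j - \<gamma> j / qq S j / \<gamma> i)"
      unfolding bs_qq[OF i] poly_prod prod.distrib[symmetric]
    proof (rule prod.cong, rule refl)
      fix j assume "j \<in> {..<k} - {i}"
      then have ne: "\<gamma> i - \<gamma> j \<noteq> 0" using i gam_ne by auto
      have e: "poly [:1, - \<gamma> j:] (1 / \<gamma> i) = (\<gamma> i - \<gamma> j) / \<gamma> i" using gi by (simp add: field_simps)
      have "X / (\<gamma> i - \<gamma> j) * ((\<gamma> i - \<gamma> j) / \<gamma> i) = X / \<gamma> i" for X
        using ne by (simp del: right_minus_eq)
      then have "(qq S j * \<gamma> i - \<gamma> j / qq S j) / (\<gamma> i - \<gamma> j) * poly [:1, - \<gamma> j:] (1 / \<gamma> i)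
         = (qq S j * \<gamma> i - \<gamma> j / qq S j) / \<gamma> i" unfolding e .
      also have "\<dots> = qq S j - \<gamma> j / qq S j / \<gamma> i" using gi by (simp add: diff_divide_distrib)
      finally show "(qq S j * \<gamma> i - \<gamma> j / qq S j) / (\<gamma> i - \<gamma> j) * poly [:1, - \<gamma> j:] (1 / \<gamma> i)
         = qq S j - \<gamma> j / qq S j / \<gamma> i" .
    qed
    also have "(qq S i - 1 / qq S i) * (\<Prod>j\<in>{..<k} - {i}. qq S j - \<gamma> j / qq S j / \<gamma> i) = poly ?r (1 / \<gamma> i)"
      unfolding poly_prod using i gi by (simp add: prod.remove[of "{..<k}" i] diff_divide_distrib mult.commute)
    finally show ?thesis using l0 by (simp add: D_def)
  qed
  have "D = 0"
  proof (rule ccontr)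
    assume D: "D \<noteq> 0"
    have "(\<lambda>i. 1 / \<gamma> i) ` {..<k} \<subseteq> {x. poly D x = 0}" using root by auto
    then have "card ((\<lambda>i. 1 / \<gamma> i) ` {..<k}) \<le> card {x. poly D x = 0}"
      by (intro card_mono poly_roots_finite[OF D])
    moreover have "inj_on (\<lambda>i. 1 / \<gamma> i) {..<k}" using inj by (auto simp: inj_on_def)
    ultimately have "k \<le> card {x. poly D x = 0}" by (simp add: card_image)
    also have "\<dots> \<le> degree D" by (rule card_poly_roots_bound[OF D])
    finally have "coeff D (degree D) = 0" by (rule cD)
    then show False using D by simp
  qed
  then show ?thesis by (simp add: D_def)
qed

lemma prod_qq:
  assumes "S \<subseteq> {..<k}"
  shows "(\<Prod>j<k. qq S j) = mu S"
proof -
  have "(\<Prod>j<k. qq S j) = (\<Prod>j<k. q * (if j \<in> S then cc else 1))"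
    by (intro prod.cong refl) (auto simp: qq_def q_inv)
  also have "\<dots> = q ^ k * (\<Prod>j\<in>{..<k}. if j \<in> S then cc else 1)" by (simp add: prod.distrib)
  also have "(\<Prod>j\<in>{..<k}. if j \<in> S then cc else 1) = (\<Prod>j\<in>S. cc)"
    using assms by (simp add: prod.If_cases Int_absorb1)
  finally show ?thesis by (simp add: mu_def)
qed

lemma qq_diff: "qq S i - 1 / qq S i = (if i \<in> S then -1 else 1) * (q - inverse q)"
  by (simp add: qq_def inverse_eq_divide)

text \<open>The identity \<open>partial_fractions\<close> evaluated at 0; it yields the relation
  between \<open>J_0\<close> and \<open>(K^-)^2\<close>.\<close>

lemma jj_0:
  assumes "S \<subseteq> {..<k}"
  shows "(q - inverse q) * jj 0 S = mu S - 1 / mu S"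
proof -
  have "poly (\<Prod>j<k. [:qq S j, - \<gamma> j / qq S j:]) 0 = mu S"
    by (simp add: poly_prod prod_qq[OF assms])
  moreover have "(\<Prod>j<k. 1 / qq S j) = 1 / mu S" using prod_qq[OF assms] by (simp add: prod_dividef)
  ultimately have "mu S = 1 / mu S + (\<Sum>i<k. (qq S i - 1 / qq S i) * bs S i)"
    unfolding partial_fractions[of S, symmetric] by (simp add: poly_prod poly_sum)
  also have "(\<Sum>i<k. (qq S i - 1 / qq S i) * bs S i) = (q - inverse q) * jj 0 S"
    unfolding qq_diff jj_def by (simp add: sum_distrib_left mult_ac)
  finally show ?thesis by (metis add_diff_cancel_left')
qed

lemma jn_0: "S \<subseteq> {..<k} \<Longrightarrow> (q - inverse q) * jn 0 S = 1 - 1 / mu S ^ 2"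
  unfolding jn_def times_divide_eq_right jj_0 using mu0[of S]
  by (simp add: diff_divide_distrib power2_eq_square)

text \<open>The two sides agree term by term. Removing \<open>i\<close> from \<open>S\<close>
  replaces \<open>g i j\<close> by \<open>g j i\<close> in \<open>bs S j\<close> for
  \<open>j \<noteq> i\<close>, and the linear factors in front compensate; for \<open>j = i\<close>
  the product is unchanged, and the change of sign is matched by that of the linear factor.\<close>

lemma jj_step:
  assumes S: "S \<subseteq> {..<k}" and i: "i \<in> S"
  shows "q * jj (n+1) S - \<gamma> i / q * jj n S = jj (n+1) (S - {i}) / q - q * \<gamma> i * jj n (S - {i})"
proof -
  let ?T = "S - {i}" and ?s = "\<lambda>S j. if j \<in> S then -1 else (1::complex)"
  have "q * jj (n+1) S - \<gamma> i / q * jj n S = (\<Sum>j<k. ?s S j * \<gamma> j ^ n * ((q * \<gamma> j - \<gamma> i / q) * bs S j))"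
    unfolding jj_def sum_distrib_left sum_subtractf[symmetric] by (intro sum.cong refl) (simp add: algebra_simps)
  also have "\<dots> = (\<Sum>j<k. ?s ?T j * \<gamma> j ^ n * ((\<gamma> j / q - q * \<gamma> i) * bs ?T j))"
  proof (rule sum.cong, rule refl)
    fix j assume "j \<in> {..<k}"
    then have j: "j < k" by simp
    show "?s S j * \<gamma> j ^ n * ((q * \<gamma> j - \<gamma> i / q) * bs S j) = ?s ?T j * \<gamma> j ^ n * ((\<gamma> j / q - q * \<gamma> i) * bs ?T j)"
    proof (cases "j = i")
      case True
      have "bs S i = bs ?T i" unfolding bs_def by (intro prod.cong) auto
      then show ?thesis using True i by (simp add: algebra_simps)
    next
      case False
      have ik: "i < k" using S i by auto
      let ?A = "{..<k} - {j} - {i}"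
      have rem: "bs T j = (if i \<in> T then g i j else g j i) * (\<Prod>l\<in>?A. if l \<in> T then g l j else g j l)" for T
        unfolding bs_def by (rule prod.remove) (use ik False in auto)
      define R where "R = (\<Prod>l\<in>?A. if l \<in> S then g l j else g j l)"
      have "bs S j = g i j * R" unfolding rem R_def using i by simp
      moreover have "bs ?T j = g j i * R"
      proof -
        have "(\<Prod>l\<in>?A. if l \<in> ?T then g l j else g j l) = R" unfolding R_def by (rule prod.cong) auto
        then show ?thesis unfolding rem by simp
      qed
      moreover have "(q * \<gamma> j - \<gamma> i / q) * g i j = (\<gamma> j / q - q * \<gamma> i) * g j i"
      proof -
        have "g i j = (\<gamma> j / q - q * \<gamma> i) / (\<gamma> j - \<gamma> i)"
          unfolding g_def by (metis minus_diff_eq minus_divide_divide)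
        then show ?thesis by (simp add: g_def)
      qed
      ultimately have "(q * \<gamma> j - \<gamma> i / q) * bs S j = (\<gamma> j / q - q * \<gamma> i) * bs ?T j" by simp
      then show ?thesis using False by simp
    qed
  qed
  also have "\<dots> = jj (n+1) ?T / q - q * \<gamma> i * jj n ?T"
    unfolding jj_def sum_distrib_left sum_divide_distrib sum_subtractf[symmetric]
    by (intro sum.cong refl) (simp add: algebra_simps)
  finally show ?thesis .
qed

lemma jn_step:
  assumes S: "S \<subseteq> {..<k}" and i: "i \<in> S"
  shows "jn (n+1) S - jn (n+1) (S - {i}) = \<gamma> i * (cc * jn n S - q^2 * jn n (S - {i}))"
proof -
  let ?T = "S - {i}"
  have fin: "finite S" using S finite_subset by blast
  have S': "jn m S = q^2 * jj m S / mu ?T" for m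
    using mu_remove[OF fin i] mu0 q0 by (simp add: jn_def cc_def field_simps)
  have "q^2 * jj (n+1) S - jj (n+1) ?T = q * (q * jj (n+1) S - jj (n+1) ?T / q)"
    using q0 by (simp add: field_simps power2_eq_square)
  also have "q * jj (n+1) S - jj (n+1) ?T / q = \<gamma> i / q * jj n S - q * \<gamma> i * jj n ?T"
    using jj_step[OF S i, of n] by (simp add: algebra_simps)
  also have "q * \<dots> = \<gamma> i * (jj n S - q^2 * jj n ?T)"
    using q0 by (simp add: field_simps power2_eq_square)
  finally have "(q^2 * jj (n+1) S - jj (n+1) ?T) / mu ?T = \<gamma> i * (cc * (q^2 * jj n S) - q^2 * jj n ?T) / mu ?T"
    by (simp flip: mult.assoc)
  then show ?thesis unfolding S' by (simp add: jn_def diff_divide_distrib right_diff_distrib)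
qed

lemma XP_XM_diag: "S \<subseteq> {..<k} \<Longrightarrow> i \<in> {..<k} - S \<Longrightarrow> ap S i * am (insert i S) i = bs S i"
proof -
  assume S: "S \<subseteq> {..<k}" and i: "i \<in> {..<k} - S"
  have A: "{..<k} - {i} = S \<union> ({..<k} - insert i S)" using S i by auto
  have "bs S i = (\<Prod>j\<in>S. g j i) * (\<Prod>j\<in>{..<k} - insert i S. g i j)"
    unfolding bs_def A using S finite_subset[OF S] by (subst prod.union_disjoint) (auto intro!: arg_cong2[of _ _ _ _ "(*)"] prod.cong)
  then show ?thesis by (simp add: ap_def am_def)
qed

lemma XM_XP_diag: "S \<subseteq> {..<k} \<Longrightarrow> i \<in> S \<Longrightarrow> am S i * ap (S - {i}) i = bs S i"
proof -
  assume S: "S \<subseteq> {..<k}" and i: "i \<in> S"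
  have A: "{..<k} - {i} = (S - {i}) \<union> ({..<k} - S)" using S i by auto
  have "bs S i = (\<Prod>j\<in>S - {i}. g j i) * (\<Prod>j\<in>{..<k} - S. g i j)"
    unfolding bs_def A using S finite_subset[OF S] by (subst prod.union_disjoint) (auto intro!: arg_cong2[of _ _ _ _ "(*)"] prod.cong)
  then show ?thesis by (simp add: ap_def am_def)
qed

lemma rel_XX: "\<rho> (XP t) * \<rho> (XM s) - \<rho> (XM s) * \<rho> (XP t) = \<rho> KP * \<rho> (JJ (s+t))"
  unfolding lop_eq_iff
proof (intro allI)
  fix x S
  show "app (\<rho> (XP t) * \<rho> (XM s) - \<rho> (XM s) * \<rho> (XP t)) x S = app (\<rho> KP * \<rho> (JJ (s+t))) x S"
  proof (cases "S \<subseteq> {..<k}")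
    case True
    have fin: "finite S" using True finite_subset by blast
    let ?N = "{..<k} - S"
    \<comment> \<open>The terms that exchange an element of \<open>S\<close> for one outside. Both
      orders of \<open>X^+_t\<close> and \<open>X^-_s\<close> produce them with equal coefficients,
      so only the diagonal terms survive in the commutator.\<close>
    define O1 where "O1 = (\<Sum>i\<in>?N. \<Sum>j\<in>S. \<beta> * \<gamma> i ^ t * \<gamma> j ^ s * ap S i * am (insert i S) j * x (insert i S - {j}))"
    have A: "app (\<rho> (XP t)) (app (\<rho> (XM s)) x) S = (\<Sum>i\<in>?N. \<beta> * \<gamma> i ^ (s + t) * bs S i * x S) + O1"
    proof -
      have "app (\<rho> (XP t)) (app (\<rho> (XM s)) x) S
         = (\<Sum>i\<in>?N. \<Sum>j\<in>insert i S. \<beta> * \<gamma> i ^ t * \<gamma> j ^ s * ap S i * am (insert i S) j * x (insert i S - {j}))"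
        unfolding app_XP[OF True]
      proof (rule sum.cong, rule refl)
        fix i assume "i \<in> ?N"
        then have s: "insert i S \<subseteq> {..<k}" using True by auto
        show "\<beta> * \<gamma> i ^ t * ap S i * app (\<rho> (XM s)) x (insert i S)
          = (\<Sum>j\<in>insert i S. \<beta> * \<gamma> i ^ t * \<gamma> j ^ s * ap S i * am (insert i S) j * x (insert i S - {j}))"
          unfolding app_XM[OF s] sum_distrib_left by (rule sum.cong) (simp_all only: mult_ac)
      qed
      also have "\<dots> = (\<Sum>i\<in>?N. \<beta> * \<gamma> i ^ t * \<gamma> i ^ s * (ap S i * am (insert i S) i) * x S
          + (\<Sum>j\<in>S. \<beta> * \<gamma> i ^ t * \<gamma> j ^ s * ap S i * am (insert i S) j * x (insert i S - {j})))"
      proof (rule sum.cong, rule refl)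
        fix i assume "i \<in> ?N"
        then have "insert i S - {i} = S" "i \<notin> S" by auto
        then show "(\<Sum>j\<in>insert i S. \<beta> * \<gamma> i ^ t * \<gamma> j ^ s * ap S i * am (insert i S) j * x (insert i S - {j}))
          = \<beta> * \<gamma> i ^ t * \<gamma> i ^ s * (ap S i * am (insert i S) i) * x S
          + (\<Sum>j\<in>S. \<beta> * \<gamma> i ^ t * \<gamma> j ^ s * ap S i * am (insert i S) j * x (insert i S - {j}))"
          using fin by (simp add: mult.assoc)
      qed
      finally show ?thesis unfolding O1_def using XP_XM_diag[OF True]
        by (simp add: sum.distrib power_add mult_ac)
    qed
    have B: "app (\<rho> (XM s)) (app (\<rho> (XP t)) x) S = (\<Sum>j\<in>S. \<beta> * \<gamma> j ^ (s + t) * bs S j * x S) + O1"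
    proof -
      have sub: "S - {j} \<subseteq> {..<k}" for j using True by auto
      have N: "{..<k} - (S - {j}) = insert j ?N" if "j \<in> S" for j using that True by auto
      have "app (\<rho> (XM s)) (app (\<rho> (XP t)) x) S
         = (\<Sum>j\<in>S. \<Sum>i\<in>insert j ?N. \<beta> * \<gamma> i ^ t * \<gamma> j ^ s * am S j * ap (S - {j}) i * x (insert i (S - {j})))"
        unfolding app_XM[OF True]
      proof (rule sum.cong, rule refl)
        fix j assume "j \<in> S"
        show "\<gamma> j ^ s * am S j * app (\<rho> (XP t)) x (S - {j})
          = (\<Sum>i\<in>insert j ?N. \<beta> * \<gamma> i ^ t * \<gamma> j ^ s * am S j * ap (S - {j}) i * x (insert i (S - {j})))"
          unfolding app_XP[OF sub] N[OF \<open>j \<in> S\<close>] sum_distrib_left by (rule sum.cong) (simp_all only: mult_ac)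
      qed
      also have "\<dots> = (\<Sum>j\<in>S. \<beta> * \<gamma> j ^ t * \<gamma> j ^ s * (am S j * ap (S - {j}) j) * x S
          + (\<Sum>i\<in>?N. \<beta> * \<gamma> i ^ t * \<gamma> j ^ s * ap S i * am (insert i S) j * x (insert i S - {j})))"
      proof (rule sum.cong, rule refl)
        fix j assume j: "j \<in> S"
        have 1: "insert j (S - {j}) = S" "j \<notin> ?N" using j by auto
        have 2: "am S j * ap (S - {j}) i = ap S i * am (insert i S) j \<and> insert i (S - {j}) = insert i S - {j}"
          if "i \<in> ?N" for i
        proof -
          have "i \<notin> S" "i < k" using that by auto
          then have "am S j = g j i * am (insert i S) j"
            using am_remove[of "insert i S" i j] True by simp
          moreover have "ap S i = g j i * ap (S - {j}) i"
            using ap_insert[of "S - {j}" j i] fin j by (simp add: insert_absorb)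
          moreover have "insert i (S - {j}) = insert i S - {j}" using \<open>i \<notin> S\<close> j by auto
          ultimately show ?thesis by simp
        qed
        have "(\<Sum>i\<in>insert j ?N. \<beta> * \<gamma> i ^ t * \<gamma> j ^ s * am S j * ap (S - {j}) i * x (insert i (S - {j})))
          = \<beta> * \<gamma> j ^ t * \<gamma> j ^ s * (am S j * ap (S - {j}) j) * x S
          + (\<Sum>i\<in>?N. \<beta> * \<gamma> i ^ t * \<gamma> j ^ s * (am S j * ap (S - {j}) i) * x (insert i (S - {j})))"
          using 1 by (simp add: mult.assoc)
        also have "(\<Sum>i\<in>?N. \<beta> * \<gamma> i ^ t * \<gamma> j ^ s * (am S j * ap (S - {j}) i) * x (insert i (S - {j})))
          = (\<Sum>i\<in>?N. \<beta> * \<gamma> i ^ t * \<gamma> j ^ s * ap S i * am (insert i S) j * x (insert i S - {j}))"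
        proof (rule sum.cong, rule refl)
          fix i assume "i \<in> ?N"
          note 2 = conjunct1[OF 2[OF this]] conjunct2[OF 2[OF this]]
          show "\<beta> * \<gamma> i ^ t * \<gamma> j ^ s * (am S j * ap (S - {j}) i) * x (insert i (S - {j}))
            = \<beta> * \<gamma> i ^ t * \<gamma> j ^ s * ap S i * am (insert i S) j * x (insert i S - {j})"
            unfolding 2 by (simp only: mult.assoc)
        qed
        finally show "(\<Sum>i\<in>insert j ?N. \<beta> * \<gamma> i ^ t * \<gamma> j ^ s * am S j * ap (S - {j}) i * x (insert i (S - {j})))
          = \<beta> * \<gamma> j ^ t * \<gamma> j ^ s * (am S j * ap (S - {j}) j) * x S
          + (\<Sum>i\<in>?N. \<beta> * \<gamma> i ^ t * \<gamma> j ^ s * ap S i * am (insert i S) j * x (insert i S - {j}))"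
          .
      qed
      finally show ?thesis unfolding O1_def using XM_XP_diag[OF True]
        by (subst sum.swap) (simp add: sum.distrib power_add mult_ac)
    qed
    have "(\<Sum>i<k. (if i \<in> S then -1 else 1) * \<gamma> i ^ (s + t) * bs S i)
        = (\<Sum>i\<in>S. - (\<gamma> i ^ (s + t) * bs S i)) + (\<Sum>i\<in>?N. \<gamma> i ^ (s + t) * bs S i)"
    proof -
      have "{..<k} = S \<union> ?N" using True by auto
      then have "(\<Sum>i<k. (if i \<in> S then -1 else 1) * \<gamma> i ^ (s + t) * bs S i)
        = (\<Sum>i\<in>S. (if i \<in> S then -1 else 1) * \<gamma> i ^ (s + t) * bs S i) + (\<Sum>i\<in>?N. (if i \<in> S then -1 else 1) * \<gamma> i ^ (s + t) * bs S i)"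
        using fin by (metis (no_types, lifting) Diff_disjoint finite_Diff finite_lessThan sum.union_disjoint)
      then show ?thesis by simp
    qed
    then have "jj (s + t) S = (\<Sum>i\<in>?N. \<gamma> i ^ (s + t) * bs S i) - (\<Sum>i\<in>S. \<gamma> i ^ (s + t) * bs S i)"
      unfolding jj_def by (simp add: sum_negf)
    then have "\<beta> * jj (s + t) S * x S = (\<Sum>i\<in>?N. \<beta> * \<gamma> i ^ (s + t) * bs S i * x S) - (\<Sum>j\<in>S. \<beta> * \<gamma> j ^ (s + t) * bs S j * x S)"
      by (simp add: right_diff_distrib left_diff_distrib sum_distrib_left sum_distrib_right mult.assoc)
    moreover have "app (\<rho> KP * \<rho> (JJ (s+t))) x S = \<beta> * jj (s + t) S * x S"
      using True mu0[of S] by (simp add: app_dop jn_def)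
    ultimately show ?thesis using A B by (simp add: fun_apply del: \<rho>.simps)
  qed (simp add: app_mixop app_dop fun_apply)
qed

lemma dop_mult: "dop d * dop e = dop (\<lambda>S. d S * e S)"
  by (rule lop_eqI) (simp add: fun_eq_iff app_dop)

lemma dop_one: "dop (\<lambda>_. 1) = 1"
  by (rule lop_eqI) (simp add: fun_eq_iff app_dop)

lemma mixop_cong:
  "(\<And>S i. i \<in> R S \<Longrightarrow> a S i = b S i) \<Longrightarrow> mixop R a f = mixop R b f"
  by (rule lop_eqI) (auto simp: fun_eq_iff app_mixop intro!: sum.cong)

lemma dop_mixop: "dop d * mixop R a f = mixop R (\<lambda>S i. d S * a S i) f"
  by (rule lop_eqI) (simp add: fun_eq_iff app_dop app_mixop sum_distrib_left mult.assoc)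

lemma mixop_dop: "mixop R a f * dop d = mixop R (\<lambda>S i. a S i * d (f S i)) f"
  by (rule lop_eqI) (simp add: fun_eq_iff app_dop app_mixop mult.assoc)

lemma mixop_lin:
  "mixop R a f - mixop R b f = mixop R (\<lambda>S i. a S i - b S i) f"
  "sc c * mixop R a f = mixop R (\<lambda>S i. c * a S i) f"
  by (rule lop_eqI; simp add: fun_eq_iff app_mixop sm_apply fun_apply sum_subtractf sum_distrib_left algebra_simps)+

lemma urep_\<rho>: "urep q \<rho>"
proof
  have b2: "\<beta> * (\<beta> * z) = z" for z using \<beta> by (simp flip: mult.assoc)
  show "\<rho> KP * \<rho> (JJ t) = \<rho> (JJ t) * \<rho> KP" for t by (simp add: dop_mult mult.commute)
  show "\<rho> (JJ s) * \<rho> (JJ t) = \<rho> (JJ t) * \<rho> (JJ s)" for s t by (simp add: dop_mult mult.commute)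
  have KK: "(if S \<subseteq> {..<k} then \<beta> * mu S else 1) * (if S \<subseteq> {..<k} then \<beta> / mu S else 1) = 1" for S
    using mu0[of S] \<beta> by simp
  show "\<rho> KP * \<rho> KM = 1" by (simp only: \<rho>.simps dop_mult KK dop_one)
  show "\<rho> KM * \<rho> KP = 1" by (simp only: \<rho>.simps dop_mult mult.commute[of "if _ then \<beta> / _ else _"] KK dop_one)
  show "\<rho> KM * \<rho> KM = 1 - sc (q - inverse q) * \<rho> (JJ 0)"
    unfolding lop_eq_iff
  proof (intro allI)
    fix x S
    show "app (\<rho> KM * \<rho> KM) x S = app (1 - sc (q - inverse q) * \<rho> (JJ 0)) x S"
    proof (cases "S \<subseteq> {..<k}")
      case True
      have "app (1 - sc (q - inverse q) * \<rho> (JJ 0)) x S = (1 - (q - inverse q) * jn 0 S) * x S"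
        using True by (simp add: app_dop fun_apply sm_apply left_diff_distrib)
      then show ?thesis using True b2 jn_0[OF True] by (simp add: app_dop power2_eq_square)
    qed (simp add: app_dop fun_apply sm_apply)
  qed
  show "\<rho> (XP (t+1)) * \<rho> (XP s) - sc (q^2) * (\<rho> (XP s) * \<rho> (XP (t+1)))
            = sc (q^2) * (\<rho> (XP t) * \<rho> (XP (s+1))) - \<rho> (XP (s+1)) * \<rho> (XP t)" for s t by (rule rel_XP)
  show "\<rho> (XM (t+1)) * \<rho> (XM s) - sc (inverse q^2) * (\<rho> (XM s) * \<rho> (XM (t+1)))
            = sc (inverse q^2) * (\<rho> (XM t) * \<rho> (XM (s+1))) - \<rho> (XM (s+1)) * \<rho> (XM t)" for s t by (rule rel_XM)
  have fin: "finite S" if "S \<subseteq> {..<k}" for S using that finite_subset by blast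
  have P: "insert i S \<subseteq> {..<k}" "mu (insert i S) = cc * mu S" "i \<notin> S" "i < k" "S \<subseteq> {..<k}"
    if "i \<in> (if S \<subseteq> {..<k} then {..<k} - S else {})" for S i
    using that mu_insert[OF fin, of S i] by (auto split: if_splits)
  have M: "S - {i} \<subseteq> {..<k}" "mu S = cc * mu (S - {i})" "i \<in> S" "S \<subseteq> {..<k}"
    if "i \<in> (if S \<subseteq> {..<k} then S else {})" for S i
    using that mu_remove[OF fin, of S i] by (auto split: if_splits)
  have ci: "1 / cc = q^2" by (simp add: divide_eq_eq)
  show "\<rho> KP * \<rho> (XP t) * \<rho> KM = sc (q^2) * \<rho> (XP t)" for t
    unfolding \<rho>.simps dop_mixop mixop_dop mixop_lin
  proof (rule mixop_cong)
    fix S i assume "i \<in> (if S \<subseteq> {..<k} then {..<k} - S else {})"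
    note p = P[OF this]
    have "\<beta> * mu S * (\<beta> * \<gamma> i ^ t * ap S i) * (\<beta> / mu (insert i S)) = (\<beta> * \<beta>) * (mu S / mu (insert i S)) * (\<beta> * \<gamma> i ^ t * ap S i)"
      by simp
    also have "mu S / mu (insert i S) = q^2" using p(2) mu0[of S] ci by simp
    finally show "(if S \<subseteq> {..<k} then \<beta> * mu S else 1) * (\<beta> * \<gamma> i ^ t * ap S i) * (if insert i S \<subseteq> {..<k} then \<beta> / mu (insert i S) else 1)
      = q^2 * (\<beta> * \<gamma> i ^ t * ap S i)" using p(1,5) \<beta> by (simp only: if_True mult_1_left)
  qed
  show "\<rho> KP * \<rho> (XM t) * \<rho> KM = sc (inverse q^2) * \<rho> (XM t)" for t
    unfolding \<rho>.simps dop_mixop mixop_dop mixop_lin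
  proof (rule mixop_cong)
    fix S i assume "i \<in> (if S \<subseteq> {..<k} then S else {})"
    note m = M[OF this]
    have "\<beta> * mu S * (\<gamma> i ^ t * am S i) * (\<beta> / mu (S - {i})) = (\<beta> * \<beta>) * (mu S / mu (S - {i})) * (\<gamma> i ^ t * am S i)"
      by simp
    also have "mu S / mu (S - {i}) = cc" using m(2) mu0 by simp
    finally show "(if S \<subseteq> {..<k} then \<beta> * mu S else 1) * (\<gamma> i ^ t * am S i) * (if S - {i} \<subseteq> {..<k} then \<beta> / mu (S - {i}) else 1)
      = inverse q^2 * (\<gamma> i ^ t * am S i)" using m(1,4) \<beta> by (simp add: cc_def)
  qed
  have qb: "qbr q 2 = (q^2 - cc) / (q - inverse q)" by (simp add: qbr_def cc_def)
  have jn0: "jn 0 S = (1 - 1 / mu S ^ 2) / (q - inverse q)" if "S \<subseteq> {..<k}" for S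
    using jn_0[OF that] qd by (simp add: field_simps)
  \<comment> \<open>Stated for two sets whose sizes differ by one, to serve both signs: the parts
    with \<open>1 / mu S ^ 2\<close> cancel and the constants leave \<open>qbr q 2\<close>.\<close>
  have J0: "q^2 * jn 0 S - cc * jn 0 T = qbr q 2" if "S \<subseteq> {..<k}" "T \<subseteq> {..<k}" "mu T = cc * mu S" for S T
  proof -
    have "cc * (1 / mu T ^ 2) = q^2 * (1 / mu S ^ 2)"
      using mu0[of S] cc0 ci by (simp add: that(3) power2_eq_square field_simps)
    then show ?thesis unfolding jn0[OF that(1)] jn0[OF that(2)] qb
      by (simp add: right_diff_distrib flip: diff_divide_distrib)
  qed
  show "sc (q^2) * (\<rho> (JJ 0) * \<rho> (XP t)) - sc (inverse q^2) * (\<rho> (XP t) * \<rho> (JJ 0)) = sc (qbr q 2) * \<rho> (XP t)" for t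
    unfolding \<rho>.simps dop_mixop mixop_dop mixop_lin
  proof (rule mixop_cong)
    fix S i assume "i \<in> (if S \<subseteq> {..<k} then {..<k} - S else {})"
    note p = P[OF this]
    have "(q^2 * jn 0 S - cc * jn 0 (insert i S)) * (\<beta> * \<gamma> i ^ t * ap S i) = qbr q 2 * (\<beta> * \<gamma> i ^ t * ap S i)"
      by (simp only: J0[OF p(5,1,2)])
    then show "q^2 * ((if S \<subseteq> {..<k} then jn 0 S else 0) * (\<beta> * \<gamma> i ^ t * ap S i))
       - inverse q^2 * (\<beta> * \<gamma> i ^ t * ap S i * (if insert i S \<subseteq> {..<k} then jn 0 (insert i S) else 0))
       = qbr q 2 * (\<beta> * \<gamma> i ^ t * ap S i)"
      using p(1,5) by (simp add: cc_def algebra_simps)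
  qed
  show "sc (inverse q^2) * (\<rho> (JJ 0) * \<rho> (XM t)) - sc (q^2) * (\<rho> (XM t) * \<rho> (JJ 0)) = sc (- qbr q 2) * \<rho> (XM t)" for t
    unfolding \<rho>.simps dop_mixop mixop_dop mixop_lin
  proof (rule mixop_cong)
    fix S i assume "i \<in> (if S \<subseteq> {..<k} then S else {})"
    note m = M[OF this]
    have "(q^2 * jn 0 (S - {i}) - cc * jn 0 S) * (\<gamma> i ^ t * am S i) = qbr q 2 * (\<gamma> i ^ t * am S i)"
      by (simp only: J0[OF m(1,4,2)])
    then show "inverse q^2 * ((if S \<subseteq> {..<k} then jn 0 S else 0) * (\<gamma> i ^ t * am S i))
       - q^2 * (\<gamma> i ^ t * am S i * (if S - {i} \<subseteq> {..<k} then jn 0 (S - {i}) else 0))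
       = - qbr q 2 * (\<gamma> i ^ t * am S i)"
      using m(1,4) by (simp add: cc_def algebra_simps)
  qed
  show "\<rho> (JJ (s+1)) * \<rho> (XP t) - \<rho> (XP t) * \<rho> (JJ (s+1))
            = sc (q^2) * (\<rho> (JJ s) * \<rho> (XP (t+1))) - sc (inverse q^2) * (\<rho> (XP (t+1)) * \<rho> (JJ s))" for s t
    unfolding \<rho>.simps dop_mixop mixop_dop mixop_lin
  proof (rule mixop_cong)
    fix S i assume "i \<in> (if S \<subseteq> {..<k} then {..<k} - S else {})"
    note p = P[OF this]
    have "insert i S - {i} = S" using p(3) by auto
    then have "jn (s+1) S - jn (s+1) (insert i S) = \<gamma> i * (q^2 * jn s S - cc * jn s (insert i S))"
      using jn_step[OF p(1), of i s] by (simp add: algebra_simps)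
    then have "(jn (s+1) S - jn (s+1) (insert i S)) * (\<beta> * \<gamma> i ^ t * ap S i)
       = \<gamma> i * (q^2 * jn s S - cc * jn s (insert i S)) * (\<beta> * \<gamma> i ^ t * ap S i)" by simp
    then show "(if S \<subseteq> {..<k} then jn (s+1) S else 0) * (\<beta> * \<gamma> i ^ t * ap S i)
       - \<beta> * \<gamma> i ^ t * ap S i * (if insert i S \<subseteq> {..<k} then jn (s+1) (insert i S) else 0)
       = q^2 * ((if S \<subseteq> {..<k} then jn s S else 0) * (\<beta> * \<gamma> i ^ (t+1) * ap S i))
       - inverse q^2 * (\<beta> * \<gamma> i ^ (t+1) * ap S i * (if insert i S \<subseteq> {..<k} then jn s (insert i S) else 0))"
      using p(1,5) by (simp add: cc_def algebra_simps)
  qed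
  show "\<rho> (JJ (s+1)) * \<rho> (XM t) - \<rho> (XM t) * \<rho> (JJ (s+1))
            = sc (inverse q^2) * (\<rho> (JJ s) * \<rho> (XM (t+1))) - sc (q^2) * (\<rho> (XM (t+1)) * \<rho> (JJ s))" for s t
    unfolding \<rho>.simps dop_mixop mixop_dop mixop_lin
  proof (rule mixop_cong)
    fix S i assume "i \<in> (if S \<subseteq> {..<k} then S else {})"
    note m = M[OF this]
    have "(jn (s+1) S - jn (s+1) (S - {i})) * (\<gamma> i ^ t * am S i)
       = \<gamma> i * (cc * jn s S - q^2 * jn s (S - {i})) * (\<gamma> i ^ t * am S i)"
      using jn_step[OF m(4,3), of s] by simp
    then show "(if S \<subseteq> {..<k} then jn (s+1) S else 0) * (\<gamma> i ^ t * am S i)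
       - \<gamma> i ^ t * am S i * (if S - {i} \<subseteq> {..<k} then jn (s+1) (S - {i}) else 0)
       = inverse q^2 * ((if S \<subseteq> {..<k} then jn s S else 0) * (\<gamma> i ^ (t+1) * am S i))
       - q^2 * (\<gamma> i ^ (t+1) * am S i * (if S - {i} \<subseteq> {..<k} then jn s (S - {i}) else 0))"
      using m(1,4) by (simp add: cc_def algebra_simps)
  qed
  show "\<rho> (XP t) * \<rho> (XM s) - \<rho> (XM s) * \<rho> (XP t) = \<rho> KP * \<rho> (JJ (s+t))" for s t by (rule rel_XX)
qed

definition vac :: "nat set \<Rightarrow> complex" where "vac S = (if S = {} then 1 else 0)"

text \<open>On the empty set all \<open>qq\<close> equal \<open>q\<close>. Dividing
  \<open>partial_fractions\<close> by the product of the 1 - \<gamma> z expresses the eigenvalue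
  series through geometric series, and the right-hand side is \<open>q ^ k\<close> times the product
  at z/q^2.\<close>

lemma drel_vac: "drel (uhat (\<lambda>n. jn n {})) (\<Prod>i<k. fps_of_poly [:1, - \<gamma> i:])"
proof -
  let ?d = "q - inverse q" and ?P = "\<Prod>i<k. fps_of_poly [:1, - \<gamma> i:]"
  let ?m = "\<lambda>i. \<Prod>j\<in>{..<k} - {i}. fps_of_poly [:1, - \<gamma> j:]"
  let ?geo = "\<lambda>i. Abs_fps (\<lambda>n. \<gamma> i ^ n)"
  have lin: "fps_of_poly [:1, - a:] = 1 - fps_const a * fps_X" for a :: complex
    by (rule fps_ext) (auto simp: coeff_pCons split: nat.splits)
  have geo: "?geo i * fps_of_poly [:1, - \<gamma> i:] = 1" for i
  proof (rule fps_ext)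
    fix n show "fps_nth (?geo i * fps_of_poly [:1, - \<gamma> i:]) n = fps_nth 1 n"
      unfolding lin by (cases n) (simp_all add: right_diff_distrib mult.left_commute)
  qed
  have mu: "mu {} = q ^ k" by (simp add: mu_def)
  have qq: "qq {} j = q" for j by (simp add: qq_def)
  have pf: "fps_const (1 / q ^ k) * ?P + (\<Sum>i<k. fps_const (?d * bs {} i) * ?m i) = (\<Prod>j<k. fps_of_poly [:q, - \<gamma> j / q:])"
    using arg_cong[OF partial_fractions[of "{}"], of fps_of_poly]
    by (simp add: fps_of_poly_add fps_of_poly_smult fps_of_poly_prod fps_of_poly_sum qq inverse_eq_divide power_one_over)
  have r: "(\<Prod>j<k. fps_of_poly [:q, - \<gamma> j / q:]) = fps_const (q ^ k) * csc ?P"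
  proof -
    have "fps_of_poly [:q, - \<gamma> j / q:] = fps_const q * csc (fps_of_poly [:1, - \<gamma> j:])" for j
      by (rule fps_ext) (auto simp: coeff_pCons cc_def power2_eq_square inverse_eq_divide split: nat.splits)
    moreover have "csc (\<Prod>j\<in>A. F j) = (\<Prod>j\<in>A. csc (F j))" for A :: "nat set" and F
      by (induction A rule: infinite_finite_induct) (simp_all add: csc_1 csc_mult)
    moreover have "fps_const q ^ k = fps_const (q ^ k)" by (rule fps_const_power)
    ultimately show ?thesis by (simp add: prod.distrib)
  qed
  have u: "uhat (\<lambda>n. jn n {}) = fps_const (1 / q ^ k) * (fps_const (1 / q ^ k) + (\<Sum>i<k. fps_const (?d * bs {} i) * ?geo i))"
  proof (rule fps_ext)
    fix n
    have s: "fps_nth (\<Sum>i<k. fps_const (?d * bs {} i) * ?geo i) n = ?d * jj n {}"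
      by (simp add: fps_sum_nth jj_def sum_distrib_left mult_ac)
    have r: "fps_nth (fps_const (1 / q ^ k) * (fps_const (1 / q ^ k) + (\<Sum>i<k. fps_const (?d * bs {} i) * ?geo i))) n
      = 1 / q ^ k * ((if n = 0 then 1 / q ^ k else 0) + ?d * jj n {})"
      by (simp only: fps_mult_left_const_nth fps_add_nth fps_nth_fps_const s)
    show "fps_nth (uhat (\<lambda>n. jn n {})) n
      = fps_nth (fps_const (1 / q ^ k) * (fps_const (1 / q ^ k) + (\<Sum>i<k. fps_const (?d * bs {} i) * ?geo i))) n"
      unfolding r
    proof (cases "n = 0")
      \<comment> \<open>In degree 0 the series has the constant 1 by definition; \<open>jj_0\<close>
        shows that the partial fractions produce the same value.\<close>
      case True
      have "?d * jj 0 {} = q ^ k - 1 / q ^ k" using jj_0[of "{}"] mu by simp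
      then have "1 / q ^ k * ((if n = 0 then 1 / q ^ k else 0) + ?d * jj n {}) = 1 / q ^ k * (1 / q ^ k + (q ^ k - 1 / q ^ k))"
        by (simp only: True simp_thms if_True)
      then show "fps_nth (uhat (\<lambda>n. jn n {})) n = 1 / q ^ k * ((if n = 0 then 1 / q ^ k else 0) + ?d * jj n {})"
        using q0 True by (simp only:) (simp add: uhat_def)
    next
      case False
      then show "fps_nth (uhat (\<lambda>n. jn n {})) n = 1 / q ^ k * ((if n = 0 then 1 / q ^ k else 0) + ?d * jj n {})"
        by (simp add: uhat_def jn_def mu)
    qed
  qed
  have gm: "?geo i * ?P = ?m i" if "i < k" for i
  proof -
    have "?P = fps_of_poly [:1, - \<gamma> i:] * ?m i" using that by (simp add: prod.remove[of "{..<k}" i])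
    then show ?thesis using geo[of i] by (simp flip: mult.assoc)
  qed
  have "uhat (\<lambda>n. jn n {}) * ?P = fps_const (1 / q ^ k) * (fps_const (1 / q ^ k) * ?P + (\<Sum>i<k. fps_const (?d * bs {} i) * (?geo i * ?P)))"
    unfolding u by (simp only: distrib_right sum_distrib_right mult.assoc)
  also have "(\<Sum>i<k. fps_const (?d * bs {} i) * (?geo i * ?P)) = (\<Sum>i<k. fps_const (?d * bs {} i) * ?m i)"
    by (rule sum.cong) (auto simp: gm)
  also have "fps_const (1 / q ^ k) * (fps_const (1 / q ^ k) * ?P + \<dots>) = fps_const (1 / q ^ k * q ^ k) * csc ?P"
    unfolding pf r by (simp only: mult.assoc[symmetric] fps_const_mult)
  also have "\<dots> = csc ?P" using q0 by simp
  finally have "uhat (\<lambda>n. jn n {}) * ?P = csc ?P" .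
  moreover have "fps_nth (\<Prod>i\<in>A. fps_of_poly [:1, - \<gamma> i:]) 0 = 1" for A
    by (induction A rule: infinite_finite_induct) simp_all
  ultimately show ?thesis by (simp add: drel_def)
qed

lemma hw_vac: "hw \<rho> (\<beta> * q ^ k, \<lambda>t. p_poly t q (map \<gamma> [0..<k])) vac"
proof -
  have "drel (prod_list (map rootfac (map \<gamma> [0..<k]))) (\<Prod>g\<leftarrow>map \<gamma> [0..<k]. fps_of_poly [:1, - g:])"
    by (rule drel_prod_list)
  also have "(\<Prod>g\<leftarrow>map \<gamma> [0..<k]. fps_of_poly [:1, - g:]) = (\<Prod>i<k. fps_of_poly [:1, - \<gamma> i:])"
    by (simp add: o_def prod.distinct_set_conv_list[symmetric] atLeast0LessThan)
  finally have "uhat (\<lambda>n. jn n {}) = prod_list (map rootfac (map \<gamma> [0..<k]))"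
    using drel_unique_left[OF drel_vac] by simp
  then have e: "fps_nth (uhat (\<lambda>n. jn n {})) t = fps_nth (prod_list (map rootfac (map \<gamma> [0..<k]))) t" for t
    by (simp only:)
  have "(q - inverse q) * jn t {} = (q - inverse q) * p_poly t q (map \<gamma> [0..<k])" if "t > 0" for t
    unfolding p_poly_gen_fun[OF that] e[symmetric] using that by (simp add: uhat_def)
  then have j: "jn t {} = p_poly t q (map \<gamma> [0..<k])" if "t > 0" for t
    using that qd by simp
  have "vac {} = 1" by (simp add: vac_def)
  then have "vac \<noteq> 0" by (auto simp: fun_apply)
  moreover have "app (\<rho> (XP t)) vac = 0" for t
    by (auto simp: fun_eq_iff app_mixop vac_def fun_apply intro!: sum.neutral)
  moreover have "app (\<rho> KP) vac = sm (\<beta> * q ^ k) vac"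
    by (auto simp: fun_eq_iff app_dop vac_def sm_def mu_def)
  moreover have "app (\<rho> (JJ t)) vac = sm (p_poly t q (map \<gamma> [0..<k])) vac" if "t > 0" for t
    using j[OF that] by (auto simp: fun_eq_iff app_dop vac_def sm_def)
  ultimately show ?thesis by (simp add: hw_def)
qed

end

section \<open>Limits of generic modules\<close>

lemma common_convergent_subsequence:
  fixes c :: "nat \<Rightarrow> nat \<Rightarrow> complex"
  assumes "\<And>m i. cmod (c m i) \<le> B"
  shows "\<exists>r d. strict_mono r \<and> (\<forall>i<D. (\<lambda>m. c (r m) i) \<longlonglongrightarrow> d i)"
proof (induction D)
  case 0
  show ?case by (intro exI[of _ id]) (auto simp: strict_mono_def)
next
  case (Suc D)
  then obtain r d where r: "strict_mono r" "\<And>i. i < D \<Longrightarrow> (\<lambda>m. c (r m) i) \<longlonglongrightarrow> d i" by blast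
  obtain f :: "nat \<Rightarrow> nat" and l where f: "strict_mono f" "\<forall>e>0. \<exists>N. \<forall>n\<ge>N. cmod (c (r (f n)) D - l) < e"
    using Bolzano_Weierstrass_complex_disc[of "\<lambda>n. c (r n) D" B, OF allI[OF assms]] by blast
  have "(\<lambda>m. c (r (f m)) i) \<longlonglongrightarrow> (if i < D then d i else l)" if "i < Suc D" for i
  proof (cases "i < D")
    case True
    then show ?thesis using LIMSEQ_subseq_LIMSEQ[OF r(2)[OF True] f(1)] by (simp add: o_def)
  next
    case False
    then have "i = D" using that by simp
    then show ?thesis using f(2) by (simp add: lim_sequentially dist_norm)
  qed
  moreover have "strict_mono (\<lambda>m. r (f m))" using strict_mono_o[OF r(1) f(1)] by (simp add: o_def)
  ultimately show ?case by (intro exI[of _ "\<lambda>m. r (f m)"] exI[of _ "\<lambda>i. if i < D then d i else l"]) simp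
qed

text \<open>For the least bound \<open>n\<close> there are \<open>n\<close> independent vectors. A
  relation between them and a further vector must involve that vector, so they span.\<close>

lemma basis_of_dimle:
  assumes W: "subsp W" "dimle W D"
  obtains n e where "\<And>j. j < n \<Longrightarrow> e j \<in> W"
    "\<And>x. x \<in> W \<Longrightarrow> \<exists>y\<in>Vn n. x = (\<Sum>j<n. sm (y j) (e j))"
    "\<And>y. y \<in> Vn n \<Longrightarrow> (\<Sum>j<n. sm (y j) (e j)) = 0 \<Longrightarrow> y = 0"
proof -
  obtain n where n: "dimle W n" "\<And>m. m < n \<Longrightarrow> \<not> dimle W m"
    using exists_least_iff[of "dimle W"] W(2) by blast
  show ?thesis
  proof (cases n)
    case 0
    have "W = {0}" using dimle_0[OF W(1)] n(1) 0 by simp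
    then show ?thesis using that[of 0 "\<lambda>_. 0"] subsp_Vn[of 0]
      by (auto simp: Vn_def fun_eq_iff fun_apply)
  next
    case (Suc m)
    then have "\<not> dimle W m" using n(2) by simp
    then obtain e where e: "\<forall>i\<le>m. e i \<in> W" "\<And>c. (\<exists>i\<le>m. c i \<noteq> 0) \<Longrightarrow> (\<Sum>i\<le>m. sm (c i) (e i)) \<noteq> 0"
      unfolding dimle_def by blast
    have lt: "{..<n} = {..m}" by (simp add: Suc lessThan_Suc_atMost)
    show ?thesis
    proof (rule that[of n e])
      show "e j \<in> W" if "j < n" for j using e(1) that Suc by simp
      show "y = 0" if y: "y \<in> Vn n" "(\<Sum>j<n. sm (y j) (e j)) = 0" for y
      proof -
        have "y i = 0" if "i \<le> m" for i using e(2)[of y] y(2) that unfolding lt by blast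
        then have "y i = 0" for i using y(1) Suc by (cases "i \<le> m") (auto simp: Vn_def)
        then show ?thesis by (simp add: fun_eq_iff fun_apply)
      qed
      show "\<exists>y\<in>Vn n. x = (\<Sum>j<n. sm (y j) (e j))" if x: "x \<in> W" for x
      proof -
        have "(if i \<le> m then e i else x) \<in> W" for i using e x by auto
        then obtain c where c: "\<exists>i\<le>Suc m. c i \<noteq> 0" "(\<Sum>i\<le>Suc m. sm (c i) (if i \<le> m then e i else x)) = 0"
          using dimleD[OF n(1)[unfolded Suc], of "\<lambda>i. if i \<le> m then e i else x"] by blast
        have s: "(\<Sum>i\<le>m. sm (c i) (e i)) + sm (c (Suc m)) x = 0" using c(2) by simp
        have cn: "c (Suc m) \<noteq> 0"
        proof
          assume z: "c (Suc m) = 0"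
          then have "(\<Sum>i\<le>m. sm (c i) (e i)) = 0" using s by simp
          then have "\<forall>i\<le>m. c i = 0" using e(2)[of c] by blast
          then show False using c(1) z by (auto simp: le_Suc_eq)
        qed
        define y where "y i = (if i \<le> m then - c i / c (Suc m) else 0)" for i
        have "(\<Sum>j<n. sm (y j) (e j)) = sm (- 1 / c (Suc m)) (\<Sum>i\<le>m. sm (c i) (e i))"
          unfolding lt sm_sum by (rule sum.cong) (auto simp: y_def)
        also have "(\<Sum>i\<le>m. sm (c i) (e i)) = - sm (c (Suc m)) x" using s by (simp add: eq_neg_iff_add_eq_0)
        also have "sm (- 1 / c (Suc m)) \<dots> = x" using cn by (simp add: sm_minus_left)
        finally have "x = (\<Sum>j<n. sm (y j) (e j))" ..
        moreover have "y \<in> Vn n" by (auto simp: Vn_def y_def Suc)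
        ultimately show ?thesis by blast
      qed
    qed
  qed
qed

text \<open>If \<open>f b\<close> is a matrix coefficient of the word \<open>b\<close> at
  \<open>x\<close>, then appending \<open>g\<close>, the operator applied first, gives the
  coefficient at \<open>g x\<close>. On arbitrary functions the defining relations fail; they are
  recovered on the space of limits.\<close>

lift_definition rtr :: "gen \<Rightarrow> gen list lop" is "\<lambda>g f b. f (b @ [g])"
  by (simp add: fun_eq_iff fun_apply sm_def)

lemma app_rtr: "app (rtr g) f b = f (b @ [g])"
  by (simp add: rtr.rep_eq)

text \<open>The limit of a sequence of highest weight modules: it is realised on functions of words in
  the generators, a vector \<open>x\<close> being replaced by its matrix coefficients
  \<open>b \<mapsto> lim (b x)\<^sub>z\<close>, and \<open>z\<close> is the coordinate of the highest weight vectors.\<close>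

locale limfam = hwfam q \<rho> v lam u "{c. convergent c}" for q
    and \<rho> :: "nat \<Rightarrow> gen \<Rightarrow> 'i lop" and v and lam and u +
  fixes z :: 'i and A :: "'i set"
  assumes vz: "\<And>m. v m z = 1" and zK: "\<And>m x. app (\<rho> m KP) x z = lam * x z"
    and A: "finite A" "\<And>m. stable (\<rho> m) {x. \<forall>i. i \<notin> A \<longrightarrow> x i = 0}" "\<And>m i. i \<notin> A \<Longrightarrow> v m i = 0"
begin

definition wd :: "nat \<Rightarrow> gen list \<Rightarrow> 'i lop" where
  "wd m b = prod_list (map (\<rho> m) b)"

lemma G_wd: "x \<in> G \<Longrightarrow> (\<lambda>m. app (wd m b) (x m)) \<in> G"
  by (induction b) (auto simp: wd_def intro: G_gen)

text \<open>By \<open>zK\<close> the coordinate \<open>z\<close> vanishes on all weights except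
  \<open>lam\<close>, so it reads off the top coefficient. This coefficient lies in the ring of
  convergent sequences, which is why every matrix coefficient has a limit.\<close>

lemma wdec_z:
  assumes w: "wdec x c N xs"
  shows "x m z = c m"
proof -
  have "xs j m z = 0" if "j > 0" for j
  proof -
    have "lam * xs j m z = lam * cc ^ j * xs j m z"
      using zK[of m "xs j m"] w by (simp add: wdec_def sm_apply)
    then show ?thesis using lam cc_pow_ne1[OF that] by simp
  qed
  then have "(\<Sum>j\<le>N. xs j m) z = (\<Sum>j\<le>N. if j = 0 then xs 0 m z else 0)"
    unfolding sum_fun_apply by (intro sum.cong) auto
  then show ?thesis using w vz[of m] by (simp add: wdec_def sm_apply)
qed

lemma conv_z: "x \<in> G \<Longrightarrow> convergent (\<lambda>m. x m z)"
  using G_wdec[of x] wdec_z by (force simp: wdec_def)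

definition Phi :: "(nat \<Rightarrow> 'i \<Rightarrow> complex) \<Rightarrow> gen list \<Rightarrow> complex" where
  "Phi x b = lim (\<lambda>m. app (wd m b) (x m) z)"

lemma Phi_lim: "x \<in> G \<Longrightarrow> (\<lambda>m. app (wd m b) (x m) z) \<longlonglongrightarrow> Phi x b"
  unfolding Phi_def by (rule convergent_LIMSEQ_iff[THEN iffD1, OF conv_z[OF G_wd]])

lemma rtr_Phi: "app (rtr g) (Phi x) = Phi (\<lambda>m. app (\<rho> m g) (x m))"
  by (rule ext) (simp add: app_rtr Phi_def wd_def)

lemma Phi_sm:
  assumes "x \<in> G" "convergent c"
  shows "Phi (\<lambda>m. sm (c m) (x m)) = sm (lim c) (Phi x)"
proof
  fix b
  have "(\<lambda>m. c m * app (wd m b) (x m) z) \<longlonglongrightarrow> lim c * Phi x b"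
    by (intro tendsto_mult Phi_lim assms convergent_LIMSEQ_iff[THEN iffD1])
  then show "Phi (\<lambda>m. sm (c m) (x m)) b = sm (lim c) (Phi x) b"
    unfolding Phi_def[of "\<lambda>m. sm (c m) (x m)"] by (simp add: sm_apply limI)
qed

lemma Phi_smc: "x \<in> G \<Longrightarrow> Phi (\<lambda>m. sm c (x m)) = sm c (Phi x)"
  using Phi_sm[of x "\<lambda>_. c"] by (simp add: convergent_const)

lemma Phi_add:
  assumes "x \<in> G" "y \<in> G"
  shows "Phi (\<lambda>m. x m + y m) = Phi x + Phi y"
proof
  fix b
  have "(\<lambda>m. app (wd m b) (x m) z + app (wd m b) (y m) z) \<longlonglongrightarrow> Phi x b + Phi y b"
    by (intro tendsto_add Phi_lim assms)
  then show "Phi (\<lambda>m. x m + y m) b = (Phi x + Phi y) b"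
    unfolding Phi_def[of "\<lambda>m. x m + y m"] by (simp add: fun_apply limI)
qed

lemma Phi_diff:
  assumes "x \<in> G" "y \<in> G"
  shows "Phi (\<lambda>m. x m - y m) = Phi x - Phi y"
proof -
  have "Phi (\<lambda>m. x m + sm (-1) (y m)) = Phi x + sm (-1) (Phi y)"
    using Phi_add[OF assms(1) G_smc[OF assms(2)]] Phi_smc[OF assms(2)] by simp
  then show ?thesis by (simp add: sm_minus_left)
qed

lemma Phi_0: "Phi (\<lambda>_. 0) = 0"
  using Phi_smc[OF G_v, of 0] by simp

lemma Phi_sum:
  assumes "\<And>j. xs j \<in> G"
  shows "Phi (\<lambda>m. \<Sum>j\<le>(N::nat). xs j m) = (\<Sum>j\<le>N. Phi (xs j)) \<and> (\<lambda>m. \<Sum>j\<le>N. xs j m) \<in> G"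
proof (induction N)
  case (Suc N)
  then show ?case using Phi_add[of "\<lambda>m. \<Sum>j\<le>N. xs j m" "xs (Suc N)"] G_add[of "\<lambda>m. \<Sum>j\<le>N. xs j m" "xs (Suc N)"] assms
    by simp
qed (simp add: assms)

definition L :: "(gen list \<Rightarrow> complex) set" where "L = Phi ` G"

lemma L_I: "x \<in> G \<Longrightarrow> Phi x \<in> L"
  by (simp add: L_def)

lemma subsp_L: "subsp L"
proof -
  have "0 \<in> L" using L_I[OF G_0] Phi_0 by simp
  moreover have "f + h \<in> L" if "f \<in> L" "h \<in> L" for f h
  proof -
    obtain x where x: "x \<in> G" "f = Phi x" using \<open>f \<in> L\<close> by (auto simp: L_def)
    obtain y where y: "y \<in> G" "h = Phi y" using \<open>h \<in> L\<close> by (auto simp: L_def)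
    show ?thesis using Phi_add[OF x(1) y(1)] L_I[OF G_add[OF x(1) y(1)]] x(2) y(2) by simp
  qed
  moreover have "sm c f \<in> L" if "f \<in> L" for f c
  proof -
    obtain x where x: "x \<in> G" "f = Phi x" using \<open>f \<in> L\<close> by (auto simp: L_def)
    show ?thesis using Phi_smc[OF x(1)] L_I[OF G_smc[OF x(1)]] x(2) by simp
  qed
  ultimately show ?thesis by (simp add: subsp_def)
qed

lemma rtr_L: "f \<in> L \<Longrightarrow> app (rtr g) f \<in> L"
proof -
  assume "f \<in> L"
  then obtain x where x: "x \<in> G" "f = Phi x" by (auto simp: L_def)
  show ?thesis using L_I[OF G_gen[OF x(1)]] x(2) by (simp add: rtr_Phi)
qed

text \<open>A nonzero function \<open>f\<close> has \<open>f b \<noteq> 0\<close> for some word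
  \<open>b\<close>. The image of the vector under \<open>b\<close> then has a top component
  \<open>f b\<close> times \<open>Phi v\<close>, which can be extracted as a weight component, and
  \<open>Phi v\<close> generates \<open>L\<close>.\<close>

lemma simple_L: "simple_on rtr L"
  unfolding simple_on_def
proof (intro allI impI, elim conjE)
  fix W assume W: "W \<subseteq> L" "subsp W" "\<forall>x\<in>W. \<forall>g. app (rtr g) x \<in> W"
  show "W = {0} \<or> W = L"
  proof (cases "W = {0}")
    case False
    then obtain f where f: "f \<in> W" "f \<noteq> 0" using subspD(1)[OF W(2)] by blast
    then obtain b where b: "f b \<noteq> 0" by (auto simp: fun_eq_iff fun_apply)
    obtain x where x: "x \<in> G" "f = Phi x" using f W(1) by (auto simp: L_def)
    have word: "Phi (\<lambda>m. app (wd m b) (x m)) \<in> W" for b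
    proof (induction b)
      case Nil
      then show ?case using f x by (simp add: wd_def)
    next
      case (Cons g b)
      have "Phi (\<lambda>m. app (wd m (g # b)) (x m)) = app (rtr g) (Phi (\<lambda>m. app (wd m b) (x m)))"
        by (simp add: rtr_Phi wd_def)
      then show ?case using Cons W(3) by simp
    qed
    let ?y = "\<lambda>m. app (wd m b) (x m)"
    have y: "?y \<in> G" by (rule G_wd[OF x(1)])
    obtain c N xs where w: "wdec ?y c N xs" using G_wdec[OF y] by blast
    have xs: "xs j \<in> G" for j using w by (simp add: wdec_def)
    have "?y = (\<lambda>m. \<Sum>j\<le>N. xs j m)" using w by (simp add: wdec_def fun_eq_iff)
    then have s: "Phi ?y = (\<Sum>j\<le>N. Phi (xs j))" using Phi_sum[of xs N] xs by simp
    have conv: "convergent c" using w by (simp add: wdec_def)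
    have "Phi (xs 0) \<in> W"
    proof (rule eigen_components[OF W(2), of "rtr KP" N "\<lambda>j. Phi (xs j)" "\<lambda>j. lam * cc ^ j"])
      show "app (rtr KP) x \<in> W" if "x \<in> W" for x using that W(3) by blast
      show "\<forall>j\<le>N. app (rtr KP) (Phi (xs j)) = sm (lam * cc ^ j) (Phi (xs j))"
        using w by (simp add: rtr_Phi wdec_def Phi_smc xs)
      show "inj_on (\<lambda>j. lam * cc ^ j) {..N}" by (rule lam_inj)
      show "(\<Sum>j\<le>N. Phi (xs j)) \<in> W" using word[of b] s by simp
    qed simp
    moreover have "Phi (xs 0) = sm (lim c) (Phi v)"
      using w Phi_sm[OF G_v conv] by (simp add: wdec_def)
    ultimately have "sm (lim c) (Phi v) \<in> W" by simp
    \<comment> \<open>By \<open>wdec_z\<close> the limit of the top coefficients is the value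
      \<open>f b\<close> itself.\<close>
    moreover have "lim c \<noteq> 0"
    proof -
      have "f b = lim (\<lambda>m. ?y m z)" unfolding x(2) Phi_def ..
      also have "(\<lambda>m. ?y m z) = c" using wdec_z[OF w] by (simp add: fun_eq_iff)
      finally show ?thesis using b by simp
    qed
    ultimately have vW: "Phi v \<in> W"
      using subspD(3)[OF W(2), of "sm (lim c) (Phi v)" "1 / lim c"] by simp
    have "Phi x \<in> W" if "x \<in> G" for x
      using that
    proof (induction rule: G.induct)
      case G_v
      show ?case by (rule vW)
    next
      case (G_XM x t)
      then have "app (rtr (XM t)) (Phi x) \<in> W" using W(3) by blast
      then show ?case by (simp add: rtr_Phi)
    next
      case (G_add x y)
      then show ?case using Phi_add[of x y] subspD(2)[OF W(2)] by simp
    next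
      case (G_sm x c)
      then show ?case using Phi_sm[of x c] subspD(3)[OF W(2)] by simp
    qed
    then show ?thesis using W(1) by (auto simp: L_def)
  qed simp
qed

text \<open>Normalised linear relations in the members of the sequence have a convergent subsequence, so the
  dimension cannot grow in the limit.\<close>

lemma dimle_L: "dimle L (card A)"
  unfolding dimle_def
proof (intro allI impI)
  let ?D = "card A"
  fix f assume "\<forall>i\<le>?D. f i \<in> L"
  then have "\<forall>i. \<exists>x. x \<in> G \<and> (i \<le> ?D \<longrightarrow> f i = Phi x)" unfolding L_def using G_v by blast
  then obtain x where x: "\<And>i. x i \<in> G" "\<And>i. i \<le> ?D \<Longrightarrow> f i = Phi (x i)" by metis
  have "\<exists>c. (\<Sum>i\<le>?D. cmod (c i)) = 1 \<and> (\<Sum>i\<le>?D. sm (c i) (x i m)) = 0" for m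
  proof -
    have d: "dimle {x. \<forall>i. i \<notin> A \<longrightarrow> x i = 0} ?D"
      by (rule dimle_support[OF A(1)]) auto
    have xin: "x i m \<in> {x. \<forall>i. i \<notin> A \<longrightarrow> x i = 0}" for i
      by (rule G_in_stable[OF A(2) _ x(1)]) (use A(3) in auto)
    obtain c where c: "\<exists>i\<le>?D. c i \<noteq> 0" "(\<Sum>i\<le>?D. sm (c i) (x i m)) = 0"
      by (rule dimleD[OF d xin])
    define n where "n = (\<Sum>i\<le>?D. cmod (c i))"
    have n: "n > 0" unfolding n_def using c(1) by (auto intro!: sum_pos2)
    have "cmod (c i / of_real n) = cmod (c i) / n" for i using n by (simp add: norm_divide)
    then have "(\<Sum>i\<le>?D. cmod (c i / of_real n)) = n / n"
      by (simp only: sum_divide_distrib[symmetric]) (simp only: n_def)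
    then have "(\<Sum>i\<le>?D. cmod (c i / of_real n)) = 1" using n by simp
    moreover have "(\<Sum>i\<le>?D. sm (c i / of_real n) (x i m)) = 0"
      using arg_cong[OF c(2), of "sm (1 / of_real n)"] by (simp add: sm_sum)
    ultimately show ?thesis by (intro exI[of _ "\<lambda>i. c i / of_real n"]) simp
  qed
  then obtain c where c: "\<And>m. (\<Sum>i\<le>?D. cmod (c m i)) = 1" "\<And>m. (\<Sum>i\<le>?D. sm (c m i) (x i m)) = 0"
    by metis
  define c' where "c' m i = (if i \<le> ?D then c m i else 0)" for m i
  have "cmod (c' m i) \<le> 1" for m i
    using member_le_sum[of i "{..?D}" "\<lambda>i. cmod (c m i)"] c(1)[of m] by (auto simp: c'_def)
  then obtain r d where r: "strict_mono r" "\<And>i. i < Suc ?D \<Longrightarrow> (\<lambda>m. c' (r m) i) \<longlonglongrightarrow> d i"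
    using common_convergent_subsequence[of c' 1 "Suc ?D"] by blast
  have lim: "(\<lambda>m. c (r m) i) \<longlonglongrightarrow> d i" if "i \<le> ?D" for i
    using r(2)[of i] that by (simp add: c'_def)
  have "(\<lambda>m. \<Sum>i\<le>?D. cmod (c (r m) i)) \<longlonglongrightarrow> (\<Sum>i\<le>?D. cmod (d i))"
    by (intro tendsto_sum tendsto_norm lim) simp
  then have "(\<Sum>i\<le>?D. cmod (d i)) = 1" using c(1) by (simp add: LIMSEQ_const_iff)
  then have "\<exists>i\<le>?D. d i \<noteq> 0" by (metis (no_types, lifting) atMost_iff norm_zero sum.neutral zero_neq_one)
  moreover have "(\<Sum>i\<le>?D. sm (d i) (f i)) b = 0" for b
  proof -
    have "(\<lambda>m. \<Sum>i\<le>?D. c (r m) i * app (wd (r m) b) (x i (r m)) z) \<longlonglongrightarrow> (\<Sum>i\<le>?D. d i * Phi (x i) b)"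
      using LIMSEQ_subseq_LIMSEQ[OF Phi_lim[OF x(1)] r(1)]
      by (intro tendsto_sum tendsto_mult lim) (auto simp: o_def)
    moreover have "(\<Sum>i\<le>?D. c (r m) i * app (wd (r m) b) (x i (r m)) z) = 0" for m
    proof -
      have "(\<Sum>i\<le>?D. c (r m) i * app (wd (r m) b) (x i (r m)) z)
          = app (wd (r m) b) (\<Sum>i\<le>?D. sm (c (r m) i) (x i (r m))) z"
        by (simp add: app_sum sum_fun_apply sm_apply)
      then show ?thesis unfolding c(2) by (simp add: fun_apply)
    qed
    ultimately have "(\<Sum>i\<le>?D. d i * Phi (x i) b) = 0" by (simp add: LIMSEQ_const_iff)
    then show ?thesis by (simp add: sum_fun_apply sm_apply x(2))
  qed
  ultimately show "\<exists>c. (\<exists>i\<le>?D. c i \<noteq> 0) \<and> (\<Sum>i\<le>?D. sm (c i) (f i)) = 0"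
    by (intro exI[of _ d]) (auto simp: fun_eq_iff fun_apply)
qed

text \<open>A basis of \<open>L\<close> turns the right translations into matrices. Each relation is
  inherited from the members of the sequence, where it holds exactly, and not checked on functions
  of words.\<close>

lemma limit_module:
  assumes u: "\<And>t. t > 0 \<Longrightarrow> (\<lambda>m. u m t) \<longlonglongrightarrow> u' t"
  shows "\<exists>M. is_L q M (lam, u')"
proof -
  obtain n e where e: "\<And>j. j < n \<Longrightarrow> e j \<in> L"
    "\<And>x. x \<in> L \<Longrightarrow> \<exists>y\<in>Vn n. x = (\<Sum>j<n. sm (y j) (e j))"
    "\<And>y. y \<in> Vn n \<Longrightarrow> (\<Sum>j<n. sm (y j) (e j)) = 0 \<Longrightarrow> y = 0"
    using basis_of_dimle[OF subsp_L dimle_L] by blast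
  define \<Psi> where "\<Psi> y = (\<Sum>j<n. sm (y j) (e j))" for y
  have \<Psi>L: "\<Psi> y \<in> L" for y
    unfolding \<Psi>_def by (rule subsp_sum[OF subsp_L]) (simp add: e(1) subspD(3)[OF subsp_L])
  have \<Psi>_lin: "\<Psi> (x + y) = \<Psi> x + \<Psi> y" "\<Psi> (sm c x) = sm c (\<Psi> x)" "\<Psi> (x - y) = \<Psi> x - \<Psi> y" for x y c
    unfolding \<Psi>_def by (simp_all add: fun_apply sm_apply sm_add_left sm_diff_left sum.distrib sum_subtractf sm_sum)
  have \<Psi>_inj: "x = y" if "x \<in> Vn n" "y \<in> Vn n" "\<Psi> x = \<Psi> y" for x y
  proof -
    have "\<Psi> (x - y) = 0" using that by (simp add: \<Psi>_lin)
    then have "x - y = 0" using e(3)[OF subspD(4)[OF subsp_Vn that(1,2)]] by (simp add: \<Psi>_def)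
    then show ?thesis by simp
  qed
  define \<kappa> where "\<kappa> f = (SOME y. y \<in> Vn n \<and> \<Psi> y = f)" for f
  have \<kappa>: "\<kappa> f \<in> Vn n" "\<Psi> (\<kappa> f) = f" if "f \<in> L" for f
  proof -
    have "\<exists>y. y \<in> Vn n \<and> \<Psi> y = f" using e(2)[OF that] unfolding \<Psi>_def by metis
    from someI_ex[OF this] show "\<kappa> f \<in> Vn n" "\<Psi> (\<kappa> f) = f" by (auto simp: \<kappa>_def)
  qed
  have "\<exists>P. P \<in> carrier_mat n n \<and> (\<forall>w\<in>carrier_vec n. vf (P *\<^sub>v w) = \<kappa> (app (rtr g) (\<Psi> (vf w))))" for g
  proof -
    let ?f = "\<lambda>y. \<kappa> (app (rtr g) (\<Psi> y))"
    have fV: "?f y \<in> Vn n" for y by (rule \<kappa>(1)[OF rtr_L[OF \<Psi>L]])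
    have \<Psi>f: "\<Psi> (?f y) = app (rtr g) (\<Psi> y)" for y by (rule \<kappa>(2)[OF rtr_L[OF \<Psi>L]])
    have "lin_on (Vn n) ?f"
      unfolding lin_on_def
    proof (intro conjI ballI allI)
      fix x y c
      show "?f (x + y) = ?f x + ?f y"
        by (rule \<Psi>_inj[OF fV subspD(2)[OF subsp_Vn fV fV]])
           (simp only: \<Psi>f \<Psi>_lin(1)[of "?f x" "?f y"], simp add: \<Psi>_lin)
      show "?f (sm c x) = sm c (?f x)"
        by (rule \<Psi>_inj[OF fV subspD(3)[OF subsp_Vn fV]])
           (simp only: \<Psi>f \<Psi>_lin(2)[of c "?f x"], simp add: \<Psi>_lin)
    qed
    from lin_on_matrix[OF this fV] show ?thesis by metis
  qed
  then obtain Mg where Mg: "\<And>g. Mg g \<in> carrier_mat n n"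
    "\<And>g w. w \<in> carrier_vec n \<Longrightarrow> vf (Mg g *\<^sub>v w) = \<kappa> (app (rtr g) (\<Psi> (vf w)))" by metis
  define \<theta> where "\<theta> w = \<Psi> (vf w)" for w
  have \<theta>_Mg: "\<theta> (Mg g *\<^sub>v w) = app (rtr g) (\<theta> w)" if "w \<in> carrier_vec n" for g w
    unfolding \<theta>_def Mg(2)[OF that] by (rule \<kappa>(2)[OF rtr_L[OF \<Psi>L]])
  have \<theta>_add: "\<theta> (x + y) = \<theta> x + \<theta> y" if "x \<in> carrier_vec n" "y \<in> carrier_vec n" for x y
    using that by (simp add: \<theta>_def vf_simps \<Psi>_lin)
  have \<theta>_sm: "\<theta> (c \<cdot>\<^sub>v x) = sm c (\<theta> x)" for x c
    by (simp add: \<theta>_def vf_simps \<Psi>_lin)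
  have \<theta>_diff: "\<theta> (x - y) = \<theta> x - \<theta> y" if "x \<in> carrier_vec n" "y \<in> carrier_vec n" for x y
  proof -
    have "x - y = x + (-1) \<cdot>\<^sub>v y" using that by (intro eq_vecI) auto
    then show ?thesis using that by (simp add: \<theta>_add \<theta>_sm sm_minus_left)
  qed
  have \<theta>_inj: "x = y" if "x \<in> carrier_vec n" "y \<in> carrier_vec n" "\<theta> x = \<theta> y" for x y
    using \<Psi>_inj[OF vf_Vn[OF that(1)] vf_Vn[OF that(2)]] that vf_inj[OF that(1,2)] by (simp add: \<theta>_def)
  have \<theta>_surj: "\<exists>w\<in>carrier_vec n. \<theta> w = f" if "f \<in> L" for f
    using \<kappa>[OF that] vf_vec[of "\<kappa> f" n] by (intro bexI[of _ "vec n (\<kappa> f)"]) (auto simp: \<theta>_def)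
  have \<theta>L: "\<theta> w \<in> L" for w by (simp add: \<theta>_def \<Psi>L)
  \<comment> \<open>A matrix corresponds to a sequence of operators if it acts on limits as they act
    on every family representing the same limit. The correspondence respects the algebra operations
    and, by \<open>corr_eq\<close>, equal operators force equal matrices.\<close>
  define corr where "corr B T \<longleftrightarrow> B \<in> carrier_mat n n \<and> (\<forall>x\<in>G. (\<lambda>m. app (T m) (x m)) \<in> G) \<and>
     (\<forall>w\<in>carrier_vec n. \<forall>x\<in>G. \<theta> w = Phi x \<longrightarrow> \<theta> (B *\<^sub>v w) = Phi (\<lambda>m. app (T m) (x m)))"
    for B and T :: "nat \<Rightarrow> 'i lop"
  have corr_gen: "corr (Mg g) (\<lambda>m. \<rho> m g)" for g
    unfolding corr_def using Mg(1) G_gen \<theta>_Mg rtr_Phi by simp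
  have corr_one: "corr (1\<^sub>m n) (\<lambda>_. 1)"
    unfolding corr_def by simp
  have corr_mult: "corr (B * B') (\<lambda>m. T m * T' m)" if c: "corr B T" "corr B' T'" for B B' T T'
    unfolding corr_def
  proof (intro conjI ballI impI)
    show "B * B' \<in> carrier_mat n n" using c by (auto simp: corr_def)
    show "(\<lambda>m. app (T m * T' m) (x m)) \<in> G" if "x \<in> G" for x
      using c that by (auto simp: corr_def)
    fix w x assume w: "w \<in> carrier_vec n" "x \<in> G" "\<theta> w = Phi x"
    have B: "B \<in> carrier_mat n n" "B' \<in> carrier_mat n n" using c by (auto simp: corr_def)
    have "\<theta> (B' *\<^sub>v w) = Phi (\<lambda>m. app (T' m) (x m))" "(\<lambda>m. app (T' m) (x m)) \<in> G"
      using c(2) w unfolding corr_def by blast+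
    moreover have "B' *\<^sub>v w \<in> carrier_vec n" using B w by simp
    ultimately have "\<theta> (B *\<^sub>v (B' *\<^sub>v w)) = Phi (\<lambda>m. app (T m) (app (T' m) (x m)))"
      using c(1) unfolding corr_def by blast
    then show "\<theta> (B * B' *\<^sub>v w) = Phi (\<lambda>m. app (T m * T' m) (x m))" using B w by simp
  qed
  have corr_smult: "corr (c \<cdot>\<^sub>m B) (\<lambda>m. sc c * T m)" if c: "corr B T" for B T c
    unfolding corr_def
  proof (intro conjI ballI impI)
    show "c \<cdot>\<^sub>m B \<in> carrier_mat n n" using that by (auto simp: corr_def)
    show "(\<lambda>m. app (sc c * T m) (x m)) \<in> G" if "x \<in> G" for x
      using c that G_smc by (auto simp: corr_def)
    fix w x assume w: "w \<in> carrier_vec n" "x \<in> G" "\<theta> w = Phi x"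
    have B: "B \<in> carrier_mat n n" using c by (auto simp: corr_def)
    have "\<theta> (B *\<^sub>v w) = Phi (\<lambda>m. app (T m) (x m))" "(\<lambda>m. app (T m) (x m)) \<in> G"
      using c w unfolding corr_def by blast+
    moreover have "(c \<cdot>\<^sub>m B) *\<^sub>v w = c \<cdot>\<^sub>v (B *\<^sub>v w)" using B w by (intro eq_vecI) auto
    ultimately show "\<theta> ((c \<cdot>\<^sub>m B) *\<^sub>v w) = Phi (\<lambda>m. app (sc c * T m) (x m))"
      by (simp add: \<theta>_sm Phi_smc)
  qed
  have corr_minus: "corr (B - B') (\<lambda>m. T m - T' m)" if c: "corr B T" "corr B' T'" for B B' T T'
    unfolding corr_def
  proof (intro conjI ballI impI)
    show "B - B' \<in> carrier_mat n n" using c by (auto simp: corr_def)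
    show "(\<lambda>m. app (T m - T' m) (x m)) \<in> G" if "x \<in> G" for x
      using c that G_diff by (auto simp: corr_def)
    fix w x assume w: "w \<in> carrier_vec n" "x \<in> G" "\<theta> w = Phi x"
    have B: "B \<in> carrier_mat n n" "B' \<in> carrier_mat n n" using c by (auto simp: corr_def)
    have "\<theta> (B *\<^sub>v w) = Phi (\<lambda>m. app (T m) (x m))" "(\<lambda>m. app (T m) (x m)) \<in> G"
       "\<theta> (B' *\<^sub>v w) = Phi (\<lambda>m. app (T' m) (x m))" "(\<lambda>m. app (T' m) (x m)) \<in> G"
      using c w unfolding corr_def by blast+
    moreover have "(B - B') *\<^sub>v w = B *\<^sub>v w - B' *\<^sub>v w" using B w by (intro minus_mult_distrib_mat_vec)
    moreover have "B *\<^sub>v w \<in> carrier_vec n" "B' *\<^sub>v w \<in> carrier_vec n" using B w by auto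
    ultimately show "\<theta> ((B - B') *\<^sub>v w) = Phi (\<lambda>m. app (T m - T' m) (x m))"
      by (simp add: \<theta>_diff Phi_diff)
  qed
  have corr_eq: "B = B'" if c: "corr B T" "corr B' T'" "\<And>m. T m = T' m" for B B' T T'
  proof (rule mat_eqI_vec)
    show B: "B \<in> carrier_mat n n" "B' \<in> carrier_mat n n" using c by (auto simp: corr_def)
    fix w :: "complex vec" assume w: "w \<in> carrier_vec n"
    obtain x where x: "x \<in> G" "\<theta> w = Phi x" using \<theta>L[of w] by (auto simp: L_def)
    have "\<theta> (B *\<^sub>v w) = Phi (\<lambda>m. app (T m) (x m))" "\<theta> (B' *\<^sub>v w) = Phi (\<lambda>m. app (T' m) (x m))"
      using c(1,2) w x unfolding corr_def by blast+
    then have "\<theta> (B *\<^sub>v w) = \<theta> (B' *\<^sub>v w)" by (simp add: c(3))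
    then show "B *\<^sub>v w = B' *\<^sub>v w" using \<theta>_inj B w by simp
  qed
  note corr_intros = corr_gen corr_one corr_mult corr_smult corr_minus
  define M where "M = \<lparr>dim = n, Xp = \<lambda>t. Mg (XP t), Xm = \<lambda>t. Mg (XM t), J = \<lambda>t. Mg (JJ t), Kp = Mg KP, Km = Mg KM\<rparr>"
  have sel: "dim M = n" "Xp M t = Mg (XP t)" "Xm M t = Mg (XM t)" "J M t = Mg (JJ t)" "Kp M = Mg KP" "Km M = Mg KM" for t
    by (simp_all add: M_def)
  have r0: "Mg KP * Mg (JJ t) = Mg (JJ t) * Mg KP" for t
    by (rule corr_eq, (rule corr_intros)+, rule urep.KJ[OF rep])
  have r1: "Mg (JJ s) * Mg (JJ t) = Mg (JJ t) * Mg (JJ s)" for s t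
    by (rule corr_eq, (rule corr_intros)+, rule urep.JJ[OF rep])
  have r2: "Mg KP * Mg KM = 1\<^sub>m n"
    by (rule corr_eq, (rule corr_intros)+, rule urep.KK(1)[OF rep])
  have r3: "Mg KM * Mg KP = 1\<^sub>m n"
    by (rule corr_eq, (rule corr_intros)+, rule urep.KK(2)[OF rep])
  have r4: "Mg KM * Mg KM = 1\<^sub>m n - (q - inverse q) \<cdot>\<^sub>m Mg (JJ 0)"
    by (rule corr_eq, (rule corr_intros)+, rule urep.KM2[OF rep])
  have r5: "Mg (XP (t+1)) * Mg (XP s) - (q^2) \<cdot>\<^sub>m (Mg (XP s) * Mg (XP (t+1))) = (q^2) \<cdot>\<^sub>m (Mg (XP t) * Mg (XP (s+1))) - Mg (XP (s+1)) * Mg (XP t)" for s t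
    by (rule corr_eq, (rule corr_intros)+, rule urep.XXp[OF rep])
  have r6: "Mg (XM (t+1)) * Mg (XM s) - (inverse q^2) \<cdot>\<^sub>m (Mg (XM s) * Mg (XM (t+1))) = (inverse q^2) \<cdot>\<^sub>m (Mg (XM t) * Mg (XM (s+1))) - Mg (XM (s+1)) * Mg (XM t)" for s t
    by (rule corr_eq, (rule corr_intros)+, rule urep.XXm[OF rep])
  have r7: "Mg KP * Mg (XP t) * Mg KM = (q^2) \<cdot>\<^sub>m Mg (XP t)" for t
    by (rule corr_eq, (rule corr_intros)+, rule urep.KXp[OF rep])
  have r8: "Mg KP * Mg (XM t) * Mg KM = (inverse q^2) \<cdot>\<^sub>m Mg (XM t)" for t
    by (rule corr_eq, (rule corr_intros)+, rule urep.KXm[OF rep])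
  have r9: "(q^2) \<cdot>\<^sub>m (Mg (JJ 0) * Mg (XP t)) - (inverse q^2) \<cdot>\<^sub>m (Mg (XP t) * Mg (JJ 0)) = qbr q 2 \<cdot>\<^sub>m Mg (XP t)" for t
    by (rule corr_eq, (rule corr_intros)+, rule urep.J0Xp[OF rep])
  have r10: "(inverse q^2) \<cdot>\<^sub>m (Mg (JJ 0) * Mg (XM t)) - (q^2) \<cdot>\<^sub>m (Mg (XM t) * Mg (JJ 0)) = (- qbr q 2) \<cdot>\<^sub>m Mg (XM t)" for t
    by (rule corr_eq, (rule corr_intros)+, rule urep.J0Xm[OF rep])
  have r11: "Mg (JJ (s+1)) * Mg (XP t) - Mg (XP t) * Mg (JJ (s+1)) = (q^2) \<cdot>\<^sub>m (Mg (JJ s) * Mg (XP (t+1))) - (inverse q^2) \<cdot>\<^sub>m (Mg (XP (t+1)) * Mg (JJ s))" for s t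
    by (rule corr_eq, (rule corr_intros)+, rule urep.JXp[OF rep])
  have r12: "Mg (JJ (s+1)) * Mg (XM t) - Mg (XM t) * Mg (JJ (s+1)) = (inverse q^2) \<cdot>\<^sub>m (Mg (JJ s) * Mg (XM (t+1))) - (q^2) \<cdot>\<^sub>m (Mg (XM (t+1)) * Mg (JJ s))" for s t
    by (rule corr_eq, (rule corr_intros)+, rule urep.JXm[OF rep])
  have r13: "Mg (XP t) * Mg (XM s) - Mg (XM s) * Mg (XP t) = Mg KP * Mg (JJ (s+t))" for s t
    by (rule corr_eq, (rule corr_intros)+, rule urep.XX[OF rep])
  have um: "is_umod q M"
    unfolding is_umod_def Let_def sel comm_def
    by (intro conjI allI Mg(1) r0 r1 r2 r3 r4 r5 r6 r7 r8 r9 r10 r11 r12 r13)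
  have Phiv: "Phi v \<in> L" "Phi v \<noteq> 0"
  proof -
    show "Phi v \<in> L" by (rule L_I[OF G_v])
    have "Phi v [] = 1" using vz by (simp add: Phi_def wd_def)
    then show "Phi v \<noteq> 0" by (auto simp: fun_apply)
  qed
  obtain w0 where w0: "w0 \<in> carrier_vec n" "\<theta> w0 = Phi v" using \<theta>_surj[OF Phiv(1)] by blast
  have \<theta>0: "\<theta> (0\<^sub>v n) = 0" 
  proof -
    have "0 \<cdot>\<^sub>v 0\<^sub>v n = (0\<^sub>v n :: complex vec)" by (intro eq_vecI) auto
    then show ?thesis using \<theta>_sm[of 0 "0\<^sub>v n"] by simp
  qed
  have w0_ne: "w0 \<noteq> 0\<^sub>v n" using w0 \<theta>0 Phiv(2) by auto
  have "n \<noteq> 0"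
  proof
    assume "n = 0"
    then have "w0 = 0\<^sub>v n" using w0(1) by (intro eq_vecI) auto
    then show False using w0_ne by simp
  qed
  have simple: "U = {0\<^sub>v n} \<or> U = carrier_vec n" if U: "is_submodule M U" for U
  proof -
    have Uc: "U \<subseteq> carrier_vec n" "0\<^sub>v n \<in> U" "\<And>x y. x \<in> U \<Longrightarrow> y \<in> U \<Longrightarrow> x + y \<in> U" "\<And>c x. x \<in> U \<Longrightarrow> c \<cdot>\<^sub>v x \<in> U"
      using U unfolding is_submodule_def sel by blast+
    have Ug: "Mg g *\<^sub>v x \<in> U" if "x \<in> U" for g x
      using U that unfolding is_submodule_def sel by (cases g) auto
    let ?W = "\<theta> ` U"
    have "subsp ?W" unfolding subsp_def
    proof (intro conjI ballI allI)
      show "0 \<in> ?W" using imageI[OF Uc(2), of \<theta>] \<theta>0 by simp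
      fix f c assume "f \<in> ?W"
      then obtain x where x: "x \<in> U" "f = \<theta> x" by auto
      show "sm c f \<in> ?W" using imageI[OF Uc(4)[OF x(1), of c], of \<theta>] x(2) \<theta>_sm by simp
      fix h assume "h \<in> ?W"
      then obtain y where y: "y \<in> U" "h = \<theta> y" by auto
      have "\<theta> (x + y) = f + h" using \<theta>_add[of x y] x y Uc(1) by auto
      then show "f + h \<in> ?W" using imageI[OF Uc(3)[OF x(1) y(1)], of \<theta>] by simp
    qed
    moreover have "app (rtr g) f \<in> ?W" if "f \<in> ?W" for f g
    proof -
      obtain x where x: "x \<in> U" "f = \<theta> x" using \<open>f \<in> ?W\<close> by auto
      have "x \<in> carrier_vec n" using x(1) Uc(1) by auto
      then show ?thesis using imageI[OF Ug[OF x(1), of g], of \<theta>] x(2) \<theta>_Mg[of x g] by simp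
    qed
    ultimately have "stable rtr ?W" by (simp add: stable_def)
    moreover have "?W \<subseteq> L" using \<theta>L by auto
    ultimately have "?W = {0} \<or> ?W = L" by (rule simple_onD[OF simple_L])
    then show ?thesis
    proof
      assume W: "?W = {0}"
      have "x = 0\<^sub>v n" if "x \<in> U" for x
      proof (rule \<theta>_inj)
        show "x \<in> carrier_vec n" using that Uc(1) by auto
        have "\<theta> x \<in> {0}" using W that by blast
        then show "\<theta> x = \<theta> (0\<^sub>v n)" using \<theta>0 by simp
      qed simp
      then have "U = {0\<^sub>v n}" using Uc(2) by blast
      then show ?thesis by simp
    next
      assume W: "?W = L"
      have "x \<in> U" if "x \<in> carrier_vec n" for x
      proof -
        have "\<theta> x \<in> ?W" using W \<theta>L by simp
        then obtain y where "y \<in> U" "\<theta> x = \<theta> y" by auto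
        then show ?thesis using \<theta>_inj[OF that, of y] Uc(1) by auto
      qed
      then show ?thesis using Uc(1) by auto
    qed
  qed
  have fs: "fd_simple q M" unfolding fd_simple_def sel using um simple \<open>n \<noteq> 0\<close> by simp
  have Mw: "Mg g *\<^sub>v w0 \<in> carrier_vec n" for g using Mg(1)[of g] w0(1) by simp
  have \<theta>g: "\<theta> (Mg g *\<^sub>v w0) = Phi (\<lambda>m. app (\<rho> m g) (v m))" for g
    using \<theta>_Mg[OF w0(1)] w0(2) rtr_Phi by simp
  have "is_L q M (lam, u')"
    unfolding is_L_def sel fst_conv snd_conv
  proof (intro conjI exI[of _ w0] allI impI)
    show "fd_simple q M" by fact
    show "w0 \<in> carrier_vec n" "w0 \<noteq> 0\<^sub>v n" by fact+
    show "Mg (XP t) *\<^sub>v w0 = 0\<^sub>v n" for t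
      by (rule \<theta>_inj[OF Mw]) (simp_all add: \<theta>g vE Phi_0 \<theta>0)
    show "Mg KP *\<^sub>v w0 = lam \<cdot>\<^sub>v w0"
      by (rule \<theta>_inj[OF Mw]) (use w0 in \<open>simp_all add: \<theta>g vK Phi_smc G_v \<theta>_sm\<close>)
    show "Mg (JJ t) *\<^sub>v w0 = u' t \<cdot>\<^sub>v w0" if "t > 0" for t
    proof (rule \<theta>_inj[OF Mw])
      \<comment> \<open>The eigenvalues of the \<open>J_t\<close> vary with the member, so scalars
        have to pass to the limit together with the vectors.\<close>
      have "convergent (\<lambda>m. u m t)" "lim (\<lambda>m. u m t) = u' t" using u[OF that] by (auto simp: convergentI limI)
      then show "\<theta> (Mg (JJ t) *\<^sub>v w0) = \<theta> (u' t \<cdot>\<^sub>v w0)"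
        using vJ[OF that] Phi_sm[OF G_v, of "\<lambda>m. u m t"] w0 by (simp add: \<theta>g \<theta>_sm)
    qed (use w0 in simp)
  qed
  then show ?thesis by blast
qed

end

section \<open>Approximating an arbitrary polynomial by generic ones\<close>

lemma is_L_cong:
  "is_L q M u \<Longrightarrow> fst u = fst u' \<Longrightarrow> (\<And>t. t > 0 \<Longrightarrow> snd u t = snd u' t) \<Longrightarrow> is_L q M u'"
  by (force simp: is_L_def)

text \<open>A form in which the index sets depend on \<open>t\<close> and \<open>k\<close> only, so
  that limits in the roots can be taken summand by summand.\<close>

lemma p_poly_map:
  "p_poly t q (map f [0..<k]) = (\<Sum>lam\<in>partitions_le t k. inverse q ^ size lam * (q - inverse q) ^ (size lam - 1) *
     (\<Sum>\<alpha>\<in>{\<alpha>::nat list. length \<alpha> = k \<and> filter_mset (\<lambda>a. a \<noteq> 0) (mset \<alpha>) = lam}. \<Prod>i<k. f i ^ (\<alpha> ! i)))"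
  unfolding p_poly_def mon_sym_def length_map length_upt diff_zero
  by (intro sum.cong refl arg_cong2[of _ _ _ _ "(*)"] prod.cong) simp

lemma tendsto_p_poly:
  assumes "\<And>i. i < k \<Longrightarrow> (\<lambda>m. f m i) \<longlonglongrightarrow> f' i"
  shows "(\<lambda>m. p_poly t q (map (f m) [0..<k])) \<longlonglongrightarrow> p_poly t q (map f' [0..<k])"
  unfolding p_poly_map by (intro tendsto_sum tendsto_mult tendsto_const tendsto_prod tendsto_power) (use assms in simp)

lemma eventually_perturb_ne:
  fixes b c :: complex
  assumes "c \<noteq> 0"
  shows "eventually (\<lambda>m. b + c / of_nat (Suc m) \<noteq> 0) sequentially"
proof (cases "b = 0")
  case False
  have "(\<lambda>m. b + c / of_nat (Suc m)) \<longlonglongrightarrow> b + 0"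
    by (intro tendsto_add tendsto_const LIMSEQ_Suc[OF lim_const_over_n])
  then show ?thesis using False tendsto_imp_eventually_ne by fastforce
qed (use assms in \<open>simp del: of_nat_Suc\<close>)

text \<open>Different indices move with different speeds, which separates multiple roots. The speeds
  are \<open>Suc i\<close> rather than \<open>i\<close> so that a root 0 also moves, whatever its
  index.\<close>

lemma generic_perturbation:
  fixes a :: "nat \<Rightarrow> complex"
  defines "\<gamma> \<equiv> \<lambda>m i. a i + of_nat (Suc i) / of_nat (Suc m)"
  shows "\<exists>M. \<forall>m\<ge>M. inj_on (\<gamma> m) {..<k} \<and> (\<forall>i<k. \<gamma> m i \<noteq> 0)"
proof -
  have 1: "eventually (\<lambda>m. \<forall>i\<in>{..<k}. \<gamma> m i \<noteq> 0) sequentially"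
    unfolding \<gamma>_def by (intro eventually_ball_finite ballI eventually_perturb_ne) (auto simp del: of_nat_Suc)
  have 2: "eventually (\<lambda>m. \<forall>i\<in>{..<k}. \<forall>j\<in>{..<k} - {i}. \<gamma> m i - \<gamma> m j \<noteq> 0) sequentially"
  proof (intro eventually_ball_finite ballI)
    fix i j assume "j \<in> {..<k} - {i}"
    then have "(of_nat (Suc i) - of_nat (Suc j) :: complex) \<noteq> 0" by auto
    from eventually_perturb_ne[OF this, of "a i - a j"]
    show "eventually (\<lambda>m. \<gamma> m i - \<gamma> m j \<noteq> 0) sequentially"
      by (rule eventually_mono) (simp add: \<gamma>_def diff_divide_distrib algebra_simps del: of_nat_Suc)
  qed auto
  from eventually_conj[OF 1 2] obtain M where
    M: "\<And>m. m \<ge> M \<Longrightarrow> (\<forall>i\<in>{..<k}. \<gamma> m i \<noteq> 0) \<and> (\<forall>i\<in>{..<k}. \<forall>j\<in>{..<k} - {i}. \<gamma> m i - \<gamma> m j \<noteq> 0)"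
    unfolding eventually_sequentially by blast
  have "inj_on (\<gamma> m) {..<k} \<and> (\<forall>i<k. \<gamma> m i \<noteq> 0)" if "m \<ge> M" for m
    using M[OF that] unfolding inj_on_def by (metis DiffI diff_self empty_iff insert_iff lessThan_iff)
  then show ?thesis by blast
qed

lemma (in quantum) simple_module_exists:
  assumes phi: "\<phi> \<in> C0"
  shows "\<exists>M. is_L q M (u0 q \<phi>)"
proof -
  define k where "k = degree \<phi>"
  define \<beta> where "\<beta> = lead_coeff \<phi>"
  define a where "a i = root_list \<phi> ! i" for i
  have roots: "map a [0..<k] = root_list \<phi>"
    using root_list(2)[OF phi] by (intro nth_equalityI) (auto simp: a_def k_def)
  obtain M0 where M0: "\<And>m. m \<ge> M0 \<Longrightarrow> inj_on (\<lambda>i. a i + of_nat (Suc i) / of_nat (Suc m)) {..<k} \<and>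
     (\<forall>i<k. a i + of_nat (Suc i) / of_nat (Suc m) \<noteq> 0)"
    using generic_perturbation[of a k] by blast
  \<comment> \<open>Shifting by \<open>M0\<close> makes every member of the sequence generic, as the
    locale requires it of all of them.\<close>
  define \<gamma> where "\<gamma> m i = a i + of_nat (Suc i) / of_nat (Suc (m + M0))" for m i
  have gen: "genericmod q k (\<gamma> m) \<beta>" for m
    by (intro genericmod.intro genericmod_axioms.intro quantum_axioms)
       (use M0[of "m + M0"] C0_sq(1)[OF phi] in \<open>auto simp: \<gamma>_def[abs_def] \<beta>_def simp del: of_nat_Suc\<close>)
  have lim\<gamma>: "(\<lambda>m. \<gamma> m i) \<longlonglongrightarrow> a i" for i
  proof -
    have "(\<lambda>m. a i + of_nat (Suc i) / of_nat (Suc m)) \<longlonglongrightarrow> a i + 0"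
      by (intro tendsto_add tendsto_const LIMSEQ_Suc[OF lim_const_over_n])
    from LIMSEQ_ignore_initial_segment[OF this, of M0] show ?thesis by (simp add: \<gamma>_def)
  qed
  define u where "u m t = p_poly t q (map (\<gamma> m) [0..<k])" for m t
  have limu: "(\<lambda>m. u m t) \<longlonglongrightarrow> p_poly t q (root_list \<phi>)" for t
    unfolding u_def roots[symmetric] by (rule tendsto_p_poly[OF lim\<gamma>])
  define \<rho> where "\<rho> m = genericmod.\<rho> q k (\<gamma> m) \<beta>" for m
  have hw: "hw (\<rho> m) (\<beta> * q ^ k, u m) vac'" if "vac' = genericmod.vac" for m vac'
    unfolding that \<rho>_def u_def by (rule genericmod.hw_vac[OF gen])
  define vac' :: "nat set \<Rightarrow> complex" where "vac' = genericmod.vac"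
  note hw = hw[OF vac'_def]
  have lam: "\<beta> * q ^ k \<noteq> 0" using q0 C0_sq(2)[OF phi] by (simp add: \<beta>_def)
  \<comment> \<open>All members share the vacuum vector. The distinguished coordinate is the empty
    set, and the support \<open>Pow {..<k}\<close> bounds the dimension of the limit by 2^k.\<close>
  interpret limfam q \<rho> "\<lambda>_. vac'" "\<beta> * q ^ k" u "{}" "Pow {..<k}"
  proof (intro limfam.intro hwfam.intro hwfam_axioms.intro limfam_axioms.intro quantum_axioms)
    show "urep q (\<rho> m)" for m unfolding \<rho>_def by (rule genericmod.urep_\<rho>[OF gen])
    show "\<beta> * q ^ k \<noteq> 0" by (rule lam)
    show "app (\<rho> m (XP t)) vac' = 0" for m t using hw[of m] by (simp add: hw_def)
    show "app (\<rho> m KP) vac' = sm (\<beta> * q ^ k) vac'" for m using hw[of m] by (simp add: hw_def)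
    show "app (\<rho> m (JJ t)) vac' = sm (u m t) vac'" if "t > 0" for m t using hw[of m] that by (simp add: hw_def)
    show "(\<lambda>_. c) \<in> {c. convergent c}" for c :: complex by (simp add: convergent_const)
    show "(\<lambda>m. c m + d m) \<in> {c. convergent c}" if "c \<in> {c. convergent c}" "d \<in> {c. convergent c}" for c d :: "nat \<Rightarrow> complex"
      using that by (simp add: convergent_add)
    show "(\<lambda>m. c m * d m) \<in> {c. convergent c}" if "c \<in> {c. convergent c}" "d \<in> {c. convergent c}" for c d :: "nat \<Rightarrow> complex"
      using that by (simp add: convergent_mult)
    show "(\<lambda>m. u m t) \<in> {c. convergent c}" for t using limu[of t] by (simp add: convergentI)
    show "vac' {} = 1" by (simp add: vac'_def genericmod.vac_def[OF gen])
    show "app (\<rho> m KP) x {} = \<beta> * q ^ k * x {}" for m x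
      by (simp add: \<rho>_def genericmod.\<rho>.simps[OF gen] app_dop genericmod.mu_def[OF gen])
    show "finite (Pow {..<k})" by simp
    show "vac' i = 0" if "i \<notin> Pow {..<k}" for i
      using that by (auto simp: vac'_def genericmod.vac_def[OF gen])
    show "stable (\<rho> m) {x. \<forall>i. i \<notin> Pow {..<k} \<longrightarrow> x i = 0}" for m
      unfolding stable_def
    proof (intro conjI ballI allI)
      show "subsp {x. \<forall>i. i \<notin> Pow {..<k} \<longrightarrow> x i = 0}" by (auto simp: subsp_def fun_apply sm_apply)
      fix x g assume x: "x \<in> {x :: nat set \<Rightarrow> complex. \<forall>i. i \<notin> Pow {..<k} \<longrightarrow> x i = 0}"
      show "app (\<rho> m g) x \<in> {x. \<forall>i. i \<notin> Pow {..<k} \<longrightarrow> x i = 0}"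
        using x by (cases g) (auto simp: \<rho>_def genericmod.\<rho>.simps[OF gen] app_dop app_mixop)
    qed
  qed
  obtain M where "is_L q M (\<beta> * q ^ k, \<lambda>t. p_poly t q (root_list \<phi>))"
    using limit_module[OF limu] by blast
  then have "is_L q M (u0 q \<phi>)"
    by (rule is_L_cong) (simp_all add: fst_u0 snd_u0[OF phi] \<beta>_def k_def)
  then show ?thesis by blast
qed

theorem mainTheorem9:
  fixes q :: complex
  assumes "q \<noteq> 0" and "\<forall>n>0. q ^ n \<noteq> 1"
  shows "(\<forall>\<phi>\<in>C0. \<exists>M. is_L q M (u0 q \<phi>))
       \<and> (\<forall>\<phi>\<in>C0. \<forall>M N. is_L q M (u0 q \<phi>) \<longrightarrow> is_L q N (u0 q \<phi>) \<longrightarrow> umod_iso M N)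
       \<and> (\<forall>\<phi>\<in>C0. \<forall>\<psi>\<in>C0. \<forall>M N. is_L q M (u0 q \<phi>) \<longrightarrow> is_L q N (u0 q \<psi>) \<longrightarrow> umod_iso M N
             \<longrightarrow> \<phi> = \<psi>)
       \<and> (\<forall>M. fd_simple q M \<longrightarrow> (\<exists>\<phi>\<in>C0. is_L q M (u0 q \<phi>)))"
proof (intro conjI ballI allI impI)
  interpret quantum q by unfold_locales fact+
  note Q = quantum_axioms
  show "\<exists>M. is_L q M (u0 q \<phi>)" if "\<phi> \<in> C0" for \<phi> by (rule simple_module_exists[OF that])
  show "umod_iso M N" if "is_L q M (u0 q \<phi>)" "is_L q N (u0 q \<phi>)" for \<phi> M N
    by (rule hw_modules_iso[OF Q that])
  show "\<phi> = \<psi>" if "\<phi> \<in> C0" "\<psi> \<in> C0" "is_L q M (u0 q \<phi>)" "is_L q N (u0 q \<psi>)" "umod_iso M N" for \<phi> \<psi> M N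
  proof -
    have N: "is_L q N (u0 q \<phi>)" using is_L_iso[OF that(3) _ that(5)] that(4) by (simp add: is_L_def)
    show ?thesis
      by (rule u0_inj[OF that(1,2)]) (use is_L_weight_unique[OF Q N that(4)] in auto)
  qed
  show "\<exists>\<phi>\<in>C0. is_L q M (u0 q \<phi>)" if "fd_simple q M" for M
    by (rule fd_simple_highest_weight[OF Q that])
qed

end
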